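(* Let $\mathbf{F}=(F_1,\ldots,F_d)\in\mathcal{H}(E)^d$, let $\mathbf{m}=(m_1,\ldots,m_d)\in\mathbb{N}^d\setminus\{\mathbf{0}\}$ be a fixed multi-index, and write $\rho^*:=\rho_{|\mathbf{m}|}(\mathbf{F})$, so that $\mathbf{F}$ is a vector of functions meromorphic in $D_{\rho^*}$. Let $\mathcal{P}:=\mathcal{P}_{|\mathbf{m}|}(\mathbf{F})$ be the set of poles of $\mathbf{F}$ in $D_{\rho^*}$. Suppose that $\mathbf{F}$ is polewise independent with respect to $\mathbf{m}$ in $D_{\rho^*}$. Then: (1) The simultaneous Padé–Faber approximant $\mathbf{R}_{n,\mathbf{m}}=(R_{n,\mathbf{m},1},\ldots,R_{n,\mathbf{m},d})$ of $\mathbf{F}$ is uniquely determined for all sufficiently large $n$. (2) For each $\alpha=1,\ldots,d$, $R_{n,\mathbf{m},\alpha}$ converges to $F_\alpha$ as $n\to\infty$ uniformly on each compact subset of $D_{\rho^*}\setminus\mathcal{P}$. Moreover, for each $\alpha=1,\ldots,d$ and each compact set $K\subset D_{\rho^*}\setminus\mathcal{P}$, $$\limsup_{n\to\infty}\|F_\alpha-R_{n,\mathbf{m},\alpha}\|_K^{1/n}\le\frac{\|\Phi\|_K}{\rho^*},$$ where $\|\cdot\|_K$ denotes the sup-norm on $K$, and if $K\subset E$ then $\|\Phi\|_K$ is replaced by $1$. (3) Additionally, $$\limsup_{n\to\infty}\|Q_{n,\mathbf{m}}-Q^{\mathbf{F}}_{|\mathbf{m}|}\|^{1/n}\le\frac{\max_{\lambda\in\mathcal{P}}|\Phi(\lambda)|}{\rho^*},$$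 where $\|\cdot\|$ denotes (for example) the norm on the space of polynomials of degree at most $|\mathbf{m}|$ given by the maximum of the absolute values of the coefficients.
   Context: $\mathbb{N}$ denotes the set of nonnegative integers, $d\ge 1$ is an integer, and $|\mathbf{m}|=m_1+\cdots+m_d$. **The set $E$.** $E\subset\mathbb{C}$ is a compact set containing more than one point such that $\overline{\mathbb{C}}\setminus E$ is simply connected. $\Phi$ is the unique conformal map of $\overline{\mathbb{C}}\setminus E$ onto $\overline{\mathbb{C}}\setminus\{w\in\mathbb{C}:|w|\le1\}$ with $\Phi(\infty)=\infty$ and $\Phi'(\infty)>0$. For $\rho>1$, $\Gamma_\rho:=\{z\in\mathbb{C}:|\Phi(z)|=\rho\}$ and $D_\rho:=E\cup\{z\in\mathbb{C}:|\Phi(z)|<\rho\}$ (the canonical domain of index $\rho$); $D_\infty:=\mathbb{C}$, and division by $\rho=\infty$ gives $0$. Since $\Phi$ is defined only off $E$, for compact $K\not\subset E$ the quantity $\|\Phi\|_K$ means $\sup_{z\in K\setminus E}|\Phi(z)|$. **Faber polynomials and coefficients.** For $n=0,1,2,\ldots$, $$\Phi_n(z):=\frac1{2\pi i}\int_{\Gamma_\rho}\frac{\Phi^n(t)}{t-z}\,dt,\qquad z\in D_\rho,$$ where $\Phi^n$ is the $n$-th power (this gives a polynomial of degree $n$ independent of $\rho>1$). $\mathcal{H}(E)$ is the space of functions holomorphic in some neighborhood of $E$, and $\mathcal{H}(E)^d$ is the set of $d$-tuples of such functions. For $G\in\mathcal{H}(E)$, the Faber coefficients are $[G]_n:=\frac1{2\pi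 i}\int_{\Gamma_\rho}\frac{G(t)\Phi'(t)}{\Phi^{n+1}(t)}\,dt$, with $\rho>1$ close enough to $1$ that $G$ is holomorphic on a neighborhood of $\overline{D_\rho}$; the Faber series $\sum_{n\ge0}[G]_n\Phi_n$ converges to $G$ uniformly on compact subsets of the largest canonical domain to which $G$ extends holomorphically. **Simultaneous Padé–Faber approximants.** Let $\mathbf{F}\in\mathcal{H}(E)^d$ and $\mathbf{m}\in\mathbb{N}^d\setminus\{\mathbf{0}\}$. For each $n\ge\max\{m_1,\ldots,m_d\}$ there exist polynomials $Q_{n,\mathbf{m}}$ and $P_{n,\mathbf{m},\alpha}$, $\alpha=1,\ldots,d$, such that $$\deg P_{n,\mathbf{m},\alpha}\le n-m_\alpha,\quad \deg Q_{n,\mathbf{m}}\le|\mathbf{m}|,\quad Q_{n,\mathbf{m}}\not\equiv0,$$ and for all $\alpha=1,\ldots,d$ the Faber expansion of $Q_{n,\mathbf{m}}F_\alpha-P_{n,\mathbf{m},\alpha}$ has the form $$Q_{n,\mathbf{m}}F_\alpha-P_{n,\mathbf{m},\alpha}=a^{(\alpha)}_{n+1,n}\Phi_{n+1}+a^{(\alpha)}_{n+2,n}\Phi_{n+2}+\cdots,$$ i.e. $[Q_{n,\mathbf{m}}F_\alpha-P_{n,\mathbf{m},\alpha}]_k=0$ for $0\le k\le n$. The vector of rational functions $\mathbf{R}_{n,\mathbf{m}}:=(R_{n,\mathbf{m},1},\ldots,R_{n,\mathbf{m},d})$, $R_{n,\mathbf{m},\alpha}:=P_{n,\mathbf{m},\alpha}/Q_{n,\mathbf{m}}$,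 is called an $(n,\mathbf{m})$ (linear) simultaneous Padé–Faber approximant of $\mathbf{F}$. It may fail to be unique in general; for each $n$ one (arbitrary) solution is taken. "Uniquely determined" means that all solutions give the same vector $\mathbf{R}_{n,\mathbf{m}}$. **Poles of a vector.** Let $\mathbf{F}\in\mathcal{H}(E)^d$ be a vector of functions meromorphic in a domain $D$ (the meromorphic extensions are still denoted $F_\alpha$). A point $\lambda$ is a pole of $\mathbf{F}$ in $D$ of order $\tau$ if for some $\alpha$ it is a pole of $F_\alpha$ of order $\tau$ and, for every $j\neq\alpha$, $\lambda$ is either not a pole of $F_j$ or a pole of $F_j$ of order at most $\tau$. The number of poles of $\mathbf{F}$ is counted with these orders (multiplicities). $\rho_{|\mathbf{m}|}(\mathbf{F})\in(1,\infty]$ is the index $\rho$ of the largest canonical domain $D_\rho$ inside of which $\mathbf{F}$ is (extends to be) meromorphic with at most $|\mathbf{m}|$ poles. $\mathcal{P}_{|\mathbf{m}|}(\mathbf{F})=\{\lambda_1,\ldots,\lambda_q\}$ is the set of distinct poles of $\mathbf{F}$ in $D_{\rho_{|\mathbf{m}|}(\mathbf{F})}$. **Polewise independence.** Let $\mathbf{F}\in\mathcal{H}(E)^d$ be meromorphic in $D_\rho$. $\mathbf{F}$ is polewise independent with respect to $\mathbf{m}$ in $D_\rho$ if and only if there do not exist polynomials $v_1,\ldots,v_d$, at least one of which is non-null, such that (i) $\deg v_\alpha\le m_\alpha-1$ if $m_\alpha\ge1$; (ii) $v_\alpha\equiv0$ if $m_\alpha=0$; (iii) $\sum_{\alpha=1}^d(v_\alpha\circ\Phi)\cdot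 F_\alpha\in\mathcal{H}(D_\rho\setminus E)$, where $\mathcal{H}(D_\rho\setminus E)$ is the space of holomorphic functions in $D_\rho\setminus E$ (i.e. the meromorphic function in (iii) has only removable singularities in $D_\rho\setminus E$). **Normalization.** Let $L:=\bigl(1+\min_{j=1,\ldots,q}|\Phi(\lambda_j)|\bigr)/2$. The polynomial $Q_{n,\mathbf{m}}$, with zeros $\lambda_{n,j}$ (counted with multiplicity), is normalized by $$Q_{n,\mathbf{m}}(z)=\prod_{|\Phi(\lambda_{n,j})|\le L}(z-\lambda_{n,j})\prod_{|\Phi(\lambda_{n,j})|>L}\Bigl(1-\frac{z}{\lambda_{n,j}}\Bigr),$$ where zeros lying in $E$ are placed in the first product. $Q^{\mathbf{F}}_{|\mathbf{m}|}$ is the polynomial whose zeros are the poles of $\mathbf{F}$ in $D_{\rho_{|\mathbf{m}|}(\mathbf{F})}$, counted with multiplicity, normalized in the same way; thus $Q^{\mathbf{F}}_{|\mathbf{m}|}(z)=\prod_{j=1}^q(1-z/\lambda_j)^{\tau_j}$, where $\tau_j$ is the order of the pole $\lambda_j$.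
   Formalization: Part (3) is stated under the assumption that 0 is not a pole of F in the domain D_{ρ*}; if 0 is a pole, the factor 1 − z/λ in the normalized polynomial Q^F_{|m|} is undefined, so the claim has no meaning as written. *)

theory Defs
  imports
    "HOL-Complex_Analysis.Complex_Analysis"
    "HOL-Computational_Algebra.Fraction_Field"
begin

text \<open>
  The Riemann sphere is the Euclidean unit sphere of \<^typ>\<open>complex \<times> real\<close>, whose point
  \<^term>\<open>(0::complex, 1::real)\<close> is infinity; \<open>stereo\<close> is the inverse stereographic projection.
\<close>

definition stereo :: "complex \<Rightarrow> complex \<times> real" where
  "stereo z =
     ((2 / ((norm z)\<^sup>2 + 1)) *\<^sub>R z, ((norm z)\<^sup>2 - 1) / ((norm z)\<^sup>2 + 1))"

definition sphere_complement :: "complex set \<Rightarrow> (complex \<times> real) set" where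
  "sphere_complement E = sphere 0 1 - stereo ` E"

text \<open>
  Conformal map of the complement of \<open>E\<close> in the sphere onto the exterior of the closed unit disc,
  fixing infinity, with \<open>\<Phi>'(\<infinity>) = lim \<Phi>(z)/z > 0\<close>. The values of \<open>\<Phi>\<close> on \<open>E\<close> are arbitrary, and no
  definition below depends on them.
\<close>

definition exterior_map :: "complex set \<Rightarrow> (complex \<Rightarrow> complex) \<Rightarrow> bool" where
  "exterior_map E \<Phi> \<longleftrightarrow>
     \<Phi> holomorphic_on (- E) \<and>
     bij_betw \<Phi> (- E) {w. norm w > 1} \<and>
     filterlim \<Phi> at_infinity at_infinity \<and>
     (\<exists>c::real. c > 0 \<and> ((\<lambda>z. \<Phi> z / z) \<longlongrightarrow> of_real c) at_infinity)"

definition canonical_domain :: "complex set \<Rightarrow> (complex \<Rightarrow> complex) \<Rightarrow> ereal \<Rightarrow> complex set" where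
  "canonical_domain E \<Phi> \<rho> = E \<union> {z. z \<notin> E \<and> ereal (norm (\<Phi> z)) < \<rho>}"

text \<open>
  The positively oriented level curve \<open>|\<Phi>| = \<rho>\<close>, as the image of a circle under the inverse of \<open>\<Phi>\<close>.
\<close>

definition level_path :: "complex set \<Rightarrow> (complex \<Rightarrow> complex) \<Rightarrow> real \<Rightarrow> real \<Rightarrow> complex" where
  "level_path E \<Phi> \<rho> = inv_into (- E) \<Phi> \<circ> circlepath 0 \<rho>"

text \<open>By Cauchy's theorem the value does not depend on which admissible \<open>\<rho>\<close> is chosen.\<close>

definition faber_coeff ::
    "complex set \<Rightarrow> (complex \<Rightarrow> complex) \<Rightarrow> (complex \<Rightarrow> complex) \<Rightarrow> nat \<Rightarrow> complex" where
  "faber_coeff E \<Phi> G n =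
     (let \<rho> = (SOME \<rho>::real. \<rho> > 1 \<and> G analytic_on closure (canonical_domain E \<Phi> (ereal \<rho>)))
      in contour_integral (level_path E \<Phi> \<rho>) (\<lambda>t. G t * deriv \<Phi> t / \<Phi> t ^ (n + 1))
           / (2 * of_real pi * \<i>))"

definition pade_faber ::
    "complex set \<Rightarrow> (complex \<Rightarrow> complex) \<Rightarrow> ('d::finite \<Rightarrow> complex \<Rightarrow> complex) \<Rightarrow> ('d \<Rightarrow> nat) \<Rightarrow>
     nat \<Rightarrow> complex poly \<Rightarrow> ('d \<Rightarrow> complex poly) \<Rightarrow> bool" where
  "pade_faber E \<Phi> F m n Q P \<longleftrightarrow>
     Q \<noteq> 0 \<and> degree Q \<le> (\<Sum>\<alpha>\<in>UNIV. m \<alpha>) \<and>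
     (\<forall>\<alpha>. degree (P \<alpha>) \<le> n - m \<alpha> \<and>
          (\<forall>k\<le>n. faber_coeff E \<Phi> (\<lambda>z. poly Q z * F \<alpha> z - poly (P \<alpha>) z) k = 0))"

definition vec_poles :: "('d::finite \<Rightarrow> complex \<Rightarrow> complex) \<Rightarrow> complex set \<Rightarrow> complex set" where
  "vec_poles F D = {z \<in> D. \<exists>\<alpha>. is_pole (F \<alpha>) z}"

text \<open>Only meaningful where at least one component has a pole.\<close>

definition vec_pole_order :: "('d::finite \<Rightarrow> complex \<Rightarrow> complex) \<Rightarrow> complex \<Rightarrow> nat" where
  "vec_pole_order F z = Max {nat (- zorder (F \<alpha>) z) |\<alpha>. is_pole (F \<alpha>) z}"

text \<open>
  Index of the largest canonical domain to which the germ of \<open>F\<close> on \<open>E\<close> extends meromorphically with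
  at most \<open>N\<close> poles. Only the values of \<open>F\<close> near \<open>E\<close> matter.
\<close>

definition mero_index ::
    "complex set \<Rightarrow> (complex \<Rightarrow> complex) \<Rightarrow> nat \<Rightarrow> ('d::finite \<Rightarrow> complex \<Rightarrow> complex) \<Rightarrow> ereal" where
  "mero_index E \<Phi> N F =
     Sup {\<rho>. 1 < \<rho> \<and>
            (\<exists>G. (\<forall>\<alpha>. G \<alpha> meromorphic_on canonical_domain E \<Phi> \<rho> \<and>
                      (\<exists>U. open U \<and> E \<subseteq> U \<and> (\<forall>z\<in>U. G \<alpha> z = F \<alpha> z))) \<and>
                 finite (vec_poles G (canonical_domain E \<Phi> \<rho>)) \<and>
                 (\<Sum>z\<in>vec_poles G (canonical_domain E \<Phi> \<rho>). vec_pole_order G z) \<le> N)}"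

definition polewise_independent ::
    "complex set \<Rightarrow> (complex \<Rightarrow> complex) \<Rightarrow> ('d::finite \<Rightarrow> complex \<Rightarrow> complex) \<Rightarrow> ('d \<Rightarrow> nat) \<Rightarrow>
     ereal \<Rightarrow> bool" where
  "polewise_independent E \<Phi> F m \<rho> \<longleftrightarrow>
     \<not> (\<exists>v :: 'd \<Rightarrow> complex poly.
          (\<exists>\<alpha>. v \<alpha> \<noteq> 0) \<and>
          (\<forall>\<alpha>. m \<alpha> \<ge> 1 \<longrightarrow> degree (v \<alpha>) \<le> m \<alpha> - 1) \<and>
          (\<forall>\<alpha>. m \<alpha> = 0 \<longrightarrow> v \<alpha> = 0) \<and>
          remove_sings (\<lambda>z. \<Sum>\<alpha>\<in>UNIV. poly (v \<alpha>) (\<Phi> z) * F \<alpha> z)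
            holomorphic_on (canonical_domain E \<Phi> \<rho> - E))"

text \<open>
  The scalar multiple of \<open>Q\<close> singled out by the threshold \<open>L\<close>. A zero at the origin that belongs to
  the second product cannot be normalized this way; in that case division by zero makes its factor
  equal to 1, and the result is not a multiple of \<open>Q\<close>.
\<close>

definition normalized_poly ::
    "complex set \<Rightarrow> (complex \<Rightarrow> complex) \<Rightarrow> real \<Rightarrow> complex poly \<Rightarrow> complex poly" where
  "normalized_poly E \<Phi> L Q =
     (\<Prod>\<zeta> | poly Q \<zeta> = 0 \<and> (\<zeta> \<in> E \<or> norm (\<Phi> \<zeta>) \<le> L). [:- \<zeta>, 1:] ^ order \<zeta> Q) *
     (\<Prod>\<zeta> | poly Q \<zeta> = 0 \<and> \<zeta> \<notin> E \<and> norm (\<Phi> \<zeta>) > L. [:1, - 1 / \<zeta>:] ^ order \<zeta> Q)"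

definition pole_poly :: "('d::finite \<Rightarrow> complex \<Rightarrow> complex) \<Rightarrow> complex set \<Rightarrow> complex poly" where
  "pole_poly F D = (\<Prod>\<zeta>\<in>vec_poles F D. [:1, - 1 / \<zeta>:] ^ vec_pole_order F \<zeta>)"

definition pole_threshold ::
    "(complex \<Rightarrow> complex) \<Rightarrow> ('d::finite \<Rightarrow> complex \<Rightarrow> complex) \<Rightarrow> complex set \<Rightarrow> real" where
  "pole_threshold \<Phi> F D = (1 + Min ((\<lambda>\<zeta>. norm (\<Phi> \<zeta>)) ` vec_poles F D)) / 2"

text \<open>
  The inserted 0 only matters for empty \<open>K\<close>. The value is meaningful only when \<open>f\<close> is bounded on \<open>K\<close>.
\<close>

definition sup_norm :: "complex set \<Rightarrow> (complex \<Rightarrow> complex) \<Rightarrow> real" where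
  "sup_norm K f = Sup (insert 0 ((\<lambda>z. norm (f z)) ` K))"

definition map_norm :: "complex set \<Rightarrow> (complex \<Rightarrow> complex) \<Rightarrow> complex set \<Rightarrow> real" where
  "map_norm E \<Phi> K = (if K \<subseteq> E then 1 else (SUP z\<in>K - E. norm (\<Phi> z)))"

definition coeff_norm :: "nat \<Rightarrow> complex poly \<Rightarrow> real" where
  "coeff_norm N p = Max ((\<lambda>i. norm (coeff p i)) ` {..N})"

end

theory Submission
  imports Defs "HOL-Computational_Algebra.Fundamental_Theorem_Algebra"
begin

text \<open>
  Let \<open>\<Psi>\<close> be the inverse of \<open>\<Phi>\<close>. Substituting \<open>t = \<Psi> w\<close>, Faber coefficients become the Laurent coefficients
  of \<open>G \<circ> \<Psi>\<close> with nonnegative index. Let \<open>q\<close> be the monic polynomial of the poles. Since \<open>deg P \<le> n - m\<close>,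
  a denominator \<open>Q\<close> satisfies \<open>[Q F]\<^sub>n\<^sub>-\<^sub>j = 0\<close> for \<open>j < m\<close>, that is, \<open>[Q V]\<^sub>n = 0\<close> for every
  \<open>V = \<Sum> (v \<circ> \<Phi>) F\<close> with \<open>deg v < m\<close>. By polewise independence the map taking \<open>v\<close> to the remainder of
  \<open>q V\<close> modulo \<open>q\<close> is injective, hence, by counting dimensions, bijective and \<open>deg q = |m|\<close>. So for
  every \<open>u\<close> of smaller degree some \<open>V\<close> equals \<open>u / q\<close> up to a holomorphic function, whose contribution
  to the Faber coefficient is \<open>O(r\<^sup>-\<^sup>n)\<close> for each \<open>r < \<rho>\<close>. This bounds \<open>Q\<close> modulo \<open>q\<close> by \<open>O((\<mu> / r)\<^sup>n)\<close>, where \<open>\<mu>\<close>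
  exceeds \<open>|\<Phi>|\<close> at all poles, which yields uniqueness and the rate for \<open>Q\<close>. The same estimate bounds
  all coefficients \<open>[Q F]\<^sub>k\<close>, hence \<open>e = Q F - P\<close> near \<open>E\<close> and \<open>P\<close> near the boundary; the maximum principle
  for \<open>q e / \<Phi>\<^sup>n\<close> interpolates between the two.
\<close>

section \<open>The exterior map and its inverse\<close>

text \<open>The obstacle is that a contour cannot cross the poles, while the decay wanted is that of
  a level \<open>r\<close> beyond them. A function without poles between the levels moves freely
  from a level \<open>s\<close> near \<open>E\<close> to \<open>r\<close>, where Cauchy's bound
  yields r^-n. For Q f / q the same works once the remainder of f modulo q is subtracted from f.
  This remainder is the whole price of the crossing, and it is paid one power t^l at a time. A
  solution is fixed at best up to a factor, so estimates are relative to the size of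
  \<open>Q\<close>, with constants chosen before \<open>n\<close> and \<open>Q\<close>. The final
  interpolation is needed because the Faber expansion of Q F converges only up to the nearest pole:
  between and beyond the poles the error cannot be read off its coefficients. The factor q removes
  the poles of the error, and division by \<Phi>^n makes a bound of size (s / r)^n near
  \<open>E\<close> comparable with a bound of size 1 far out. Every step gives up a little in its
  radii. Nothing is lost in the end, because the limit superior is controlled by rates S / r for all
  S above and all r below the limiting values.\<close>

locale exterior =
  fixes E :: "complex set" and \<Phi> :: "complex \<Rightarrow> complex"
  assumes compact_E: "compact E" and E_ne: "E \<noteq> {}" and ext: "exterior_map E \<Phi>"
begin

definition Psi :: "complex \<Rightarrow> complex" where "Psi = inv_into (- E) \<Phi>"

abbreviation lp :: "real \<Rightarrow> real \<Rightarrow> complex" where "lp \<equiv> level_path E \<Phi>"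

abbreviation dom :: "ereal \<Rightarrow> complex set" where "dom \<equiv> canonical_domain E \<Phi>"

abbreviation level :: "real \<Rightarrow> complex set" where
  "level s \<equiv> {z. z \<notin> E \<and> norm (\<Phi> z) = s}"

abbreviation sublevel :: "real \<Rightarrow> complex set" where
  "sublevel s \<equiv> E \<union> {z. z \<notin> E \<and> norm (\<Phi> z) \<le> s}"

lemma Phi_holo: "\<Phi> holomorphic_on - E"
  and Phi_bij: "bij_betw \<Phi> (- E) {w. norm w > 1}"
  and Phi_lim: "filterlim \<Phi> at_infinity at_infinity"
  using ext by (auto simp: exterior_map_def)

lemma open_E: "open (- E)"
  using compact_E by (simp add: compact_imp_closed open_Compl)

lemma Phi_Psi: "1 < norm w \<Longrightarrow> \<Phi> (Psi w) = w"
  and Psi_notin: "1 < norm w \<Longrightarrow> Psi w \<notin> E"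
  using bij_betw_inv_into_right[OF Phi_bij] bij_betwE[OF bij_betw_inv_into[OF Phi_bij]]
  by (auto simp: Psi_def)

lemma Psi_Phi: "z \<notin> E \<Longrightarrow> Psi (\<Phi> z) = z"
  and norm_Phi: "z \<notin> E \<Longrightarrow> 1 < norm (\<Phi> z)"
  using bij_betw_inv_into_left[OF Phi_bij] bij_betwE[OF Phi_bij]
  by (auto simp: Psi_def)

lemma Phi_nz: "z \<notin> E \<Longrightarrow> \<Phi> z \<noteq> 0"
  using norm_Phi[of z] by auto

lemma Psi_holo_deriv:
  shows Psi_holo: "Psi holomorphic_on {w. 1 < norm w}"
    and deriv_Psi: "\<And>w. 1 < norm w \<Longrightarrow> deriv \<Phi> (Psi w) * deriv Psi w = 1"
proof -
  have inj: "inj_on \<Phi> (- E)" using Phi_bij by (simp add: bij_betw_def)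
  have im: "\<Phi> ` (- E) = {w. 1 < norm w}" using Phi_bij by (simp add: bij_betw_def)
  obtain g where g: "g holomorphic_on {w. 1 < norm w}"
      "\<And>z. z \<in> - E \<Longrightarrow> deriv \<Phi> z * deriv g (\<Phi> z) = 1" "\<And>z. z \<in> - E \<Longrightarrow> g (\<Phi> z) = z"
    using holomorphic_has_inverse[OF Phi_holo open_E inj] unfolding im by metis
  have o: "open {w::complex. 1 < norm w}" by (intro open_Collect_less continuous_intros)
  have eq: "g w = Psi w" if "1 < norm w" for w
    using g(3)[of "Psi w"] Phi_Psi[OF that] Psi_notin[OF that] by simp
  show "Psi holomorphic_on {w. 1 < norm w}"
    using g(1) by (rule holomorphic_transform) (use eq in auto)
  fix w :: complex assume w: "1 < norm w"
  have "deriv g w = deriv Psi w"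
    using w eq o by (intro deriv_cong_ev eventually_mono[OF eventually_nhds_in_open[OF o]]) auto
  then show "deriv \<Phi> (Psi w) * deriv Psi w = 1"
    using g(2)[of "Psi w"] Phi_Psi[OF w] Psi_notin[OF w] by simp
qed

lemma open_ext: "open {w::complex. a < norm w}"
  by (intro open_Collect_less continuous_intros)

lemma Psi_cont: "continuous_on {w. 1 < norm w} Psi"
  using Psi_holo by (rule holomorphic_on_imp_continuous_on)

lemma Phi_cont: "continuous_on (- E) \<Phi>"
  using Phi_holo by (rule holomorphic_on_imp_continuous_on)

lemma deriv_Phi_nz: "z \<notin> E \<Longrightarrow> deriv \<Phi> z \<noteq> 0"
  using deriv_Psi[of "\<Phi> z"] norm_Phi[of z] Psi_Phi[of z] by auto

lemma deriv_Phi_holo: "deriv \<Phi> holomorphic_on - E"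
  by (rule holomorphic_deriv[OF Phi_holo open_E])

lemma open_lev_gt: "open {z. z \<notin> E \<and> a < norm (\<Phi> z)}"
proof -
  have "open ((- E) \<inter> (\<Phi> -` {w. a < norm w}))"
    using continuous_open_preimage[OF Phi_cont open_E open_ext] .
  moreover have "(- E) \<inter> (\<Phi> -` {w. a < norm w}) = {z. z \<notin> E \<and> a < norm (\<Phi> z)}" by auto
  ultimately show ?thesis by simp
qed

lemma open_lev_between: "open {z. z \<notin> E \<and> a < norm (\<Phi> z) \<and> ereal (norm (\<Phi> z)) < b}"
proof -
  have "open {w::complex. ereal (norm w) < b}"
    by (cases b) (auto intro!: open_Collect_less continuous_intros)
  then have "open ((- E) \<inter> (\<Phi> -` ({w. a < norm w} \<inter> {w. ereal (norm w) < b})))"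
    by (intro continuous_open_preimage[OF Phi_cont open_E] open_Int open_ext)
  moreover have "(- E) \<inter> (\<Phi> -` ({w. a < norm w} \<inter> {w. ereal (norm w) < b}))
      = {z. z \<notin> E \<and> a < norm (\<Phi> z) \<and> ereal (norm (\<Phi> z)) < b}" by auto
  ultimately show ?thesis by simp
qed

lemma Phi_large: "\<exists>R. \<forall>z. z \<notin> E \<longrightarrow> norm (\<Phi> z) \<le> B \<longrightarrow> norm z \<le> R"
proof -
  have "eventually (\<lambda>z. norm (\<Phi> z) > B) at_infinity"
    using filterlim_at_infinity_imp_norm_at_top[OF Phi_lim] by (simp add: filterlim_at_top_dense)
  then obtain R where "\<And>z. R \<le> norm z \<Longrightarrow> B < norm (\<Phi> z)"
    by (auto simp: eventually_at_infinity)
  then show ?thesis by (meson leD linear)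
qed

lemma compact_sublevel: "compact (sublevel s)"
proof -
  have "sublevel s = - {z. z \<notin> E \<and> s < norm (\<Phi> z)}" by auto
  then have "closed (sublevel s)"
    by (simp add: open_lev_gt closed_open)
  moreover obtain R where "\<forall>z. z \<notin> E \<longrightarrow> norm (\<Phi> z) \<le> s \<longrightarrow> norm z \<le> R" using Phi_large by blast
  then have "bounded {z. z \<notin> E \<and> norm (\<Phi> z) \<le> s}" by (auto simp: bounded_iff)
  with compact_E have "bounded (sublevel s)"
    by (simp add: compact_imp_bounded)
  ultimately show ?thesis by (simp add: compact_eq_bounded_closed)
qed

lemma Psi_image: "(\<And>x. x \<in> A \<Longrightarrow> 1 < x) \<Longrightarrow> Psi ` {w. norm w \<in> A} = {z. z \<notin> E \<and> norm (\<Phi> z) \<in> A}"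
proof (intro set_eqI iffI)
  fix z assume "z \<in> {z. z \<notin> E \<and> norm (\<Phi> z) \<in> A}"
  then show "z \<in> Psi ` {w. norm w \<in> A}"
    using Psi_Phi[of z] by (intro image_eqI[of _ _ "\<Phi> z"]) auto
qed (use Phi_Psi Psi_notin in auto)

lemma compact_level: "1 < s \<Longrightarrow> compact (level s)"
proof -
  assume s: "1 < s"
  have "continuous_on (sphere 0 s) Psi"
    by (rule continuous_on_subset[OF Psi_cont]) (use s in auto)
  then have "compact (Psi ` sphere 0 s)" by (rule compact_continuous_image) simp
  moreover have "sphere (0::complex) s = {w. norm w \<in> {s}}" by auto
  ultimately show ?thesis
    using Psi_image[of "{s}"] s by simp
qed

lemma dom_subset: "a \<le> b \<Longrightarrow> dom a \<subseteq> dom b"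
  by (auto simp: canonical_domain_def)

lemma E_sub_dom: "E \<subseteq> dom a"
  by (auto simp: canonical_domain_def)

text \<open>In the coordinate 1 / z the map becomes g \<zeta> = 1 / \<Phi>(1/\<zeta>), with a
  removable zero at 0. By the open mapping theorem g takes all small values already near 0, and
  since \<open>Psi\<close> inverts \<Phi>, these are the values of \<open>Psi\<close> at large
  arguments.\<close>

lemma Psi_at_infinity: "filterlim Psi at_infinity at_infinity"
proof -
  obtain b where b: "\<And>z. b \<le> norm z \<Longrightarrow> z \<notin> E" "b > 0"
  proof -
    obtain c where "\<And>z. z \<in> E \<Longrightarrow> norm z \<le> c" "c > 0"
      using compact_imp_bounded[OF compact_E] bounded_pos by metis
    then show ?thesis by (intro that[of "c+1"]) force+
  qed
  define g where "g = (\<lambda>\<zeta>. if \<zeta> = 0 then 0 else 1 / \<Phi> (1 / \<zeta>))"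
  have outE: "1 / \<zeta> \<notin> E" if "norm \<zeta> < 1 / b" "\<zeta> \<noteq> 0" for \<zeta>
    using that b by (intro b(1)) (auto simp: norm_divide field_simps)
  have holo: "g holomorphic_on ball 0 (1/b)"
  proof -
    have "(\<lambda>\<zeta>. 1 / \<Phi> (1 / \<zeta>)) holomorphic_on ball 0 (1/b) - {0}"
      using outE Phi_nz
      by (intro holomorphic_intros holomorphic_on_compose_gen[OF _ Phi_holo, unfolded o_def]) auto
    moreover have "((\<lambda>\<zeta>. 1 / \<Phi> (1 / \<zeta>)) \<longlongrightarrow> 0) (at 0)"
    proof -
      have "filterlim (\<lambda>\<zeta>::complex. 1 / \<zeta>) at_infinity (at 0)"
        using filterlim_inverse_at_infinity by (simp add: inverse_eq_divide[abs_def])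
      then have "filterlim (\<lambda>\<zeta>. \<Phi> (1 / \<zeta>)) at_infinity (at 0)"
        by (rule filterlim_compose[OF Phi_lim])
      then show ?thesis
        by (intro tendsto_divide_0[OF tendsto_const])
    qed
    ultimately show ?thesis
      unfolding g_def by (intro removable_singularity) auto
  qed
  show ?thesis
    unfolding filterlim_at_infinity[OF order_refl]
  proof (intro allI impI)
    fix r :: real assume "0 < r"
    define \<delta> where "\<delta> = 1 / max r b"
    have \<delta>: "0 < \<delta>" "\<delta> \<le> 1 / b" "\<delta> \<le> 1 / r"
      using b \<open>0 < r\<close> by (auto simp: \<delta>_def field_simps)
    have sub: "ball (0::complex) \<delta> \<subseteq> ball 0 (1/b)" using \<delta> by (auto intro: subset_ball)
    \<comment> \<open>Openness requires g to be non-constant: it vanishes at 0 and nowhere else on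
      the disc.\<close>
    have nc: "\<not> g constant_on ball 0 (1/b)"
    proof
      assume "g constant_on ball 0 (1/b)"
      then obtain k where k: "\<And>z. z \<in> ball 0 (1/b) \<Longrightarrow> g z = k" by (auto simp: constant_on_def)
      have "g 0 = 0" by (simp add: g_def)
      then have "k = 0" using k[of 0] b by simp
      moreover have "g (of_real (1/b/2)) = 1 / \<Phi> (1 / of_real (1/b/2))"
        using b by (simp add: g_def)
      moreover have "g (of_real (1/b/2)) = k" using b(2) by (intro k) (auto simp: norm_divide field_simps)
      moreover have "1 / (of_real (1/b/2)::complex) \<notin> E"
        by (rule outE) (use b(2) in \<open>auto simp: norm_divide field_simps\<close>)
      ultimately show False using Phi_nz by auto
    qed
    have "open (g ` ball 0 \<delta>)"
      by (rule open_mapping_thm[OF holo _ _ _ sub nc]) auto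
    moreover have "0 \<in> g ` ball 0 \<delta>" using \<delta> by (auto simp: g_def image_iff intro!: bexI[of _ 0])
    ultimately obtain \<eta> where \<eta>: "\<eta> > 0" "ball 0 \<eta> \<subseteq> g ` ball 0 \<delta>"
      using open_contains_ball by blast
    have "r \<le> norm (Psi w)" if w: "norm w \<ge> max 2 (2/\<eta>)" for w
    proof -
      have w0: "norm w > 0" using w by linarith
      have "norm (1/w) < \<eta>" using w \<eta> w0 by (auto simp: norm_divide field_simps)
      then obtain \<zeta> where \<zeta>: "norm \<zeta> < \<delta>" "g \<zeta> = 1 / w" using \<eta> by (auto simp: subset_iff image_iff)
      then have nz: "\<zeta> \<noteq> 0" using w0 by (auto simp: g_def)
      then have "\<Phi> (1/\<zeta>) = w" using \<zeta> w0 by (simp add: g_def) 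
      moreover have "1/\<zeta> \<notin> E" using outE \<zeta> \<delta> nz by auto
      ultimately have "Psi w = 1 / \<zeta>" using Psi_Phi by metis
      moreover have "r \<le> norm (1/\<zeta>)" proof -
        have "r * norm \<zeta> \<le> r * \<delta>" using \<zeta> \<open>0<r\<close> by (intro mult_left_mono) auto
        also have "\<dots> \<le> 1" using \<delta> \<open>0<r\<close> by (simp add: field_simps)
        finally show ?thesis using nz by (simp add: norm_divide field_simps)
      qed
      ultimately show ?thesis by simp
    qed
    then show "eventually (\<lambda>w. r \<le> norm (Psi w)) at_infinity"
      unfolding eventually_at_infinity by blast
  qed
qed

text \<open>The linear growth of \<open>Psi\<close> is what determines the winding numbers in
  \<open>winding_inner\<close> and the degree count in \<open>FC_poly\<close>.\<close>

lemma Psi_ratio: obtains c :: real where "c > 0" "((\<lambda>w. Psi w / w) \<longlongrightarrow> of_real c) at_infinity"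
proof -
  obtain c :: real where c: "c > 0" "((\<lambda>z. \<Phi> z / z) \<longlongrightarrow> of_real c) at_infinity"
    using ext by (auto simp: exterior_map_def)
  have "((\<lambda>w. \<Phi> (Psi w) / Psi w) \<longlongrightarrow> of_real c) at_infinity"
    by (rule filterlim_compose[OF c(2) Psi_at_infinity])
  then have "((\<lambda>w. inverse (\<Phi> (Psi w) / Psi w)) \<longlongrightarrow> inverse (of_real c)) at_infinity"
    using c by (intro tendsto_inverse) auto
  moreover have "eventually (\<lambda>w. inverse (\<Phi> (Psi w) / Psi w) = Psi w / w) at_infinity"
    unfolding eventually_at_infinity by (rule exI[of _ 2]) (auto simp: Phi_Psi)
  ultimately have "((\<lambda>w. Psi w / w) \<longlongrightarrow> inverse (of_real c)) at_infinity"
    by (rule Lim_transform_eventually)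
  then have "((\<lambda>w. Psi w / w) \<longlongrightarrow> of_real (inverse c)) at_infinity"
    by simp
  then show ?thesis using c that[of "inverse c"] by simp
qed

text \<open>Openness at points of \<open>E\<close> is the delicate part: points outside
  \<open>dom \<rho>\<close> must not accumulate at \<open>E\<close>. A convergent sequence of such
  points has bounded values of \<Phi>, hence lies in the \<open>Psi\<close>-image of a compact round
  annulus, which misses \<open>E\<close>. For connectedness, the part outside \<open>E\<close> is
  the image of an annulus, and every component of the domain meets it.\<close>

lemma connected_dom:
  assumes "1 < \<rho>" shows "open (dom \<rho>)" "connected (dom \<rho>)"
proof -
  have eq: "dom \<rho> = - {z. z \<notin> E \<and> \<rho> \<le> ereal (norm (\<Phi> z))}"
    by (auto simp: canonical_domain_def)
  have "closed {z. z \<notin> E \<and> \<rho> \<le> ereal (norm (\<Phi> z))}"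
  proof (cases \<rho>)
    case (real r)
    then have r: "r > 1" using assms by simp
    show ?thesis
      unfolding closed_sequential_limits real
    proof (intro allI impI, elim conjE)
      fix y x assume y: "\<forall>n. y n \<in> {z. z \<notin> E \<and> ereal r \<le> ereal (norm (\<Phi> z))}" and lim: "y \<longlonglongrightarrow> x"
      have "Bseq y" using lim convergent_def convergent_imp_Bseq by blast
      then obtain K where K: "K > 0" "\<And>n. norm (y n) \<le> K" by (auto simp: Bseq_def)
      obtain B where B: "\<And>w. norm w \<ge> B \<Longrightarrow> K + 1 \<le> norm (Psi w)"
        using Psi_at_infinity K(1) unfolding filterlim_at_infinity[OF order_refl] eventually_at_infinity
        by (metis add_pos_pos zero_less_one)
      have yB: "norm (\<Phi> (y n)) \<le> B" for n
        using K(2)[of n] B[of "\<Phi> (y n)"] Psi_Phi[of "y n"] y by force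
      have "{w::complex. r \<le> norm w \<and> norm w \<le> B} = cball 0 B \<inter> - ball 0 r" by auto
      then have "compact {w::complex. r \<le> norm w \<and> norm w \<le> B}"
        by (simp add: compact_Int_closed closed_Compl)
      then have "compact (Psi ` {w. r \<le> norm w \<and> norm w \<le> B})"
        by (intro compact_continuous_image continuous_on_subset[OF Psi_cont]) (use r in auto)
      moreover have "y n \<in> Psi ` {w. r \<le> norm w \<and> norm w \<le> B}" for n
        using y yB[of n] Psi_Phi[of "y n"] by (intro image_eqI[of _ _ "\<Phi> (y n)"]) auto
      ultimately have "x \<in> Psi ` {w. r \<le> norm w \<and> norm w \<le> B}"
        using lim closed_sequentially compact_imp_closed by metis
      then show "x \<in> {z. z \<notin> E \<and> ereal r \<le> ereal (norm (\<Phi> z))}" using r Psi_notin Phi_Psi by auto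
    qed
  qed (use assms in auto)
  then show op: "open (dom \<rho>)" unfolding eq by (simp add: open_Compl)
  define A where "A = {z. z \<notin> E \<and> ereal (norm (\<Phi> z)) < \<rho>}"
  have cA: "connected A"
  proof -
    have "connected {w::complex. 1 < norm w \<and> ereal (norm w) < \<rho>}"
    proof (cases \<rho>)
      case (real r)
      have "{w::complex. 1 < norm w \<and> norm w < r} = {w. 1 < norm (w - 0) \<and> norm (w - 0) < r}" by simp
      then have "connected {w::complex. 1 < norm w \<and> norm w < r}"
        using connected_annulus(1)[of 1 "0::complex" r] by simp
      then show ?thesis using real by simp
    next
      case PInf
      have "connected (- cball (0::complex) 1)" by (simp add: connected_complement_bounded_convex)
      moreover have "- cball (0::complex) 1 = {w. 1 < norm w}" by auto
      ultimately show ?thesis using PInf by simp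
    qed (use assms in auto)
    then have "connected (Psi ` {w. 1 < norm w \<and> ereal (norm w) < \<rho>})"
      by (intro connected_continuous_image continuous_on_subset[OF Psi_cont]) auto
    moreover have "Psi ` {w. 1 < norm w \<and> ereal (norm w) < \<rho>} = A"
    proof -
      have "z \<in> Psi ` {w. 1 < norm w \<and> ereal (norm w) < \<rho>}" if "z \<in> A" for z
        using that norm_Phi[of z] Psi_Phi[of z] by (intro image_eqI[of _ _ "\<Phi> z"]) (auto simp: A_def)
      then show ?thesis by (auto simp: A_def Phi_Psi Psi_notin)
    qed
    ultimately show ?thesis by simp
  qed
  \<comment> \<open>A component inside \<open>E\<close> would be open, and closed because its
    closure stays in \<open>E\<close>, hence in the domain; a bounded nonempty clopen subset of the
    plane does not exist.\<close>
  have comp: "A \<inter> C \<noteq> {}" if C: "C \<in> components (dom \<rho>)" for C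
  proof
    assume "A \<inter> C = {}"
    then have "C \<subseteq> E" using in_components_subset[OF C] by (auto simp: A_def canonical_domain_def)
    have oC: "open C" using open_components[OF op C] .
    have "closed C"
    proof -
      have "closure C \<subseteq> E" using \<open>C \<subseteq> E\<close> compact_E by (simp add: closure_minimal compact_imp_closed)
      then have "closure C \<subseteq> dom \<rho>" using E_sub_dom by blast
      moreover have "connected (closure C)" using in_components_connected[OF C] by (rule connected_imp_connected_closure)
      ultimately have "closure C \<subseteq> C"
        using C components_maximal[OF C, of "closure C"] in_components_nonempty[OF C] closure_subset[of C] by blast
      then show ?thesis by (simp add: closure_subset_eq)
    qed
    with oC have "C = {} \<or> C = UNIV" using clopen by blast
    then show False using in_components_nonempty[OF C] \<open>C \<subseteq> E\<close> compact_E
      by (metis compact_imp_bounded bounded_subset not_bounded_UNIV)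
  qed
  have "A \<subseteq> dom \<rho>" by (auto simp: A_def canonical_domain_def)
  show "connected (dom \<rho>)"
    unfolding connected_iff_connected_component
  proof (intro ballI)
    fix x y assume x: "x \<in> dom \<rho>" and y: "y \<in> dom \<rho>"
    obtain a where a: "a \<in> A" "connected_component (dom \<rho>) x a"
      using comp[of "connected_component_set (dom \<rho>) x"] x by (auto simp: components_def)
    obtain b where b: "b \<in> A" "connected_component (dom \<rho>) y b"
      using comp[of "connected_component_set (dom \<rho>) y"] y by (auto simp: components_def)
    have "connected_component (dom \<rho>) a b"
      using cA \<open>A \<subseteq> dom \<rho>\<close> a b unfolding connected_component_def by blast
    then show "connected_component (dom \<rho>) x y"
      using a(2) b(2) connected_component_sym connected_component_trans by metis
  qed
qed

end

section \<open>Contour integrals over level curves\<close>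

lemma ereal_le_less: "x \<le> r \<Longrightarrow> ereal r < R \<Longrightarrow> ereal x < R"
  using le_less_trans[of "ereal x" "ereal r" R] by simp

context exterior begin

lemma lp_eq: "lp s = Psi \<circ> circlepath 0 s"
  by (simp add: level_path_def Psi_def)

lemma lp_path:
  assumes "1 < s"
  shows lp_valid: "valid_path (lp s)" and lp_image: "path_image (lp s) = level s"
    and lp_loop: "pathfinish (lp s) = pathstart (lp s)"
proof -
  have sub: "path_image (circlepath 0 s) \<subseteq> {w. 1 < norm w}" using assms by auto
  show "valid_path (lp s)" unfolding lp_eq
    by (rule valid_path_compose_holomorphic[OF _ Psi_holo open_ext sub]) simp
  have "{w::complex. norm w \<in> {s}} = sphere 0 s" by auto
  then show "path_image (lp s) = level s"
    using Psi_image[of "{s}"] assms by (simp add: lp_eq path_image_compose)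
  show "pathfinish (lp s) = pathstart (lp s)"
    by (simp add: lp_eq pathfinish_compose pathstart_compose)
qed

lemma lp_vd:
  assumes "1 < s"
  shows "vector_derivative (lp s) (at x) = vector_derivative (circlepath 0 s) (at x) * deriv Psi (circlepath 0 s x)"
  unfolding lp_eq
proof (rule vector_derivative_chain_at_general)
  show "circlepath 0 s differentiable at x"
    using has_vector_derivative_circlepath differentiableI_vector by blast
  have "norm (circlepath 0 s x) = s" using assms by (simp add: circlepath norm_mult)
  then show "Psi field_differentiable at (circlepath 0 s x)"
    using assms holomorphic_on_imp_differentiable_at[OF Psi_holo open_ext] by auto
qed

lemma lp_subst:
  assumes "1 < s"
  shows "contour_integral (lp s) f = contour_integral (circlepath 0 s) (\<lambda>w. f (Psi w) * deriv Psi w)"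
  using lp_vd[OF assms, unfolded lp_eq] by (simp add: contour_integral_integral lp_eq mult_ac)

text \<open>The straight-line homotopy of two concentric circles stays in the round annulus;
  \<open>Psi\<close> carries it over to the level curves.\<close>

lemma lp_homotopic:
  assumes "1 < s" "s \<le> r" "{z. z \<notin> E \<and> s \<le> norm (\<Phi> z) \<and> norm (\<Phi> z) \<le> r} \<subseteq> S"
  shows "homotopic_loops S (lp s) (lp r)"
  unfolding lp_eq
proof (rule homotopic_loops_continuous_image)
  let ?A = "{w::complex. s \<le> norm w \<and> norm w \<le> r}"
  show "homotopic_loops ?A (circlepath 0 s) (circlepath 0 r)"
  proof (rule homotopic_loops_linear)
    fix t :: real
    show "closed_segment (circlepath 0 s t) (circlepath 0 r t) \<subseteq> ?A"
    proof
      fix w assume "w \<in> closed_segment (circlepath 0 s t) (circlepath 0 r t)"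
      then obtain u where u: "0 \<le> u" "u \<le> 1"
          "w = (1 - u) *\<^sub>R (circlepath 0 s t) + u *\<^sub>R circlepath 0 r t" by (auto simp: closed_segment_def)
      define k where "k = (1 - u) * s + u * r"
      have k: "s \<le> k" "k \<le> r"
      proof -
        have "u * (r - s) \<ge> 0" "(1 - u) * (r - s) \<ge> 0" using u assms by auto
        then show "s \<le> k" "k \<le> r" by (simp_all add: k_def algebra_simps)
      qed
      have "w = of_real k * exp (2 * of_real pi * \<i> * of_real t)"
        by (simp add: u(3) circlepath k_def scaleR_conv_of_real algebra_simps)
      then have "norm w = \<bar>k\<bar>" by (simp add: norm_mult)
      then show "w \<in> ?A" using assms k by auto
    qed
  qed auto
  show "continuous_on ?A Psi" by (rule continuous_on_subset[OF Psi_cont]) (use assms in auto)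
  have "Psi w \<in> S" if "w \<in> ?A" for w
    using that assms Phi_Psi[of w] Psi_notin[of w] by (intro subsetD[OF assms(3)]) auto
  then show "Psi \<in> ?A \<rightarrow> S" by auto
qed

lemma lp_deform:
  assumes "1 < s" "s \<le> r" "{z. z \<notin> E \<and> s \<le> norm (\<Phi> z) \<and> norm (\<Phi> z) \<le> r} \<subseteq> S"
    and "open S" "f holomorphic_on S"
  shows "contour_integral (lp s) f = contour_integral (lp r) f"
  using assms by (intro Cauchy_theorem_homotopic_loops[OF lp_homotopic]) (auto intro: lp_valid)

lemma lp_integrable:
  assumes "1 < s" "open S" "f holomorphic_on S" "level s \<subseteq> S"
  shows "f contour_integrable_on lp s"
  using assms by (intro contour_integrable_holomorphic_simple[where S=S]) (auto simp: lp_image intro: lp_valid)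

text \<open>A non-integrable function has contour integral 0 by convention, which settles the second
  case.\<close>

lemma circle_bound:
  assumes "0 < s" "0 \<le> B" "\<And>w. norm w = s \<Longrightarrow> norm (f w) \<le> B"
  shows "norm (contour_integral (circlepath 0 s) f) \<le> B * (2 * pi * s)"
proof (cases "f contour_integrable_on circlepath 0 s")
  case True
  then show ?thesis
    using assms by (intro has_contour_integral_bound_circlepath[OF has_contour_integral_integral]) auto
next
  case False
  then show ?thesis using assms by (simp add: not_integrable_contour_integral)
qed

lemma deriv_Psi_bound: "1 < s \<Longrightarrow> \<exists>M>0. \<forall>w. norm w = s \<longrightarrow> norm (deriv Psi w) \<le> M"
proof -
  assume s: "1 < s"
  have "continuous_on (sphere 0 s) (deriv Psi)"
    by (rule continuous_on_subset[OF holomorphic_on_imp_continuous_on[OF holomorphic_deriv[OF Psi_holo open_ext]]])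
       (use s in auto)
  then have "bounded (deriv Psi ` sphere 0 s)"
    by (intro compact_imp_bounded compact_continuous_image) auto
  then obtain M where "M > 0" "\<And>w. w \<in> sphere 0 s \<Longrightarrow> norm (deriv Psi w) \<le> M"
    unfolding bounded_pos by blast
  then show ?thesis by (intro exI[of _ M]) auto
qed

text \<open>The constant depends on the level alone and comes before \<open>f\<close>, since later
  integrands vary with n and with the solution.\<close>

lemma lp_bound:
  assumes "1 < s"
  obtains C where "C > 0"
    "\<And>(f :: complex \<Rightarrow> complex) B. 0 \<le> B \<Longrightarrow> (\<And>z. z \<notin> E \<Longrightarrow> norm (\<Phi> z) = s \<Longrightarrow> norm (f z) \<le> B) \<Longrightarrow> norm (contour_integral (lp s) f) \<le> C * B"
proof -
  obtain M where M: "M > 0" "\<And>w. norm w = s \<Longrightarrow> norm (deriv Psi w) \<le> M" using deriv_Psi_bound[OF assms] by blast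
  show ?thesis
  proof (rule that[of "M * (2 * pi * s)"])
    fix f :: "complex \<Rightarrow> complex" and B assume B: "0 \<le> (B::real)" "\<And>z. z \<notin> E \<Longrightarrow> norm (\<Phi> z) = s \<Longrightarrow> norm (f z) \<le> B"
    have "norm (contour_integral (lp s) f) \<le> (B * M) * (2 * pi * s)"
      unfolding lp_subst[OF assms]
    proof (rule circle_bound)
      fix w :: complex assume w: "norm w = s"
      then show "norm (f (Psi w) * deriv Psi w) \<le> B * M"
        using B(2)[of "Psi w"] B(1) M assms Phi_Psi[of w] Psi_notin[of w]
        by (auto simp: norm_mult intro!: mult_mono)
    qed (use assms B M in auto)
    then show "norm (contour_integral (lp s) f) \<le> M * (2 * pi * s) * B" by (simp add: mult_ac)
  qed (use M assms in auto)
qed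

section \<open>Winding numbers of level curves and Cauchy's formulas\<close>

text \<open>The set above the level is connected, avoids the curve, and is unbounded because its
  complement is compact; so \<open>x\<close> lies in the outside of the curve.\<close>

lemma winding_outer:
  assumes "1 < s" "x \<notin> E" "s < norm (\<Phi> x)"
  shows "winding_number (lp s) x = 0"
proof (rule winding_number_zero_in_outside[OF valid_path_imp_path[OF lp_valid[OF assms(1)]] lp_loop[OF assms(1)]])
  define A where "A = {z. z \<notin> E \<and> norm (\<Phi> z) \<in> {s<..}}"
  have eq: "A = Psi ` {w. norm w \<in> {s<..}}" using Psi_image[of "{s<..}"] assms by (simp add: A_def)
  have "connected (- cball (0::complex) s)" by (simp add: connected_complement_bounded_convex)
  moreover have "- cball (0::complex) s = {w. norm w \<in> {s<..}}" by auto
  ultimately have "connected A" unfolding eq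
    using assms by (intro connected_continuous_image continuous_on_subset[OF Psi_cont]) auto
  moreover have "A \<subseteq> - path_image (lp s)" using assms by (auto simp: A_def lp_image)
  moreover have "x \<in> A" using assms by (auto simp: A_def)
  ultimately have sub: "A \<subseteq> connected_component_set (- path_image (lp s)) x"
    by (simp add: connected_component_maximal)
  have "\<not> bounded A"
  proof
    assume "bounded A"
    then obtain K where K: "\<And>z. z \<in> A \<Longrightarrow> norm z \<le> K" by (auto simp: bounded_iff)
    have "- A = sublevel s" by (auto simp: A_def)
    then have "bounded (- A)" using compact_imp_bounded[OF compact_sublevel[of s]] by simp
    with \<open>bounded A\<close> have "bounded (A \<union> - A)" by (rule bounded_Un[THEN iffD2, OF conjI])
    then show False by (simp add: Compl_partition not_bounded_UNIV)
  qed
  then show "x \<in> outside (path_image (lp s))"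
    unfolding outside using bounded_subset[OF _ sub] by auto
qed

lemma dom_ereal_iff: "x \<in> dom (ereal s) \<longleftrightarrow> x \<in> E \<or> norm (\<Phi> x) < s"
  by (auto simp: canonical_domain_def)

text \<open>The curve can be blown up without meeting \<open>x\<close>. At a large level
  \<open>S\<close> it is close to the circle of radius c S, because Psi w behaves like c w, and the
  winding number of a circle is known.\<close>

lemma winding_inner:
  assumes s: "1 < s" and x: "x \<in> dom (ereal s)"
  shows "winding_number (lp s) x = 1"
proof -
  obtain c :: real where c: "c > 0" "((\<lambda>w. Psi w / w) \<longlongrightarrow> of_real c) at_infinity" using Psi_ratio by blast
  have "eventually (\<lambda>w. dist (Psi w / w) (of_real c) < c/2) at_infinity"
    using c by (intro tendstoD) auto
  then obtain b where b: "\<And>w. b \<le> norm w \<Longrightarrow> norm (Psi w / w - of_real c) < c / 2"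
    by (auto simp: eventually_at_infinity dist_norm)
  \<comment> \<open>From \<open>b\<close> on, Psi w differs from c w by less than (c / 2) |w|. The
    last term gives c S > 2 |x|, so the distance of the two loops stays below c S / 2, which is less
    than the distance from \<open>x\<close> to the circle.\<close>
  define S where "S = max (max b (s+1)) (2 * norm x / c + 1)"
  have S: "b \<le> S" "s + 1 \<le> S" "2 * norm x / c + 1 \<le> S" by (auto simp: S_def)
  have S0: "S > 1" using S s by linarith
  have xS: "2 * norm x < c * S" using S(3) c by (simp add: field_simps)
  have "homotopic_loops (-{x}) (lp s) (lp S)"
    by (rule lp_homotopic) (use s S x in \<open>auto simp: dom_ereal_iff\<close>)
  then have "winding_number (lp s) x = winding_number (lp S) x"
    by (rule winding_number_homotopic_loops)
  also have "homotopic_loops (-{x}) (circlepath 0 (c*S)) (lp S)"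
  proof (rule homotopic_loops_nearby_explicit)
    fix t y assume "y \<notin> -{x}"
    then have y: "y = x" by simp
    define e where "e = exp (2 * of_real pi * \<i> * of_real t)"
    have e: "norm e = 1" by (simp add: e_def)
    have cs: "circlepath 0 (c*S) t = of_real (c * S) * e" "circlepath 0 S t = of_real S * e"
      by (simp_all add: circlepath e_def)
    have "norm (Psi (of_real S * e) / (of_real S * e) - of_real c) < c / 2"
      using S S0 e by (intro b) (auto simp: norm_mult)
    moreover have "Psi (of_real S * e) - of_real (c * S) * e
       = (Psi (of_real S * e) / (of_real S * e) - of_real c) * (of_real S * e)"
      using S0 e by (auto simp: field_simps)
    ultimately have "norm (Psi (of_real S * e) - of_real (c * S) * e) < c/2 * S"
      using S0 e by (simp add: norm_mult)
    also have "\<dots> < norm (of_real (c * S) * e) - norm x"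
      using xS e c S0 by (simp add: norm_mult mult.commute)
    also have "\<dots> \<le> norm (of_real (c * S) * e - x)" by (rule norm_triangle_ineq2)
    finally show "norm (lp S t - circlepath 0 (c*S) t) < norm (circlepath 0 (c*S) t - y)"
      by (simp add: lp_eq cs y)
  qed (use S0 in \<open>auto intro: valid_path_imp_path lp_valid lp_loop\<close>)
  then have "winding_number (lp S) x = winding_number (circlepath 0 (c*S)) x"
    by (simp add: winding_number_homotopic_loops)
  also have "\<dots> = 1" proof (rule winding_number_circlepath)
    show "norm (x - 0) < c * S" using xS norm_ge_zero[of x] by (simp only: diff_zero)
  qed
  finally show ?thesis .
qed

lemma Cauchy_dom:
  assumes s: "1 < s" "ereal s < R" and f: "f holomorphic_on dom R" and z: "z \<in> dom (ereal s)"
  shows "contour_integral (lp s) (\<lambda>t. f t / (t - z)) = 2 * of_real pi * \<i> * f z"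
proof -
  have R: "1 < R" using s less_trans[of 1 "ereal s" R] by simp
  have "((\<lambda>w. f w / (w - z)) has_contour_integral (2 * pi * \<i> * winding_number (lp s) z * f z)) (lp s)"
  proof (rule Cauchy_integral_formula_global[OF _ f _ lp_valid[OF s(1)] _ lp_loop[OF s(1)]])
    show "open (dom R)" using connected_dom R by blast
    show "z \<in> dom R" using z dom_subset[of "ereal s" R] s(2) by (meson less_imp_le subsetD)
    show "path_image (lp s) \<subseteq> dom R - {z}"
      using z s by (auto simp: lp_image dom_ereal_iff) (auto simp: canonical_domain_def)
    fix w assume "w \<notin> dom R"
    then show "winding_number (lp s) w = 0"
      using s by (intro winding_outer) (auto simp: canonical_domain_def not_less dest: less_le_trans[of "ereal s" R])
  qed
  then show ?thesis using winding_inner[OF s(1) z] by (simp add: contour_integral_unique)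
qed

definition ann :: "ereal \<Rightarrow> complex set" where "ann R = {z. z \<notin> E \<and> ereal (norm (\<Phi> z)) < R}"

lemma open_ann: "open (ann R)"
proof -
  have "ann R = {z. z \<notin> E \<and> 0 < norm (\<Phi> z) \<and> ereal (norm (\<Phi> z)) < R}" by (auto simp: ann_def Phi_nz)
  then show ?thesis by (simp only: open_lev_between)
qed

lemma in_ann: "z \<in> ann R \<longleftrightarrow> z \<notin> E \<and> ereal (norm (\<Phi> z)) < R"
  by (simp add: ann_def)

lemma ann_eq: "ann R = dom R - E"
  by (auto simp: ann_def canonical_domain_def)

text \<open>As \<open>f\<close> need not extend to \<open>E\<close>, the formula is derived by
  deformation: the difference quotient of \<open>f\<close> at \<open>x\<close> has no singularity,
  so its integrals over both curves agree, and the winding numbers 1 and 0 around \<open>x\<close>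
  supply the value.\<close>

lemma Cauchy_ann:
  assumes s: "1 < s" "s < r" "ereal r < R" and f: "f holomorphic_on ann R"
    and x: "x \<notin> E" "s < norm (\<Phi> x)" "norm (\<Phi> x) < r"
  shows "contour_integral (lp r) (\<lambda>t. f t / (t - x)) - contour_integral (lp s) (\<lambda>t. f t / (t - x))
     = 2 * of_real pi * \<i> * f x"
proof -
  have xa: "x \<in> ann R" using x s by (auto simp: ann_def intro: less_trans[of _ "ereal r"])
  \<comment> \<open>This is the difference quotient in the shape produced by
    \<open>pole_theorem_open\<close> for the function f t - f x; the last summand is 0.\<close>
  define g where "g = (\<lambda>t. if t = x then deriv (\<lambda>t. f t - f x) x else (f t - f x) / (t - x) - (\<lambda>t. f t - f x) x / (t - x))"
  have hg: "g holomorphic_on ann R"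
    unfolding g_def by (rule pole_theorem_open) (auto intro!: holomorphic_intros f open_ann)
  have I: "contour_integral (lp u) g = contour_integral (lp u) (\<lambda>t. f t / (t - x)) - f x * (2 * of_real pi * \<i> * winding_number (lp u) x)"
    if u: "1 < u" "u \<noteq> norm (\<Phi> x)" "ereal u < R" for u
  proof -
    have xp: "x \<notin> path_image (lp u)" using u by (simp add: lp_image)
    have "contour_integral (lp u) g = contour_integral (lp u) (\<lambda>t. f t / (t - x) - f x * (1 / (t - x)))"
      using xp by (intro contour_integral_eq) (auto simp: g_def diff_divide_distrib)
    also have "\<dots> = contour_integral (lp u) (\<lambda>t. f t / (t - x)) - contour_integral (lp u) (\<lambda>t. f x * (1 / (t - x)))"
    proof (rule contour_integral_diff)
      show "(\<lambda>t. f t / (t - x)) contour_integrable_on lp u"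
        by (rule lp_integrable[where S="ann R - {x}"])
           (use u open_ann in \<open>auto intro!: holomorphic_intros holomorphic_on_subset[OF f] open_delete simp: in_ann\<close>)
      show "(\<lambda>t. f x * (1 / (t - x))) contour_integrable_on lp u"
        by (rule lp_integrable[where S="- {x}"]) (use u in \<open>auto intro!: holomorphic_intros\<close>)
    qed
    also have "contour_integral (lp u) (\<lambda>t. f x * (1 / (t - x))) = f x * (2 * of_real pi * \<i> * winding_number (lp u) x)"
      using has_contour_integral_lmul[OF has_contour_integral_winding_number[OF lp_valid xp]] u
      by (intro contour_integral_unique) auto
    finally show ?thesis .
  qed
  have "contour_integral (lp s) g = contour_integral (lp r) g"
    by (rule lp_deform[OF _ _ _ open_ann hg]) (use s in \<open>auto simp: ann_def intro: ereal_le_less[of _ r]\<close>)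
  moreover have "winding_number (lp r) x = 1" by (rule winding_inner) (use x s in \<open>auto simp: dom_ereal_iff\<close>)
  moreover have "winding_number (lp s) x = 0" by (rule winding_outer) (use x s in auto)
  moreover have "ereal s < R" using s less_trans[of "ereal s" "ereal r" R] by simp
  ultimately show ?thesis using I[of s] I[of r] s x by (simp add: algebra_simps)
qed

section \<open>Faber coefficients on a prescribed level\<close>

text \<open>Unlike \<open>faber_coeff\<close>, this fixes the level curve instead of choosing it by \<open>SOME\<close>.\<close>

definition FC :: "real \<Rightarrow> (complex \<Rightarrow> complex) \<Rightarrow> nat \<Rightarrow> complex" where
  "FC s f k = contour_integral (lp s) (\<lambda>t. f t * deriv \<Phi> t / \<Phi> t ^ (k + 1)) / (2 * of_real pi * \<i>)"

lemma FC_circle: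
  assumes "1 < s"
  shows "2 * of_real pi * \<i> * FC s f k = contour_integral (circlepath 0 s) (\<lambda>w. f (Psi w) / w ^ (k + 1))"
proof -
  have "contour_integral (lp s) (\<lambda>t. f t * deriv \<Phi> t / \<Phi> t ^ (k + 1))
      = contour_integral (circlepath 0 s) (\<lambda>w. f (Psi w) / w ^ (k + 1))"
    unfolding lp_subst[OF assms]
  proof (rule contour_integral_eq)
    fix w assume "w \<in> path_image (circlepath 0 s)"
    then have w: "1 < norm w" using assms by simp
    show "f (Psi w) * deriv \<Phi> (Psi w) / \<Phi> (Psi w) ^ (k + 1) * deriv Psi w = f (Psi w) / w ^ (k + 1)"
      using deriv_Psi[OF w] by (simp add: Phi_Psi[OF w])
  qed
  then show ?thesis by (simp add: FC_def)
qed

lemma FC_integrand_holo: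
  "f holomorphic_on S \<Longrightarrow> S \<subseteq> - E \<Longrightarrow> (\<lambda>t. f t * deriv \<Phi> t / \<Phi> t ^ (k + 1)) holomorphic_on S"
  by (intro holomorphic_intros holomorphic_on_subset[OF Phi_holo] holomorphic_on_subset[OF deriv_Phi_holo])
     (auto dest: Phi_nz)

lemma FC_deform:
  assumes "1 < s" "s \<le> r" "{z. z \<notin> E \<and> s \<le> norm (\<Phi> z) \<and> norm (\<Phi> z) \<le> r} \<subseteq> S"
    and "open S" "f holomorphic_on S" "S \<subseteq> - E"
  shows "FC s f k = FC r f k"
  unfolding FC_def
  using lp_deform[OF assms(1-4) FC_integrand_holo[OF assms(5,6)]] by simp

lemma FC_integrable:
  assumes "1 < s" "open S" "f holomorphic_on S" "S \<subseteq> - E" "level s \<subseteq> S"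
  shows "(\<lambda>t. f t * deriv \<Phi> t / \<Phi> t ^ (k + 1)) contour_integrable_on lp s"
  by (rule lp_integrable[OF assms(1,2) FC_integrand_holo[OF assms(3,4)] assms(5)])

lemma FC_diff:
  assumes "1 < s" "open S" "S \<subseteq> - E" "level s \<subseteq> S"
    and "f holomorphic_on S" "g holomorphic_on S"
  shows "FC s (\<lambda>z. f z - g z) k = FC s f k - FC s g k"
  unfolding FC_def
  using contour_integral_diff[OF FC_integrable[OF assms(1,2,5,3,4)] FC_integrable[OF assms(1,2,6,3,4)], of k k]
  by (simp add: left_diff_distrib diff_divide_distrib)

lemma FC_cmult:
  assumes "1 < s" "open S" "S \<subseteq> - E" "level s \<subseteq> S" "f holomorphic_on S"
  shows "FC s (\<lambda>z. c * f z) k = c * FC s f k"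
  unfolding FC_def
  using contour_integral_lmul[OF FC_integrable[OF assms(1,2,5,3,4)], of c k]
  by (simp add: mult.assoc)

text \<open>Of the level chosen by \<open>SOME\<close> only the defining property is known, and it
  may lie on either side of \<open>s\<close> or even beyond \<open>R\<close>. Both levels are
  therefore compared with their minimum \<open>t\<close>: up to \<open>s\<close> inside the domain
  of \<open>f\<close>, up to \<rho> inside a neighbourhood of the closed domain on which
  \<open>f\<close> is holomorphic.\<close>

lemma faber_coeff_eq:
  assumes s: "1 < s" "ereal s < R" and f: "f holomorphic_on dom R"
  shows "faber_coeff E \<Phi> f k = FC s f k"
proof -
  define P where "P = (\<lambda>\<rho>::real. 1 < \<rho> \<and> f analytic_on closure (dom (ereal \<rho>)))"
  have R: "1 < R" using s less_trans[of 1 "ereal s" R] by simp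
  have "closure (dom (ereal s)) \<subseteq> sublevel s"
    by (intro closure_minimal compact_imp_closed compact_sublevel) (auto simp: dom_ereal_iff)
  also have "\<dots> \<subseteq> dom R" using s by (auto simp: canonical_domain_def intro: ereal_le_less)
  finally have "P s" using s f connected_dom(1)[OF R] unfolding P_def analytic_on_holomorphic by blast
  then have "P (SOME \<rho>. P \<rho>)" by (rule someI)
  then obtain \<rho> where \<rho>: "\<rho> = (SOME \<rho>. P \<rho>)" "1 < \<rho>" "f analytic_on closure (dom (ereal \<rho>))" unfolding P_def by blast
  then have 1: "faber_coeff E \<Phi> f k = FC \<rho> f k"
    by (simp add: faber_coeff_def FC_def P_def[symmetric])
  define t where "t = min s \<rho>"
  have t: "1 < t" "t \<le> s" "t \<le> \<rho>" using s \<rho> by (auto simp: t_def)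
  have "FC t f k = FC s f k"
    by (rule FC_deform[where S="ann R"])
       (use t s f open_ann in \<open>auto simp: ann_eq intro: holomorphic_on_subset\<close>, auto simp: canonical_domain_def intro: ereal_le_less)
  moreover have "FC t f k = FC \<rho> f k"
  proof -
    obtain T where T: "open T" "closure (dom (ereal \<rho>)) \<subseteq> T" "f holomorphic_on T"
      using \<rho>(3) unfolding analytic_on_holomorphic by blast
    \<comment> \<open>Points on the level \<rho> itself belong to the closure, being limits of
      points approached radially from inside in the coordinate \<Phi>.\<close>
    have sub: "x \<in> closure (dom (ereal \<rho>))" if x: "x \<notin> E" "norm (\<Phi> x) \<le> \<rho>" for x
    proof -
      let ?A = "{w::complex. 1 < norm w \<and> norm w < \<rho>}"
      have ph: "\<Phi> x \<noteq> 0" "1 < norm (\<Phi> x)" using x norm_Phi Phi_nz by auto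
      have "((\<lambda>u. Psi (of_real u * \<Phi> x)) \<longlongrightarrow> Psi (of_real 1 * \<Phi> x)) (at_left 1)"
      proof (rule isCont_tendsto_compose[where g=Psi])
        show "isCont Psi (of_real 1 * \<Phi> x)"
          using Psi_cont open_ext[of 1] ph by (simp add: continuous_on_eq_continuous_at)
        show "((\<lambda>u. of_real u * \<Phi> x) \<longlongrightarrow> of_real 1 * \<Phi> x) (at_left 1)" by (intro tendsto_intros)
      qed
      moreover have "Psi (of_real 1 * \<Phi> x) = x" using x Psi_Phi by simp
      moreover have "eventually (\<lambda>u. Psi (of_real u * \<Phi> x) \<in> dom (ereal \<rho>)) (at_left 1)"
      proof -
        have "1 / norm (\<Phi> x) < 1" using ph by simp
        then have "eventually (\<lambda>u. 1 / norm (\<Phi> x) < u \<and> u < 1) (at_left 1)"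
          using eventually_at_left_real[of "1 / norm (\<Phi> x)" 1] by simp
        then show ?thesis
        proof eventually_elim
          case (elim u)
          have u0: "u > 0" using elim ph by (meson divide_pos_pos less_trans zero_less_one zero_less_norm_iff)
          then have n: "norm (of_real u * \<Phi> x) = u * norm (\<Phi> x)" by (simp add: norm_mult)
          have "u * norm (\<Phi> x) > 1" "u * norm (\<Phi> x) < norm (\<Phi> x)" using elim ph by (auto simp: field_simps)
          then show ?case using n x Phi_Psi[of "of_real u * \<Phi> x"] by (simp add: dom_ereal_iff)
        qed
      qed
      ultimately show ?thesis
        by (intro Lim_in_closed_set[of "closure (dom (ereal \<rho>))" "\<lambda>u. Psi (of_real u * \<Phi> x)" "at_left 1"])
           (auto elim: eventually_mono intro: closure_subset[THEN subsetD])
    qed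
    have T': "T \<inter> - E \<subseteq> T" by auto
    have lev: "{z. z \<notin> E \<and> t \<le> norm (\<Phi> z) \<and> norm (\<Phi> z) \<le> \<rho>} \<subseteq> T \<inter> - E"
      using sub T(2) by blast
    show ?thesis
      by (rule FC_deform[OF t(1,3) lev open_Int[OF T(1) open_E] holomorphic_on_subset[OF T(3) T']]) simp
  qed
  ultimately show ?thesis using 1 by simp
qed

text \<open>The level is sent to infinity. There Psi w grows linearly, so p(Psi w) / w^k tends to 0,
  and the remaining factor 1 / w balances the length of the circle.\<close>

lemma FC_poly:
  assumes s: "1 < s" and k: "degree p < k"
  shows "FC s (poly p) k = 0"
proof -
  obtain c :: real where c: "((\<lambda>w. Psi w / w) \<longlongrightarrow> of_real c) at_infinity" using Psi_ratio by blast
  have L1: "((\<lambda>w. \<Sum>i\<le>degree p. coeff p i * ((Psi w / w) ^ i * (inverse w) ^ (k - i))) \<longlongrightarrow>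
      (\<Sum>i\<le>degree p. coeff p i * (of_real c ^ i * 0 ^ (k - i)))) at_infinity"
    by (intro tendsto_intros c tendsto_inverse_0)
  have L2: "(\<Sum>i\<le>degree p. coeff p i * (of_real c ^ i * 0 ^ (k - i))) = 0"
    using k by (intro sum.neutral) auto
  have L3: "eventually (\<lambda>w. (\<Sum>i\<le>degree p. coeff p i * ((Psi w / w) ^ i * (inverse w) ^ (k - i)))
      = poly p (Psi w) / w ^ k) at_infinity"
    unfolding eventually_at_infinity
  proof (intro exI[of _ 1] allI impI)
    fix w :: complex assume "1 \<le> norm w"
    then have w: "w \<noteq> 0" by auto
    have "(Psi w / w) ^ i * (inverse w) ^ (k - i) = Psi w ^ i / w ^ k" if "i \<le> degree p" for i
    proof -
      have "w ^ i * w ^ (k - i) = w ^ k" using that k by (simp flip: power_add)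
      then show ?thesis using w by (simp add: field_simps)
    qed
    then show "(\<Sum>i\<le>degree p. coeff p i * ((Psi w / w) ^ i * (inverse w) ^ (k - i))) = poly p (Psi w) / w ^ k"
      by (simp add: poly_altdef sum_divide_distrib)
  qed
  have lim0: "((\<lambda>w. poly p (Psi w) / w ^ k) \<longlongrightarrow> 0) at_infinity"
    by (rule Lim_transform_eventually[OF L1[unfolded L2] L3])
  have lim: "eventually (\<lambda>w. norm (poly p (Psi w) / w ^ k) < e) at_infinity" if "e > 0" for e
    using tendstoD[OF lim0 that] by (simp add: dist_norm)
  have small: "norm (FC s (poly p) k) \<le> e" if e: "e > 0" for e
  proof -
    obtain b where b: "\<And>w. b \<le> norm w \<Longrightarrow> norm (poly p (Psi w) / w ^ k) < e"
      using lim[OF e] unfolding eventually_at_infinity by blast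
    define S where "S = max b s"
    have S: "1 < S" "s \<le> S" "b \<le> S" using s by (auto simp: S_def)
    have "FC s (poly p) k = FC S (poly p) k"
      by (rule FC_deform[where S="- E"]) (use s S open_E in \<open>auto intro!: holomorphic_intros\<close>)
    moreover have "norm (2 * of_real pi * \<i> * FC S (poly p) k) \<le> (e / S) * (2 * pi * S)"
      unfolding FC_circle[OF S(1)]
    proof (rule circle_bound)
      fix w :: complex assume w: "norm w = S"
      have "norm (poly p (Psi w) / w ^ (k + 1)) = norm (poly p (Psi w) / w ^ k) / S"
        using w by (simp add: norm_divide norm_mult norm_power)
      also have "\<dots> \<le> e / S" using b[of w] w S by (intro divide_right_mono) auto
      finally show "norm (poly p (Psi w) / w ^ (k + 1)) \<le> e / S" .
    qed (use S e in auto)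
    ultimately show ?thesis using S by (simp add: norm_mult)
  qed
  show ?thesis using field_le_epsilon[of "norm (FC s (poly p) k)" 0] small by simp
qed

end

lemma ereal_less_less: "x < r \<Longrightarrow> ereal r < R \<Longrightarrow> ereal x < R"
  by (rule ereal_le_less) auto

section \<open>Division by a polynomial and bounds from Faber coefficients\<close>

text \<open>This is the dimension count: \<open>card I\<close> independent vectors in a space of
  dimension N \<le> \<open>card I\<close> form a basis. Membership is expressed by vanishing
  coefficients instead of a degree, so that N = 0 means the zero space.\<close>

lemma injective_family_spans:
  fixes x :: "'b \<Rightarrow> complex poly"
  assumes fin: "finite I" and N: "N \<le> card I"
    and deg: "\<And>b i. b \<in> I \<Longrightarrow> N \<le> i \<Longrightarrow> coeff (x b) i = 0"
    and inj: "\<And>c. (\<Sum>b\<in>I. smult (c b) (x b)) = 0 \<Longrightarrow> \<forall>b\<in>I. c b = 0"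
  shows "N = card I" and "\<And>u. (\<And>i. N \<le> i \<Longrightarrow> coeff u i = 0) \<Longrightarrow> \<exists>c. u = (\<Sum>b\<in>I. smult (c b) (x b))"
proof -
  interpret V: vector_space "smult :: complex \<Rightarrow> complex poly \<Rightarrow> complex poly"
    by unfold_locales (simp_all add: smult_add_right smult_add_left)
  define T where "T = (\<lambda>i. monom (1::complex) i) ` {..<N}"
  have T: "finite T" "card T \<le> N" using card_image_le[of "{..<N}"] by (auto simp: T_def)
  have inT: "p \<in> V.span T" if p: "\<And>i. N \<le> i \<Longrightarrow> coeff p i = 0" for p
  proof -
    have "p = (\<Sum>i<N. smult (coeff p i) (monom 1 i))"
    proof (rule poly_eqI)
      fix n
      have "coeff (\<Sum>i<N. smult (coeff p i) (monom 1 i)) n = (\<Sum>i<N. if i = n then coeff p i else 0)"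
        by (simp add: coeff_sum if_distrib cong: if_cong)
      then show "coeff p n = coeff (\<Sum>i<N. smult (coeff p i) (monom 1 i)) n" using p by simp
    qed
    also have "\<dots> \<in> V.span T"
      by (intro V.span_sum V.span_scale V.span_base) (auto simp: T_def)
    finally show ?thesis .
  qed
  \<comment> \<open>Independence concerns sets, so repeated members must be excluded first: they
    would give a relation with coefficients 1 and -1.\<close>
  have injx: "inj_on x I"
  proof (rule inj_onI, rule ccontr)
    fix a b assume ab: "a \<in> I" "b \<in> I" "x a = x b" "a \<noteq> b"
    let ?c = "\<lambda>k. if k = a then 1 else if k = b then -1 else (0::complex)"
    have "(\<Sum>k\<in>I. smult (?c k) (x k)) = (\<Sum>k\<in>{a,b}. smult (?c k) (x k))"
      using fin ab by (intro sum.mono_neutral_right) auto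
    also have "\<dots> = 0" using ab by simp
    finally show False using inj[of ?c] ab by auto
  qed
  have ind: "V.independent (x ` I)"
  proof
    assume "V.dependent (x ` I)"
    then obtain u where u: "\<exists>v\<in>x ` I. u v \<noteq> 0" "(\<Sum>v\<in>x ` I. smult (u v) v) = 0"
      using V.dependent_finite[of "x ` I"] fin by auto
    have "(\<Sum>b\<in>I. smult (u (x b)) (x b)) = 0" using u(2) injx by (simp add: sum.reindex)
    then show False using inj[of "\<lambda>b. u (x b)"] u(1) by auto
  qed
  have sub: "x ` I \<subseteq> V.span T" using inT deg by blast
  have card: "card (x ` I) = card I" using injx by (rule card_image)
  have "card I \<le> card T" using V.independent_span_bound[OF T(1) ind sub] card by simp
  then show NI: "N = card I" using N T by simp
  fix u :: "complex poly" assume u: "\<And>i. N \<le> i \<Longrightarrow> coeff u i = 0"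
  have "u \<in> V.span (x ` I)"
  proof (rule ccontr)
    assume not: "u \<notin> V.span (x ` I)"
    then have "V.independent (insert u (x ` I))" by (rule V.independent_insertI[OF _ ind])
    then have "card (insert u (x ` I)) \<le> card T"
      using V.independent_span_bound[OF T(1)] sub inT[OF u] by blast
    moreover have "u \<notin> x ` I" using not V.span_superset by blast
    ultimately show False using fin card T NI by simp
  qed
  then obtain c where "u = (\<Sum>v\<in>x ` I. smult (c v) v)"
    using V.span_finite[of "x ` I"] fin by auto
  then have "u = (\<Sum>b\<in>I. smult (c (x b)) (x b))" using injx by (simp add: sum.reindex)
  then show "\<exists>c. u = (\<Sum>b\<in>I. smult (c b) (x b))" by (rule exI[of _ "\<lambda>b. c (x b)"])
qed

text \<open>Expanded in powers of x, the quotient of q t - q x by t - x has the Horner tails of q as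
  coefficients; these vanish beyond the degree.\<close>

lemma poly_diff_poly_shift:
  fixes q :: "complex poly"
  assumes "degree q \<le> N"
  shows "poly q t - poly q x = (t - x) * (\<Sum>i<N. x ^ i * poly (poly_shift (Suc i) q) t)"
  using assms
proof (induction q arbitrary: N)
  case (pCons a q)
  show ?case
  proof (cases "q = 0")
    case True
    have "poly_shift (Suc i) [:a:] = 0" for i
      by (rule poly_eqI) (simp add: coeff_poly_shift)
    then show ?thesis using True by simp
  next
    case False
    then obtain K where K: "N = Suc K" "degree q \<le> K" using pCons.prems by (cases N) auto
    have 1: "poly_shift (Suc 0) (pCons a q) = q" "\<And>i. poly_shift (Suc (Suc i)) (pCons a q) = poly_shift (Suc i) q"
      by (rule poly_eqI, simp add: coeff_poly_shift)+
    have "(\<Sum>i<N. x ^ i * poly (poly_shift (Suc i) (pCons a q)) t)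
        = poly q t + x * (\<Sum>i<K. x ^ i * poly (poly_shift (Suc i) q) t)"
      unfolding K(1) by (subst sum.lessThan_Suc_shift) (simp add: 1 sum_distrib_left mult.assoc)
    moreover have "poly (pCons a q) t - poly (pCons a q) x = (t - x) * poly q t + x * (poly q t - poly q x)"
      by (simp add: algebra_simps)
    ultimately show ?thesis unfolding pCons.IH[OF K(2)] by (simp add: distrib_left mult.left_commute)
  qed
qed simp

text \<open>Linear factors are cancelled one by one. At the root just cancelled the new identity
  holds by continuity.\<close>

lemma poly_dvd_of_holomorphic_quotient:
  fixes p q :: "complex poly"
  assumes "open A" "h holomorphic_on A" "q \<noteq> 0" "\<And>\<zeta>. poly q \<zeta> = 0 \<Longrightarrow> \<zeta> \<in> A"
    and "\<And>z. z \<in> A \<Longrightarrow> poly p z = poly q z * h z"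
  shows "q dvd p"
  using assms(3-)
proof (induction "degree q" arbitrary: p q)
  case 0
  then have "q dvd 1" using is_unit_iff_degree[of q] by simp
  then show ?case by (rule unit_imp_dvd)
next
  case (Suc n)
  have "\<not> constant (poly q)" using Suc.hyps(2) by (simp add: constant_degree)
  then obtain \<zeta> where \<zeta>: "poly q \<zeta> = 0" using fundamental_theorem_of_algebra by blast
  then obtain q' where q': "q = [:-\<zeta>, 1:] * q'" by (auto simp: poly_eq_0_iff_dvd)
  have "\<zeta> \<in> A" using \<zeta> Suc.prems by blast
  then have "poly p \<zeta> = 0" using Suc.prems(3) \<zeta> by simp
  then obtain p' where p': "p = [:-\<zeta>, 1:] * p'" by (auto simp: poly_eq_0_iff_dvd)
  have q'0: "q' \<noteq> 0" using Suc.prems(1) q' by auto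
  have "degree q = degree [:-\<zeta>, 1:] + degree q'" unfolding q' by (rule degree_mult_eq) (use q'0 in auto)
  then have deg: "n = degree q'" using Suc.hyps(2) by simp
  have eq: "poly p' z = poly q' z * h z" if z: "z \<in> A" "z \<noteq> \<zeta>" for z
  proof -
    have "(z - \<zeta>) * poly p' z = (z - \<zeta>) * (poly q' z * h z)"
      using Suc.prems(3)[OF z(1)] by (simp add: p' q' algebra_simps)
    then show ?thesis using z(2) by simp
  qed
  have lim1: "((\<lambda>z. poly q' z * h z) \<longlongrightarrow> poly q' \<zeta> * h \<zeta>) (at \<zeta>)"
    using holomorphic_on_imp_continuous_on[OF assms(2)] \<open>\<zeta> \<in> A\<close> assms(1)
    by (intro tendsto_intros isContD) (auto simp: continuous_on_eq_continuous_at)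
  have "eventually (\<lambda>z. z \<in> A - {\<zeta>}) (at \<zeta>)"
    using assms(1) \<open>\<zeta> \<in> A\<close> by (intro eventually_at_in_open) auto
  then have "eventually (\<lambda>z. poly q' z * h z = poly p' z) (at \<zeta>)"
    by eventually_elim (use eq in auto)
  then have "(poly p' \<longlongrightarrow> poly q' \<zeta> * h \<zeta>) (at \<zeta>)" by (rule Lim_transform_eventually[OF lim1])
  moreover have "(poly p' \<longlongrightarrow> poly p' \<zeta>) (at \<zeta>)" by (intro tendsto_intros)
  ultimately have "poly p' \<zeta> = poly q' \<zeta> * h \<zeta>" using tendsto_unique by (metis trivial_limit_at)
  then have "q' dvd p'"
    using Suc.hyps(1)[OF deg q'0, of p'] Suc.prems(2) eq q' by auto
  then show ?case unfolding p' q' by (rule mult_dvd_mono[OF dvd_refl])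
qed

section \<open>Remainders modulo a polynomial, by integrals over level curves\<close>

context exterior begin

lemma lp_Cauchy_holo:
  assumes s: "1 < s" and f: "continuous_on (path_image (lp s)) f"
    and I: "\<And>x. x \<notin> path_image (lp s) \<Longrightarrow> (\<lambda>t. f t / (t - x)) contour_integrable_on lp s"
  shows "(\<lambda>x. contour_integral (lp s) (\<lambda>t. f t / (t - x))) holomorphic_on - path_image (lp s)"
proof -
  obtain M where M: "M > 0" "\<And>w. norm w = s \<Longrightarrow> norm (deriv Psi w) \<le> M" using deriv_Psi_bound[OF s] by blast
  have n: "norm (circlepath 0 s t) = s" for t using s by (simp add: circlepath norm_mult)
  \<comment> \<open>\<open>Cauchy_next_derivative\<close> asks for a bound on the speed of the
    curve.\<close>
  have vd: "norm (vector_derivative (lp s) (at t)) \<le> 2 * pi * s * M" for t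
    using s M(2)[OF n[of t]]
    by (auto simp: lp_vd[OF s] vector_derivative_circlepath norm_mult intro!: mult_mono)
  show ?thesis
    unfolding holomorphic_on_def
  proof
    fix x assume x: "x \<in> - path_image (lp s)"
    have "((\<lambda>x. contour_integral (lp s) (\<lambda>t. f t / (t - x))) has_field_derivative
        (of_nat 1 * contour_integral (lp s) (\<lambda>u. f u / (u - x) ^ Suc 1))) (at x)"
      by (rule Cauchy_next_derivative(2)[OF f vd, of UNIV])
         (use x I s in \<open>auto intro!: has_contour_integral_integral lp_valid\<close>)
    then show "(\<lambda>x. contour_integral (lp s) (\<lambda>t. f t / (t - x))) field_differentiable at x within - path_image (lp s)"
      using field_differentiable_def field_differentiable_at_within by blast
  qed
qed

text \<open>
  Hermite's formula for the remainder of \<open>f\<close> modulo \<open>q\<close>, with the coefficients of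
  \<open>(q t - q x) / (t - x)\<close> as a polynomial in \<open>x\<close>. Being an integral over two level curves, it bounds
  the remainder by the supremum of \<open>f\<close> on these curves.
\<close>

definition divrem :: "real \<Rightarrow> real \<Rightarrow> complex poly \<Rightarrow> (complex \<Rightarrow> complex) \<Rightarrow> complex poly" where
  "divrem s r q f = (\<Sum>i<degree q. monom ((contour_integral (lp r) (\<lambda>t. f t * poly (poly_shift (Suc i) q) t / poly q t)
      - contour_integral (lp s) (\<lambda>t. f t * poly (poly_shift (Suc i) q) t / poly q t)) / (2 * of_real pi * \<i>)) i)"

lemma coeff_divrem: "coeff (divrem s r q f) i = (if i < degree q then
    (contour_integral (lp r) (\<lambda>t. f t * poly (poly_shift (Suc i) q) t / poly q t)
      - contour_integral (lp s) (\<lambda>t. f t * poly (poly_shift (Suc i) q) t / poly q t)) / (2 * of_real pi * \<i>) else 0)"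
  by (simp add: divrem_def coeff_sum)

text \<open>The kernel (q t - q x) / ((t - x) q t) splits into 1 / (t - x), which reproduces
  \<open>f\<close> by Cauchy's formula, and -q x / (q t (t - x)), which gives a multiple of q x by a
  Cauchy integral holomorphic between the curves. The latter is the quotient.\<close>

lemma divrem_spec:
  assumes s: "1 < s" "s < r" "ereal r < R" and q: "q \<noteq> 0"
    and roots: "\<And>\<zeta>. poly q \<zeta> = 0 \<Longrightarrow> \<zeta> \<notin> E \<and> s < norm (\<Phi> \<zeta>) \<and> norm (\<Phi> \<zeta>) < r"
    and f: "f holomorphic_on ann R"
  obtains h where "h holomorphic_on ann R"
    "\<And>x. x \<in> ann R \<Longrightarrow> f x = poly (divrem s r q f) x + poly q x * h x"
proof -
  define c where "c = 2 * of_real pi * \<i>"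
  have c0: "c \<noteq> 0" by (simp add: c_def)
  define u where "u = divrem s r q f"
  define I where "I v x = contour_integral (lp v) (\<lambda>t. (f t / poly q t) / (t - x))" for v x
  define A where "A = {z. z \<notin> E \<and> s < norm (\<Phi> z) \<and> ereal (norm (\<Phi> z)) < ereal r}"
  have oA: "open A" unfolding A_def by (rule open_lev_between)
  have AR: "A \<subseteq> ann R" using s by (auto simp: A_def in_ann intro: ereal_less_less[of _ r])
  define Z where "Z = {\<zeta>. poly q \<zeta> = 0}"
  have finZ: "finite Z" using q poly_roots_finite by (auto simp: Z_def)
  define W where "W = ann R - Z"
  have oW: "open W" unfolding W_def using open_ann finZ by (simp add: open_Diff finite_imp_closed)
  have hq: "(\<lambda>t. f t / poly q t) holomorphic_on W"
    by (intro holomorphic_intros holomorphic_on_subset[OF f]) (auto simp: W_def Z_def)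
  have levW: "level v \<subseteq> W" if "v = r \<or> v = s" for v
    using that s roots by (auto simp: W_def in_ann Z_def intro: ereal_less_less[of _ r])
  have v1: "1 < v" if "v = r \<or> v = s" for v using that s by auto
  have Iint: "(\<lambda>t. f t / poly q t / (t - x)) contour_integrable_on lp v" if v: "v = r \<or> v = s" "x \<notin> path_image (lp v)" for v x
  proof (rule lp_integrable[OF v1[OF v(1)]])
    show "open (W - {x})" using oW by (rule open_delete)
    show "(\<lambda>t. f t / poly q t / (t - x)) holomorphic_on W - {x}"
      by (intro holomorphic_intros holomorphic_on_subset[OF hq]) auto
    show "level v \<subseteq> W - {x}"
      using levW[OF v(1)] v(2) lp_image[OF v1[OF v(1)]] by auto
  qed
  have Kint: "(\<lambda>t. x ^ i * (f t * poly (poly_shift (Suc i) q) t / poly q t)) contour_integrable_on lp v" 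
    if v: "v = r \<or> v = s" for v x i
  proof -
    have "(\<lambda>t. x ^ i * (f t / poly q t * poly (poly_shift (Suc i) q) t)) contour_integrable_on lp v"
      by (rule lp_integrable[OF v1[OF v] oW _ levW[OF v]]) (intro holomorphic_intros hq)
    then show ?thesis by (simp add: mult_ac)
  qed
  have fint: "(\<lambda>t. f t / (t - x)) contour_integrable_on lp v" if v: "v = r \<or> v = s" "x \<notin> path_image (lp v)" for v x
  proof (rule lp_integrable[OF v1[OF v(1)]])
    show "open (W - {x})" using oW by (rule open_delete)
    show "(\<lambda>t. f t / (t - x)) holomorphic_on W - {x}"
      by (intro holomorphic_intros holomorphic_on_subset[OF f]) (auto simp: W_def)
    show "level v \<subseteq> W - {x}"
      using levW[OF v(1)] v(2) lp_image[OF v1[OF v(1)]] by auto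
  qed
  have part: "(\<Sum>i<degree q. x ^ i * contour_integral (lp v) (\<lambda>t. f t * poly (poly_shift (Suc i) q) t / poly q t))
      = contour_integral (lp v) (\<lambda>t. f t / (t - x)) - poly q x * I v x"
    if v: "v = r \<or> v = s" "x \<notin> path_image (lp v)" for v x
  proof -
    have "(\<Sum>i<degree q. x ^ i * contour_integral (lp v) (\<lambda>t. f t * poly (poly_shift (Suc i) q) t / poly q t))
       = (\<Sum>i<degree q. contour_integral (lp v) (\<lambda>t. x ^ i * (f t * poly (poly_shift (Suc i) q) t / poly q t)))"
    proof (rule sum.cong)
      fix i
      have "(\<lambda>t. f t * poly (poly_shift (Suc i) q) t / poly q t) contour_integrable_on lp v"
      proof -
        have "(\<lambda>t. f t / poly q t * poly (poly_shift (Suc i) q) t) contour_integrable_on lp v"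
          by (rule lp_integrable[OF v1[OF v(1)] oW _ levW[OF v(1)]]) (intro holomorphic_intros hq)
        then show ?thesis by simp
      qed
      then show "x ^ i * contour_integral (lp v) (\<lambda>t. f t * poly (poly_shift (Suc i) q) t / poly q t)
         = contour_integral (lp v) (\<lambda>t. x ^ i * (f t * poly (poly_shift (Suc i) q) t / poly q t))"
        by (rule contour_integral_lmul[symmetric])
    qed simp
    also have "\<dots> = contour_integral (lp v) (\<lambda>t. \<Sum>i<degree q. x ^ i * (f t * poly (poly_shift (Suc i) q) t / poly q t))"
      using Kint[OF v(1)] by (intro contour_integral_sum[symmetric]) auto
    also have "\<dots> = contour_integral (lp v) (\<lambda>t. f t / (t - x) - poly q x * (f t / poly q t / (t - x)))"
    proof (rule contour_integral_eq)
      fix t assume "t \<in> path_image (lp v)"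
      then have t: "t \<noteq> x" "poly q t \<noteq> 0"
        using v levW[OF v(1)] lp_image[OF v1[OF v(1)]] by (auto simp: W_def Z_def)
      have "(\<Sum>i<degree q. x ^ i * (f t * poly (poly_shift (Suc i) q) t / poly q t))
         = f t / poly q t * (\<Sum>i<degree q. x ^ i * poly (poly_shift (Suc i) q) t)"
        by (simp add: sum_distrib_left mult_ac)
      also have "(\<Sum>i<degree q. x ^ i * poly (poly_shift (Suc i) q) t) = (poly q t - poly q x) / (t - x)"
        using poly_diff_poly_shift[of q "degree q" t x] t by simp
      also have "f t / poly q t * ((poly q t - poly q x) / (t - x)) = f t / (t - x) - poly q x * (f t / poly q t / (t - x))"
      proof -
        have "a / Q * ((Q - b) / d) = a / d - b * (a / Q / d)" if "Q \<noteq> 0" "d \<noteq> 0" for a b d Q :: complex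
          using that by (simp add: field_simps)
        then show ?thesis using t by simp
      qed
      finally show "(\<Sum>i<degree q. x ^ i * (f t * poly (poly_shift (Suc i) q) t / poly q t))
          = f t / (t - x) - poly q x * (f t / poly q t / (t - x))" .
    qed
    also have "\<dots> = contour_integral (lp v) (\<lambda>t. f t / (t - x)) - poly q x * I v x"
      unfolding I_def contour_integral_lmul[OF Iint[OF v], symmetric]
      by (rule contour_integral_diff[OF fint[OF v] contour_integrable_lmul[OF Iint[OF v]]])
    finally show ?thesis .
  qed
  define g where "g = (\<lambda>x. (I r x - I s x) / c)"
  have eqA: "f x = poly u x + poly q x * g x" if x: "x \<in> A" for x
  proof -
    have x': "x \<notin> path_image (lp r)" "x \<notin> path_image (lp s)" using x s by (auto simp: A_def lp_image)
    have deg: "poly u x = (\<Sum>i<degree q. x ^ i * coeff u i)"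
      unfolding u_def divrem_def by (simp add: poly_sum poly_monom coeff_sum mult.commute)
    have "c * poly u x = (\<Sum>i<degree q. x ^ i * (contour_integral (lp r) (\<lambda>t. f t * poly (poly_shift (Suc i) q) t / poly q t)
         - contour_integral (lp s) (\<lambda>t. f t * poly (poly_shift (Suc i) q) t / poly q t)))"
      unfolding deg sum_distrib_left
      by (intro sum.cong refl) (simp add: u_def coeff_divrem c_def[symmetric] c0)
    also have "\<dots> = (contour_integral (lp r) (\<lambda>t. f t / (t - x)) - contour_integral (lp s) (\<lambda>t. f t / (t - x)))
        - poly q x * (I r x - I s x)"
      using part[of r x] part[of s x] x' by (simp add: right_diff_distrib sum_subtractf)
    also have "\<dots> = c * f x - poly q x * (I r x - I s x)"
      using Cauchy_ann[OF s f, of x] x by (simp add: A_def c_def)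
    finally have e: "c * f x = c * poly u x + poly q x * (I r x - I s x)" by simp
    have "f x = (c * f x) / c" using c0 by simp
    also have "\<dots> = poly u x + poly q x * g x" unfolding e g_def using c0 by (simp add: add_divide_distrib)
    finally show ?thesis .
  qed
  have gholo: "g holomorphic_on A"
  proof -
    have "I v holomorphic_on A" if v: "v = r \<or> v = s" for v
      unfolding I_def
    proof (rule holomorphic_on_subset[OF lp_Cauchy_holo[OF v1[OF v]]])
      show "continuous_on (path_image (lp v)) (\<lambda>t. f t / poly q t)"
        using holomorphic_on_imp_continuous_on[OF hq] levW[OF v] lp_image[OF v1[OF v]]
        by (auto intro: continuous_on_subset)
      show "A \<subseteq> - path_image (lp v)" using v s by (auto simp: lp_image A_def)
    qed (use Iint[OF v] in auto)
    then show ?thesis unfolding g_def by (intro holomorphic_intros) (auto simp: c0)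
  qed
  \<comment> \<open>The Cauchy integral \<open>g\<close> represents the quotient only between the
    curves, but all roots of \<open>q\<close> are there; elsewhere the quotient is found by
    dividing. The two agree on the overlap.\<close>
  define h where "h = (\<lambda>x. if poly q x = 0 then g x else (f x - poly u x) / poly q x)"
  have "h holomorphic_on A"
    by (rule holomorphic_transform[OF gholo]) (use eqA in \<open>auto simp: h_def\<close>)
  moreover have "h holomorphic_on W"
  proof (rule holomorphic_transform)
    show "(\<lambda>x. (f x - poly u x) / poly q x) holomorphic_on W"
      by (intro holomorphic_intros holomorphic_on_subset[OF f]) (auto simp: W_def Z_def)
  qed (auto simp: h_def W_def Z_def)
  ultimately have "h holomorphic_on A \<union> W" using oA oW by (simp add: holomorphic_on_Un)
  moreover have "A \<union> W = ann R" using AR roots by (auto simp: W_def Z_def A_def)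
  ultimately have "h holomorphic_on ann R" by simp
  moreover have "f x = poly (divrem s r q f) x + poly q x * h x" if "x \<in> ann R" for x
    using eqA[of x] roots[of x] by (auto simp: h_def A_def u_def)
  ultimately show ?thesis by (rule that)
qed

text \<open>\<open>C\<close> is fixed before \<open>f\<close>, since it will be applied to functions
  that contain powers \<Phi>^n.\<close>

lemma divrem_bound:
  assumes s: "1 < s" "s < r" and q: "q \<noteq> 0"
    and roots: "\<And>\<zeta>. poly q \<zeta> = 0 \<Longrightarrow> \<zeta> \<notin> E \<and> s < norm (\<Phi> \<zeta>) \<and> norm (\<Phi> \<zeta>) < r"
  obtains C where "C > 0"
    "\<And>(f :: complex \<Rightarrow> complex) B i. 0 \<le> B \<Longrightarrow> (\<And>z. z \<notin> E \<Longrightarrow> norm (\<Phi> z) = s \<or> norm (\<Phi> z) = r \<Longrightarrow> norm (f z) \<le> B)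
       \<Longrightarrow> norm (coeff (divrem s r q f) i) \<le> C * B"
proof -
  define X where "X = level s \<union> level r"
  have X: "compact X" unfolding X_def using s by (intro compact_Un compact_level) auto
  have "\<exists>M>0. \<forall>z\<in>X. norm (poly (poly_shift (Suc i) q) z / poly q z) \<le> M" for i
  proof -
    have "continuous_on X (\<lambda>z. poly (poly_shift (Suc i) q) z / poly q z)"
      by (intro continuous_intros) (use roots in \<open>auto simp: X_def\<close>)
    then have "bounded ((\<lambda>z. poly (poly_shift (Suc i) q) z / poly q z) ` X)"
      by (intro compact_imp_bounded compact_continuous_image X)
    then show ?thesis unfolding bounded_pos by auto
  qed
  then obtain M where M: "\<And>i. M i > 0" "\<And>i z. z \<in> X \<Longrightarrow> norm (poly (poly_shift (Suc i) q) z / poly q z) \<le> M i" by metis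
  define K where "K = (\<Sum>i<degree q. M i) + 1"
  have K: "M i \<le> K" "K > 0" if "i < degree q" for i
  proof -
    have "M i \<le> (\<Sum>i<degree q. M i)" using that M(1) by (intro member_le_sum) (auto intro: less_imp_le)
    then show "M i \<le> K" by (simp add: K_def)
    then show "K > 0" using M(1)[of i] by linarith
  qed
  have K0: "K > 0" unfolding K_def using M(1) by (intro add_nonneg_pos sum_nonneg) (auto intro: less_imp_le)
  obtain Cs where Cs: "Cs > 0" "\<And>(f::complex\<Rightarrow>complex) B. 0 \<le> B \<Longrightarrow> (\<And>z. z \<notin> E \<Longrightarrow> norm (\<Phi> z) = s \<Longrightarrow> norm (f z) \<le> B) \<Longrightarrow> norm (contour_integral (lp s) f) \<le> Cs * B"
    using lp_bound[OF s(1)] by blast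
  have r1: "1 < r" using s by simp
  obtain Cr where Cr: "Cr > 0" "\<And>(f::complex\<Rightarrow>complex) B. 0 \<le> B \<Longrightarrow> (\<And>z. z \<notin> E \<Longrightarrow> norm (\<Phi> z) = r \<Longrightarrow> norm (f z) \<le> B) \<Longrightarrow> norm (contour_integral (lp r) f) \<le> Cr * B"
    using lp_bound[OF r1] by blast
  show ?thesis
  proof (rule that[of "(Cr * K + Cs * K) / (2 * pi)"])
    show "(Cr * K + Cs * K) / (2 * pi) > 0" using Cr Cs K0 by (simp add: add_pos_pos)
    fix f :: "complex \<Rightarrow> complex" and B i assume B: "0 \<le> (B::real)" "\<And>z. z \<notin> E \<Longrightarrow> norm (\<Phi> z) = s \<or> norm (\<Phi> z) = r \<Longrightarrow> norm (f z) \<le> B"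
    show "norm (coeff (divrem s r q f) i) \<le> (Cr * K + Cs * K) / (2 * pi) * B"
    proof (cases "i < degree q")
      case True
      let ?k = "\<lambda>t. f t * poly (poly_shift (Suc i) q) t / poly q t"
      have bd: "norm (?k z) \<le> B * K" if "z \<notin> E" "norm (\<Phi> z) = s \<or> norm (\<Phi> z) = r" for z
      proof -
        have "norm (?k z) = norm (f z) * norm (poly (poly_shift (Suc i) q) z / poly q z)"
          by (simp add: norm_mult norm_divide)
        also have "\<dots> \<le> B * K"
          using B that M(2)[of z i] K(1)[OF True] by (intro mult_mono) (auto simp: X_def)
        finally show ?thesis .
      qed
      have BK: "0 \<le> B * K" using B K0 by simp
      have "norm (contour_integral (lp r) ?k - contour_integral (lp s) ?k) \<le> Cr * (B * K) + Cs * (B * K)"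
        by (intro order.trans[OF norm_triangle_ineq4] add_mono Cr(2) Cs(2) BK bd) auto
      then have "norm (coeff (divrem s r q f) i) \<le> (Cr * (B * K) + Cs * (B * K)) / (2 * pi)"
        using True by (simp add: coeff_divrem norm_divide norm_mult divide_right_mono)
      then show ?thesis by (simp add: algebra_simps add_divide_distrib)
    next
      case False
      then show ?thesis using B Cr Cs K0 by (simp add: coeff_divrem)
    qed
  qed
qed

section \<open>Maximum principle, and bounds of a function by its Faber coefficients\<close>

text \<open>In the coordinate w = \<Phi> z the region is a round annulus, and f(Psi w) / w^n is
  bounded by the same \<open>B\<close> on both boundary circles.\<close>

lemma annulus_max:
  assumes s: "1 < s" "s < r" "ereal r < R" and f: "f holomorphic_on ann R"
    and bs: "\<And>z. z \<notin> E \<Longrightarrow> norm (\<Phi> z) = s \<Longrightarrow> norm (f z) \<le> B * s ^ n"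
    and br: "\<And>z. z \<notin> E \<Longrightarrow> norm (\<Phi> z) = r \<Longrightarrow> norm (f z) \<le> B * r ^ n"
    and z: "z \<notin> E" "s \<le> norm (\<Phi> z)" "norm (\<Phi> z) \<le> r"
  shows "norm (f z) \<le> B * norm (\<Phi> z) ^ n"
proof -
  define g where "g = (\<lambda>w. f (Psi w) / w ^ n)"
  define S where "S = {w::complex. s \<le> norm w \<and> norm w \<le> r}"
  have "(f \<circ> Psi) holomorphic_on {w. 1 < norm w \<and> ereal (norm w) < R}"
    by (rule holomorphic_on_compose_gen[OF holomorphic_on_subset[OF Psi_holo] f])
       (auto simp: in_ann Psi_notin Phi_Psi)
  then have hg: "g holomorphic_on {w. 1 < norm w \<and> ereal (norm w) < R}"
    unfolding g_def o_def by (intro holomorphic_intros) auto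
  have SR: "S \<subseteq> {w. 1 < norm w \<and> ereal (norm w) < R}"
    using s by (auto simp: S_def intro: ereal_le_less[of _ r])
  have S_eq: "S = cball 0 r - ball 0 s" by (auto simp: S_def)
  have cl: "closed S" unfolding S_eq by (intro closed_Diff) auto
  have op: "ball 0 r - cball (0::complex) s \<subseteq> interior S"
    by (rule interior_maximal) (auto simp: S_eq)
  have "norm (g (\<Phi> z)) \<le> B"
  proof (rule maximum_modulus_frontier[of g S])
    show "g holomorphic_on interior S" using hg SR interior_subset holomorphic_on_subset by blast
    show "continuous_on (closure S) g"
      using holomorphic_on_imp_continuous_on[OF hg] SR cl by (auto intro: continuous_on_subset)
    show "bounded S" unfolding S_eq by (rule bounded_diff) simp
    show "\<Phi> z \<in> S" using z by (simp add: S_def)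
    fix w assume "w \<in> frontier S"
    then have w: "w \<in> S" "w \<notin> interior S" using cl by (auto simp: frontier_def)
    then have "norm w = s \<or> norm w = r" using op by (force simp: S_def)
    moreover have "0 < norm w ^ n" using w(1) s by (auto simp: S_def intro!: zero_less_power)
    ultimately show "norm (g w) \<le> B"
      using s bs[of "Psi w"] br[of "Psi w"] Psi_notin[of w] Phi_Psi[of w]
      by (auto simp: g_def norm_divide norm_power pos_divide_le_eq)
  qed
  then show ?thesis using z Phi_nz[OF z(1)] Psi_Phi[OF z(1)]
    by (simp add: g_def norm_divide norm_power divide_le_eq)
qed

text \<open>
  With \<open>u \<zeta> = \<zeta> \<Psi>(1/\<zeta>)\<close>, extended by \<open>u 0 = lim \<Psi>(w)/w\<close>, one has
  \<open>w \<Psi>'(w) / (\<Psi>(w) - z) = (u \<zeta> - \<zeta> u' \<zeta>) / (u \<zeta> - z \<zeta>)\<close> for \<open>\<zeta> = 1/w\<close>, which is regular at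
  \<open>\<zeta> = 0\<close>; the coefficients \<open>a\<close> are the values of the Faber polynomials at \<open>z\<close>.
\<close>

lemma kernel_expansion:
  assumes s': "1 < s'" "s' < \<sigma>"
  obtains B where "B > 0"
    "\<And>z. z \<in> dom (ereal s') \<Longrightarrow> \<exists>a. (\<forall>j. norm (a j) \<le> B * \<sigma> ^ j) \<and>
       (\<forall>w. s' < norm w \<longrightarrow> (\<lambda>j. a j / w ^ (j + 1)) sums (deriv Psi w / (Psi w - z)))"
proof -
  have \<sigma>: "1 < \<sigma>" using s' by simp
  obtain M where M: "M > 0" "\<And>w. norm w = \<sigma> \<Longrightarrow> norm (deriv Psi w) \<le> M" using deriv_Psi_bound[OF \<sigma>] by blast
  have disj: "(sublevel s') \<inter> level \<sigma> = {}" using s' by auto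
  obtain \<delta> where \<delta>: "\<delta> > 0" "\<And>x y. x \<in> sublevel s' \<Longrightarrow> y \<in> level \<sigma> \<Longrightarrow> \<delta> \<le> dist x y"
    using separate_compact_closed[OF compact_sublevel compact_imp_closed[OF compact_level[OF \<sigma>]] disj] by auto
  obtain c :: real where c: "c > 0" "((\<lambda>w. Psi w / w) \<longlongrightarrow> of_real c) at_infinity" using Psi_ratio by blast
  define u where "u = (\<lambda>\<zeta>. if \<zeta> = 0 then of_real c else \<zeta> * Psi (1 / \<zeta>))"
  have uholo: "u holomorphic_on ball 0 1"
  proof -
    have "(\<lambda>\<zeta>. \<zeta> * Psi (1 / \<zeta>)) holomorphic_on ball 0 1 - {0}"
      by (intro holomorphic_intros holomorphic_on_compose_gen[OF _ Psi_holo, unfolded o_def])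
         (auto simp: norm_divide field_simps)
    moreover have "((\<lambda>\<zeta>. \<zeta> * Psi (1 / \<zeta>)) \<longlongrightarrow> of_real c) (at 0)"
    proof -
      have "filterlim (\<lambda>\<zeta>::complex. 1 / \<zeta>) at_infinity (at 0)"
        using filterlim_inverse_at_infinity by (simp add: inverse_eq_divide[abs_def])
      then have "((\<lambda>\<zeta>. Psi (1 / \<zeta>) / (1 / \<zeta>)) \<longlongrightarrow> of_real c) (at 0)"
        by (rule filterlim_compose[OF c(2)])
      then show ?thesis by (simp add: mult.commute)
    qed
    ultimately show ?thesis unfolding u_def by (intro removable_singularity) auto
  qed
  have uP: "Psi w = w * u (1 / w)" if "1 < norm w" for w
    using that by (auto simp: u_def)
  have du: "deriv Psi w = u (1 / w) - deriv u (1 / w) / w" if w: "1 < norm w" for w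
  proof -
    have w0: "w \<noteq> 0" using w by auto
    have "1 / w \<in> ball 0 1" using w by (auto simp: norm_divide divide_less_eq)
    then have d1: "(u has_field_derivative deriv u (1 / w)) (at (1 / w))"
      using uholo by (intro holomorphic_derivI[OF uholo]) auto
    have d2: "((\<lambda>w. 1 / w) has_field_derivative (- 1 / w\<^sup>2)) (at w)"
      using w0 by (auto intro!: derivative_eq_intros simp: power2_eq_square)
    have "((\<lambda>w. w * u (1 / w)) has_field_derivative (1 * u (1 / w) + deriv u (1 / w) * (- 1 / w\<^sup>2) * w)) (at w)"
      by (rule DERIV_mult[OF DERIV_ident DERIV_chain2[OF d1 d2]])
    then have d3: "((\<lambda>w. w * u (1 / w)) has_field_derivative (u (1 / w) - deriv u (1 / w) / w)) (at w)"
      using w0 by (simp add: power2_eq_square)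
    have "eventually (\<lambda>w. w \<in> {w. 1 < norm w}) (nhds w)"
      by (rule eventually_nhds_in_open[OF open_ext]) (use w in simp)
    then have ev: "eventually (\<lambda>w. w * u (1 / w) = Psi w) (nhds w)"
      by (rule eventually_mono) (metis mem_Collect_eq uP)
    have "(Psi has_field_derivative (u (1 / w) - deriv u (1 / w) / w)) (at w)"
      by (rule DERIV_cong_ev[OF refl ev refl, THEN iffD1, OF d3])
    then show ?thesis by (rule DERIV_imp_deriv)
  qed
  \<comment> \<open>On |\<zeta>| = 1 / \<sigma>, that is |w| = \<sigma>, the kernel w Psi'(w) / (Psi
    w - z) is at most \<sigma> M / \<delta>, where \<delta> separates the level \<sigma> from the
    whole sublevel set containing \<open>z\<close>. Cauchy's inequality then bounds all
    coefficients, uniformly in \<open>z\<close>.\<close>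
  show ?thesis
  proof (rule that[of "\<sigma> * (M / \<delta>)"])
    show "\<sigma> * (M / \<delta>) > 0" using \<sigma> M \<delta> by simp
    fix z assume z: "z \<in> dom (ereal s')"
    define \<kappa> where "\<kappa> = (\<lambda>\<zeta>. (u \<zeta> - \<zeta> * deriv u \<zeta>) / (u \<zeta> - z * \<zeta>))"
    have nz: "u \<zeta> - z * \<zeta> \<noteq> 0" if \<zeta>: "norm \<zeta> < 1 / s'" for \<zeta>
    proof (cases "\<zeta> = 0")
      case True then show ?thesis using c by (simp add: u_def)
    next
      case False
      have n: "s' < norm (1 / \<zeta>)" using \<zeta> False s' by (simp add: norm_divide field_simps)
      then have "Psi (1 / \<zeta>) \<noteq> z"
        using z s' Psi_notin[of "1/\<zeta>"] Phi_Psi[of "1/\<zeta>"] by (auto simp: dom_ereal_iff)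
      then show ?thesis using False by (simp add: u_def mult.commute)
    qed
    have b1: "ball 0 (1/s') \<subseteq> ball (0::complex) 1" using s' by (intro subset_ball) simp
    have \<kappa>holo: "\<kappa> holomorphic_on ball 0 (1/s')"
      unfolding \<kappa>_def using nz
      by (intro holomorphic_intros holomorphic_on_subset[OF uholo b1] holomorphic_on_subset[OF holomorphic_deriv[OF uholo open_ball] b1])
         auto
    have \<kappa>eq: "\<kappa> (1 / w) = w * (deriv Psi w / (Psi w - z))" if w: "s' < norm w" for w
    proof -
      have w': "1 < norm w" "w \<noteq> 0" using w s' by auto
      have "u (1/w) - z * (1/w) = (Psi w - z) / w" using uP[OF w'(1)] w' by (simp add: field_simps)
      moreover have "u (1/w) - (1/w) * deriv u (1/w) = deriv Psi w" using du[OF w'(1)] by simp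
      ultimately show ?thesis using w' by (simp add: \<kappa>_def)
    qed
    define a where "a = (\<lambda>j. (deriv ^^ j) \<kappa> 0 / fact j)"
    have a1: "norm (a j) \<le> \<sigma> * (M / \<delta>) * \<sigma> ^ j" for j
    proof -
      have "norm ((deriv ^^ j) \<kappa> 0) \<le> (fact j) * (\<sigma> * (M / \<delta>)) / (1/\<sigma>) ^ j"
      proof (rule Cauchy_inequality)
        have "1 / \<sigma> < 1 / s'" using s' by (intro frac_less2) auto
        then have sub: "cball (0::complex) (1/\<sigma>) \<subseteq> ball 0 (1/s')" by auto
        then show "continuous_on (cball 0 (1/\<sigma>)) \<kappa>"
          by (rule holomorphic_on_imp_continuous_on[OF holomorphic_on_subset[OF \<kappa>holo]])
        show "\<kappa> holomorphic_on ball 0 (1/\<sigma>)"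
          using sub by (intro holomorphic_on_subset[OF \<kappa>holo]) auto
        fix x :: complex assume "norm (0 - x) = 1 / \<sigma>"
        then have x: "norm x = 1 / \<sigma>" by simp
        define w where "w = 1 / x"
        have w: "norm w = \<sigma>" "x = 1 / w" using x by (simp_all add: w_def norm_divide)
        have w1: "1 < norm w" using w \<sigma> by simp
        have "\<delta> \<le> dist z (Psi w)"
          using z w w1 s' Psi_notin[OF w1] Phi_Psi[OF w1] by (intro \<delta>(2)) (auto simp: dom_ereal_iff)
        then have d: "\<delta> \<le> norm (Psi w - z)" by (simp add: dist_norm norm_minus_commute)
        have "norm (\<kappa> x) = \<sigma> * (norm (deriv Psi w) / norm (Psi w - z))"
          using \<kappa>eq[of w] w s' by (simp add: norm_mult norm_divide)
        also have "\<dots> \<le> \<sigma> * (M / \<delta>)"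
          using M(2)[OF w(1)] d \<delta>(1) \<sigma> M(1) by (intro mult_left_mono frac_le) auto
        finally show "norm (\<kappa> x) \<le> \<sigma> * (M / \<delta>)" .
      qed (use \<sigma> in auto)
      then show ?thesis by (simp add: a_def norm_divide field_simps)
    qed
    have a2: "(\<lambda>j. a j / w ^ (j + 1)) sums (deriv Psi w / (Psi w - z))" if w: "s' < norm w" for w
    proof -
      have w0: "w \<noteq> 0" using w s' by auto
      have "1 / norm w < 1 / s'" using w s' by (intro frac_less2) auto
      then have "1 / w \<in> ball 0 (1/s')" by (simp add: norm_divide)
      from holomorphic_power_series[OF \<kappa>holo this]
      have "(\<lambda>j. a j * (1 / w) ^ j) sums (w * (deriv Psi w / (Psi w - z)))"
        by (simp add: a_def \<kappa>eq[OF w])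
      then have "(\<lambda>j. (1 / w) * (a j * (1 / w) ^ j)) sums ((1 / w) * (w * (deriv Psi w / (Psi w - z))))"
        by (rule sums_mult)
      then show ?thesis using w0 by (simp add: power_divide)
    qed
    show "\<exists>a. (\<forall>j. norm (a j) \<le> \<sigma> * (M / \<delta>) * \<sigma> ^ j) \<and>
       (\<forall>w. s' < norm w \<longrightarrow> (\<lambda>j. a j / w ^ (j + 1)) sums (deriv Psi w / (Psi w - z)))"
      using a1 a2 by blast
  qed
qed

text \<open>Integrating the expanded kernel against \<open>f\<close> on the level \<open>s\<close>
  gives f z as the sum of a_j times the j-th Faber coefficient. The terms are dominated by a
  geometric series of ratio \<sigma> / s. \<open>R\<close> is quantified after \<open>C\<close>, so
  that both entire functions and functions with poles further out are covered.\<close>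

lemma faber_bound:
  assumes s': "1 < s'" "s' < s"
  obtains C where "C > 0"
    "\<And>f R A z. ereal s < R \<Longrightarrow> f holomorphic_on dom R \<Longrightarrow> (\<And>j. norm (FC s f j) \<le> A / s ^ j)
       \<Longrightarrow> z \<in> dom (ereal s') \<Longrightarrow> norm (f z) \<le> C * A"
proof -
  define \<sigma> where "\<sigma> = (s' + s) / 2"
  have \<sigma>: "s' < \<sigma>" "\<sigma> < s" "0 < \<sigma>" "1 < s" using s' by (auto simp: \<sigma>_def)
  obtain B where B: "B > 0"
    "\<And>z. z \<in> dom (ereal s') \<Longrightarrow> \<exists>a. (\<forall>j. norm (a j) \<le> B * \<sigma> ^ j) \<and>
       (\<forall>w. s' < norm w \<longrightarrow> (\<lambda>j. a j / w ^ (j + 1)) sums (deriv Psi w / (Psi w - z)))"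
    using kernel_expansion[OF s'(1) \<sigma>(1)] by blast
  have q: "\<sigma> / s < 1" "0 \<le> \<sigma> / s" using \<sigma> by auto
  show ?thesis
  proof (rule that[of "B * (1 / (1 - \<sigma> / s))"])
    show "B * (1 / (1 - \<sigma> / s)) > 0" using B q by simp
    fix f R A z
    assume R: "ereal s < R" and f: "f holomorphic_on dom R" and A: "\<And>j. norm (FC s f j) \<le> A / s ^ j"
      and z: "z \<in> dom (ereal s')"
    define c where "c = 2 * of_real pi * \<i>"
    have c0: "c \<noteq> 0" by (simp add: c_def)
    obtain a where a: "\<And>j. norm (a j) \<le> B * \<sigma> ^ j"
      "\<And>w. s' < norm w \<Longrightarrow> (\<lambda>j. a j / w ^ (j + 1)) sums (deriv Psi w / (Psi w - z))"
      using B(2)[OF z] by blast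
    have zs: "z \<in> dom (ereal s)" using z s' by (auto simp: dom_ereal_iff)
    define g where "g = (\<lambda>j w. f (Psi w) * (a j / w ^ (j + 1)))"
    have fc: "continuous_on (sphere 0 s) (\<lambda>w. f (Psi w))"
    proof (rule continuous_on_compose2[OF holomorphic_on_imp_continuous_on[OF f]])
      show "continuous_on (sphere 0 s) Psi" by (rule continuous_on_subset[OF Psi_cont]) (use \<sigma> in auto)
      show "Psi ` sphere 0 s \<subseteq> dom R" using \<sigma> R by (auto simp: canonical_domain_def Phi_Psi)
    qed
    then have "bounded ((\<lambda>w. f (Psi w)) ` sphere 0 s)"
      by (intro compact_imp_bounded compact_continuous_image) auto
    then obtain K where K: "K > 0" "\<And>w. norm w = s \<Longrightarrow> norm (f (Psi w)) \<le> K" unfolding bounded_pos by auto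
    have gc: "continuous_on (sphere 0 s) (g j)" for j
      unfolding g_def using \<sigma> by (intro continuous_intros fc) auto
    have gint: "g j contour_integrable_on circlepath 0 s" for j
      using gc \<sigma> by (intro contour_integrable_continuous_circlepath) simp
    have gI: "contour_integral (circlepath 0 s) (g j) = c * (a j * FC s f j)" for j
    proof -
      have "(\<lambda>w. f (Psi w) / w ^ (j + 1)) contour_integrable_on circlepath 0 s"
        using \<sigma> fc by (intro contour_integrable_continuous_circlepath continuous_intros) auto
      then have "contour_integral (circlepath 0 s) (\<lambda>w. a j * (f (Psi w) / w ^ (j + 1))) = a j * (c * FC s f j)"
        unfolding c_def FC_circle[OF \<sigma>(4)] by (rule contour_integral_lmul)
      then show ?thesis by (simp add: g_def mult_ac)
    qed
    have ul: "uniform_limit (sphere 0 s) (\<lambda>n w. \<Sum>j<n. g j w) (\<lambda>w. \<Sum>j. g j w) sequentially"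
    proof (rule Weierstrass_m_test)
      fix j and w :: complex assume "w \<in> sphere 0 s"
      then have w: "norm w = s" by simp
      have "norm (g j w) = norm (f (Psi w)) * (norm (a j) / s ^ (j + 1))"
        by (simp add: g_def norm_mult norm_divide norm_power w)
      also have "\<dots> \<le> K * (B * \<sigma> ^ j / s ^ (j + 1))"
        using K a(1)[of j] w \<sigma> by (intro mult_mono divide_right_mono) auto
      also have "\<dots> = K * B / s * (\<sigma> / s) ^ j" by (simp add: power_divide)
      finally show "norm (g j w) \<le> K * B / s * (\<sigma> / s) ^ j" .
    qed (intro summable_mult summable_geometric, use q in simp)
    have "(\<lambda>n. contour_integral (circlepath 0 s) (\<lambda>w. \<Sum>j<n. g j w)) \<longlonglongrightarrow> contour_integral (circlepath 0 s) (\<lambda>w. \<Sum>j. g j w)"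
      by (rule contour_integral_uniform_limit_circlepath(2)[OF always_eventually ul])
         (use \<sigma> gint in \<open>auto intro!: contour_integrable_sum\<close>)
    moreover have "contour_integral (circlepath 0 s) (\<lambda>w. \<Sum>j<n. g j w) = c * (\<Sum>j<n. a j * FC s f j)" for n
      by (simp add: contour_integral_sum gint gI sum_distrib_left)
    moreover have "contour_integral (circlepath 0 s) (\<lambda>w. \<Sum>j. g j w) = c * f z"
    proof -
      have "contour_integral (circlepath 0 s) (\<lambda>w. \<Sum>j. g j w)
          = contour_integral (circlepath 0 s) (\<lambda>w. f (Psi w) / (Psi w - z) * deriv Psi w)"
      proof (rule contour_integral_eq)
        fix w assume "w \<in> path_image (circlepath 0 s)"
        then have "s' < norm w" using \<sigma> by auto
        from sums_mult[OF a(2)[OF this], of "f (Psi w)"]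
        show "(\<Sum>j. g j w) = f (Psi w) / (Psi w - z) * deriv Psi w"
          by (simp add: g_def sums_iff)
      qed
      then show ?thesis using Cauchy_dom[OF \<sigma>(4) R f zs] by (simp add: lp_subst[OF \<sigma>(4)] c_def)
    qed
    ultimately have "(\<lambda>n. c * (\<Sum>j<n. a j * FC s f j)) \<longlonglongrightarrow> c * f z" by simp
    then have lim: "(\<lambda>n. \<Sum>j<n. a j * FC s f j) \<longlonglongrightarrow> f z"
      using c0 by (simp add: tendsto_mult_left_iff)
    have A0: "A \<ge> 0" using order.trans[OF norm_ge_zero A[of 0]] by simp
    have "norm (\<Sum>j<n. a j * FC s f j) \<le> B * (1 / (1 - \<sigma> / s)) * A" for n
    proof -
      have "norm (\<Sum>j<n. a j * FC s f j) \<le> (\<Sum>j<n. (B * \<sigma> ^ j) * (A / s ^ j))"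
      proof (rule sum_norm_le)
        fix j
        show "norm (a j * FC s f j) \<le> (B * \<sigma> ^ j) * (A / s ^ j)"
          unfolding norm_mult by (rule mult_mono[OF a(1) A]) (use B \<sigma> in auto)
      qed
      also have "\<dots> = B * A * (\<Sum>j<n. (\<sigma> / s) ^ j)" by (simp add: sum_distrib_left power_divide mult_ac)
      also have "\<dots> \<le> B * A * (\<Sum>j. (\<sigma> / s) ^ j)"
        using q A0 B by (intro mult_left_mono sum_le_suminf summable_geometric) auto
      also have "(\<Sum>j. (\<sigma> / s) ^ j) = 1 / (1 - \<sigma> / s)" using q by (intro suminf_geometric) auto
      finally show ?thesis by (simp add: mult_ac)
    qed
    then show "norm (f z) \<le> B * (1 / (1 - \<sigma> / s)) * A"
      using lim by (intro Lim_bounded[OF tendsto_norm[OF lim], of 0]) auto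
  qed
qed

end

section \<open>Linear equations for the denominators\<close>

context exterior begin

text \<open>Allowing different indices turns multiplication by a power of \<Phi> into a shift of the
  index, which is how all Faber coefficients are reduced to the n-th one.\<close>

lemma FC_cong:
  assumes "1 < v" "\<And>z. z \<notin> E \<Longrightarrow> norm (\<Phi> z) = v \<Longrightarrow> f z / \<Phi> z ^ (k + 1) = g z / \<Phi> z ^ (l + 1)"
  shows "FC v f k = FC v g l"
proof -
  have "contour_integral (lp v) (\<lambda>t. f t * deriv \<Phi> t / \<Phi> t ^ (k + 1))
      = contour_integral (lp v) (\<lambda>t. g t * deriv \<Phi> t / \<Phi> t ^ (l + 1))"
  proof (rule contour_integral_eq)
    fix t assume "t \<in> path_image (lp v)"
    then have "f t / \<Phi> t ^ (k + 1) = g t / \<Phi> t ^ (l + 1)" using assms by (simp add: lp_image)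
    then have "f t / \<Phi> t ^ (k + 1) * deriv \<Phi> t = g t / \<Phi> t ^ (l + 1) * deriv \<Phi> t" by simp
    then show "f t * deriv \<Phi> t / \<Phi> t ^ (k + 1) = g t * deriv \<Phi> t / \<Phi> t ^ (l + 1)"
      by simp
  qed
  then show ?thesis by (simp add: FC_def)
qed

lemma FC_bound:
  assumes v: "1 < v" and B: "0 \<le> B" "\<And>z. z \<notin> E \<Longrightarrow> norm (\<Phi> z) = v \<Longrightarrow> norm (f z) \<le> B"
  shows "norm (FC v f k) \<le> B / v ^ k"
proof -
  have "norm (2 * of_real pi * \<i> * FC v f k) \<le> (B / v ^ (k + 1)) * (2 * pi * v)"
    unfolding FC_circle[OF v]
  proof (rule circle_bound)
    fix w :: complex assume w: "norm w = v"
    have "norm (f (Psi w)) \<le> B" using w v by (intro B) (auto simp: Phi_Psi Psi_notin)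
    then show "norm (f (Psi w) / w ^ (k + 1)) \<le> B / v ^ (k + 1)"
      using v unfolding norm_divide norm_power w by (intro divide_right_mono) auto
  qed (use v B in auto)
  then show ?thesis using v by (simp add: norm_mult field_simps)
qed

lemma FC_sum:
  assumes "1 < v" "open S" "S \<subseteq> - E" "level v \<subseteq> S" "finite I"
    and f: "\<And>i. i \<in> I \<Longrightarrow> f i holomorphic_on S"
  shows "FC v (\<lambda>t. \<Sum>i\<in>I. a i * f i t) k = (\<Sum>i\<in>I. a i * FC v (f i) k)"
proof -
  have int: "(\<lambda>t. f i t * deriv \<Phi> t / \<Phi> t ^ (k + 1)) contour_integrable_on lp v" if "i \<in> I" for i
    by (rule FC_integrable[OF assms(1,2) f[OF that] assms(3,4)])
  have "contour_integral (lp v) (\<lambda>t. (\<Sum>i\<in>I. a i * f i t) * deriv \<Phi> t / \<Phi> t ^ (k + 1))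
      = contour_integral (lp v) (\<lambda>t. \<Sum>i\<in>I. a i * (f i t * deriv \<Phi> t / \<Phi> t ^ (k + 1)))"
    by (intro contour_integral_eq) (simp add: sum_distrib_right sum_divide_distrib mult.assoc)
  also have "\<dots> = (\<Sum>i\<in>I. contour_integral (lp v) (\<lambda>t. a i * (f i t * deriv \<Phi> t / \<Phi> t ^ (k + 1))))"
    by (rule contour_integral_sum[OF assms(5)]) (rule contour_integrable_lmul[OF int])
  also have "\<dots> = (\<Sum>i\<in>I. a i * contour_integral (lp v) (\<lambda>t. f i t * deriv \<Phi> t / \<Phi> t ^ (k + 1)))"
    by (intro sum.cong refl contour_integral_lmul int)
  finally show ?thesis by (simp add: FC_def sum_divide_distrib)
qed

lemma FC_add:
  assumes "1 < v" "open S" "S \<subseteq> - E" "level v \<subseteq> S"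
    and "f holomorphic_on S" "g holomorphic_on S"
  shows "FC v (\<lambda>z. f z + g z) k = FC v f k + FC v g k"
  unfolding FC_def
  using contour_integral_add[OF FC_integrable[OF assms(1,2,5,3,4)] FC_integrable[OF assms(1,2,6,3,4)], of k k]
  by (simp add: distrib_right add_divide_distrib)

lemma holo_level_bound:
  assumes "1 < v" "open S" "level v \<subseteq> S" "f holomorphic_on S"
  shows "\<exists>B>0. \<forall>z. z \<notin> E \<longrightarrow> norm (\<Phi> z) = v \<longrightarrow> norm (f z) \<le> B"
proof -
  have "bounded (f ` level v)"
    using assms by (intro compact_imp_bounded compact_continuous_image compact_level)
      (auto intro: holomorphic_on_imp_continuous_on holomorphic_on_subset)
  then show ?thesis unfolding bounded_pos by auto
qed

end

lemma uniform_constant: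
  fixes T :: "nat \<Rightarrow> real \<Rightarrow> bool"
  assumes "\<And>l. l < N \<Longrightarrow> \<exists>C>0. T l C" "\<And>l C C'. T l C \<Longrightarrow> C \<le> C' \<Longrightarrow> T l C'"
  shows "\<exists>C>0. \<forall>l<N. T l C"
  using assms(1)
proof (induction N)
  case 0
  show ?case by (auto intro: exI[of _ 1])
next
  case (Suc N)
  then obtain C where C: "C > 0" "\<forall>l<N. T l C" by (metis less_SucI)
  obtain D where D: "D > 0" "T N D" using Suc.prems by blast
  have "T l (max C D)" if "l < Suc N" for l
    using that C D assms(2)[of l C "max C D"] assms(2)[of l D "max C D"] by (cases "l = N") auto
  then show ?case using C by (intro exI[of _ "max C D"]) auto
qed

lemma norm_diff_add_le:
  fixes a b c :: complex
  shows "norm a \<le> A \<Longrightarrow> norm b \<le> B \<Longrightarrow> norm c \<le> C \<Longrightarrow> norm (a - b + c) \<le> A + B + C"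
  using norm_triangle_ineq[of "a - b" c] norm_triangle_ineq4[of a b] by linarith

section \<open>The approximation problem with the poles cleared\<close>

text \<open>
  Here \<open>G\<close> plays the role of \<open>q F\<close>, and polewise independence is expressed by the coefficients \<open>c\<close> of the
  polynomials \<open>v\<close>.
\<close>

locale pade = exterior E \<Phi> for E :: "complex set" and \<Phi> +
  fixes R :: ereal and q :: "complex poly" and G :: "'d::finite \<Rightarrow> complex \<Rightarrow> complex" and m :: "'d \<Rightarrow> nat"
  assumes R1: "1 < R"
    and monic: "lead_coeff q = 1"
    and roots: "\<And>\<zeta>. poly q \<zeta> = 0 \<Longrightarrow> \<zeta> \<notin> E \<and> ereal (norm (\<Phi> \<zeta>)) < R"
    and G_holo: "\<And>\<alpha>. G \<alpha> holomorphic_on dom R"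
    and deg_q_le: "degree q \<le> (\<Sum>\<alpha>\<in>UNIV. m \<alpha>)"
    and indep: "\<And>c h. h holomorphic_on ann R \<Longrightarrow>
       (\<And>x. x \<in> ann R \<Longrightarrow> (\<Sum>b\<in>Sigma UNIV (\<lambda>\<alpha>. {..<m \<alpha>}). c b * (\<Phi> x ^ snd b * G (fst b) x)) = poly q x * h x)
       \<Longrightarrow> \<forall>b\<in>Sigma UNIV (\<lambda>\<alpha>. {..<m \<alpha>}). c b = 0"
begin

definition "M = (\<Sum>\<alpha>\<in>UNIV. m \<alpha>)"

definition below :: "real \<Rightarrow> bool" where
  "below s \<longleftrightarrow> 1 < s \<and> ereal s < R \<and> (\<forall>\<zeta>. poly q \<zeta> = 0 \<longrightarrow> s < norm (\<Phi> \<zeta>))"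

definition above :: "real \<Rightarrow> bool" where
  "above r \<longleftrightarrow> 1 < r \<and> ereal r < R \<and> (\<forall>\<zeta>. poly q \<zeta> = 0 \<longrightarrow> norm (\<Phi> \<zeta>) < r)"

text \<open>Below the poles Q G / q is holomorphic inside the level, \<open>E\<close> included, so
  every such level gives the same coefficients. The clause m \<alpha> \<le> n keeps the subtraction
  n - m \<alpha> from being truncated.\<close>

definition solves :: "nat \<Rightarrow> complex poly \<Rightarrow> ('d \<Rightarrow> complex poly) \<Rightarrow> bool" where
  "solves n Q P \<longleftrightarrow> Q \<noteq> 0 \<and> degree Q \<le> M \<and> (\<forall>\<alpha>. m \<alpha> \<le> n \<and> degree (P \<alpha>) \<le> n - m \<alpha> \<and>
     (\<forall>s k. below s \<longrightarrow> k \<le> n \<longrightarrow> FC s (\<lambda>z. poly Q z * G \<alpha> z / poly q z - poly (P \<alpha>) z) k = 0))"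

definition pnorm :: "complex poly \<Rightarrow> real" where "pnorm p = (\<Sum>i\<le>M. norm (coeff p i))"

definition W :: "complex set" where "W = ann R - {z. poly q z = 0}"

text \<open>Indexes the coefficients of the vectors \<open>v\<close> in polewise independence; there
  are \<open>M\<close> of them.\<close>

definition I :: "('d \<times> nat) set" where "I = Sigma UNIV (\<lambda>\<alpha>. {..<m \<alpha>})"

lemma finite_I: "finite I" by (simp add: I_def)

lemma card_I: "card I = M" by (simp add: I_def M_def)

lemma q_nz: "q \<noteq> 0" using monic by auto

lemma open_W: "open W"
  unfolding W_def using open_ann poly_roots_finite[OF q_nz] by (simp add: open_Diff finite_imp_closed)

lemma W_sub: "W \<subseteq> ann R" "W \<subseteq> - E" "\<And>z. z \<in> W \<Longrightarrow> poly q z \<noteq> 0"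
  by (auto simp: W_def in_ann)

lemma ann_E: "ann R \<subseteq> - E" by (auto simp: in_ann)

lemma level_W: "below v \<or> above v \<Longrightarrow> level v \<subseteq> W"
  by (auto simp: W_def in_ann below_def above_def)

lemma level_ann: "ereal v < R \<Longrightarrow> level v \<subseteq> ann R"
  by (auto simp: in_ann)

lemma gt1: "below v \<or> above v \<Longrightarrow> 1 < v" "below v \<or> above v \<Longrightarrow> ereal v < R"
  by (auto simp: below_def above_def)

lemma G_holo_ann: "G \<alpha> holomorphic_on ann R"
  by (rule holomorphic_on_subset[OF G_holo]) (auto simp: ann_eq)

lemma Phi_holo_sub: "S \<subseteq> - E \<Longrightarrow> \<Phi> holomorphic_on S"
  by (rule holomorphic_on_subset[OF Phi_holo])

lemma q_bounds: "below s \<Longrightarrow> poly q \<zeta> = 0 \<Longrightarrow> \<zeta> \<notin> E \<and> s < norm (\<Phi> \<zeta>)"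
    "above r \<Longrightarrow> poly q \<zeta> = 0 \<Longrightarrow> \<zeta> \<notin> E \<and> norm (\<Phi> \<zeta>) < r"
  using roots by (auto simp: below_def above_def)

lemma pnorm_nonneg: "0 \<le> pnorm p" by (simp add: pnorm_def sum_nonneg)

lemma coeff_le_pnorm: "degree p \<le> M \<Longrightarrow> norm (coeff p i) \<le> pnorm p"
proof (cases "i \<le> M")
  case True
  then show ?thesis unfolding pnorm_def by (intro member_le_sum) auto
next
  case False
  assume "degree p \<le> M"
  then have "coeff p i = 0" using False by (intro coeff_eq_0) auto
  then show ?thesis by (simp add: pnorm_nonneg)
qed

lemma pnorm_pos: "p \<noteq> 0 \<Longrightarrow> degree p \<le> M \<Longrightarrow> 0 < pnorm p"
  using coeff_le_pnorm[of p "degree p"] by (metis leading_coeff_0_iff less_le_trans zero_less_norm_iff)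

lemma pnorm_triangle: "pnorm (a + b) \<le> pnorm a + pnorm b"
  unfolding pnorm_def by (simp flip: sum.distrib add: sum_mono norm_triangle_ineq)

lemma pnorm_smult: "pnorm (smult c p) = norm c * pnorm p"
  unfolding pnorm_def by (simp add: norm_mult sum_distrib_left)

lemma poly_pnorm_bound:
  assumes "bounded K"
  obtains C where "C > 0" "\<And>p z. degree p \<le> M \<Longrightarrow> z \<in> K \<Longrightarrow> norm (poly p z) \<le> C * pnorm p"
proof -
  obtain B where B: "\<And>z. z \<in> K \<Longrightarrow> norm z \<le> B" using assms by (auto simp: bounded_iff)
  define B' where "B' = max 1 B"
  show ?thesis
  proof (rule that[of "B' ^ M"])
    show "B' ^ M > 0" by (simp add: B'_def)
    fix p :: "complex poly" and z assume p: "degree p \<le> M" and z: "z \<in> K"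
    have "poly p z = (\<Sum>i\<le>M. coeff p i * z ^ i)"
      unfolding poly_altdef using p by (intro sum.mono_neutral_left) (auto simp: coeff_eq_0)
    also have "norm \<dots> \<le> (\<Sum>i\<le>M. B' ^ M * norm (coeff p i))"
    proof (rule sum_norm_le)
      fix i assume i: "i \<in> {..M}"
      have "norm z ^ i \<le> B' ^ i" using B[OF z] by (intro power_mono) (auto simp: B'_def)
      also have "\<dots> \<le> B' ^ M" using i by (intro power_increasing) (auto simp: B'_def)
      finally show "norm (coeff p i * z ^ i) \<le> B' ^ M * norm (coeff p i)"
        by (simp add: norm_mult norm_power mult.commute mult_right_mono)
    qed
    finally show "norm (poly p z) \<le> B' ^ M * pnorm p" by (simp add: pnorm_def sum_distrib_left)
  qed
qed

lemma remainder_exists: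
  assumes "below s" "above r" "s < r" "f holomorphic_on ann R"
  obtains h where "h holomorphic_on ann R" "\<And>x. x \<in> ann R \<Longrightarrow> f x = poly (divrem s r q f) x + poly q x * h x"
  using divrem_spec[of s r R q f] assms q_bounds gt1 q_nz by blast

lemma spanning:
  assumes s: "below s" "above r" "s < r"
  shows "degree q = M"
    and "\<And>u. degree u < M \<Longrightarrow> \<exists>c h. h holomorphic_on ann R \<and>
       (\<forall>x\<in>ann R. (\<Sum>b\<in>I. c b * (\<Phi> x ^ snd b * G (fst b) x)) = poly u x + poly q x * h x)"
proof -
  define f where "f = (\<lambda>b x. \<Phi> x ^ snd b * G (fst b) x)"
  have f: "f b holomorphic_on ann R" for b
    unfolding f_def by (intro holomorphic_intros Phi_holo_sub ann_E G_holo_ann)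
  define X where "X = (\<lambda>b. divrem s r q (f b))"
  have "\<exists>h. h holomorphic_on ann R \<and> (\<forall>x\<in>ann R. f b x = poly (X b) x + poly q x * h x)" for b
    unfolding X_def using remainder_exists[OF s f[of b]] by metis
  then obtain h where h: "\<And>b. h b holomorphic_on ann R" "\<And>b x. x \<in> ann R \<Longrightarrow> f b x = poly (X b) x + poly q x * h b x"
    by metis
  have lin: "(\<Sum>b\<in>I. c b * f b x) = poly (\<Sum>b\<in>I. smult (c b) (X b)) x + poly q x * (\<Sum>b\<in>I. c b * h b x)"
    if "x \<in> ann R" for c x
    using h(2)[OF that] by (simp add: poly_sum sum_distrib_left distrib_left sum.distrib mult_ac)
  have hs: "(\<lambda>x. \<Sum>b\<in>I. c b * h b x) holomorphic_on ann R" for c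
    by (intro holomorphic_intros h)
  \<comment> \<open>If a combination of remainders vanishes, the same combination of the functions
    is q times a holomorphic function, which \<open>indep\<close> allows only for zero
    coefficients.\<close>
  have inj: "\<forall>b\<in>I. c b = 0" if "(\<Sum>b\<in>I. smult (c b) (X b)) = 0" for c
  proof (rule indep[OF hs[of c], folded I_def])
    fix x assume "x \<in> ann R"
    from lin[OF this, of c] show "(\<Sum>b\<in>I. c b * (\<Phi> x ^ snd b * G (fst b) x)) = poly q x * (\<Sum>b\<in>I. c b * h b x)"
      unfolding that f_def by simp
  qed
  have co: "coeff (X b) i = 0" if "degree q \<le> i" for b i
    using that by (simp add: X_def coeff_divrem)
  have le: "degree q \<le> card I" using deg_q_le card_I by (simp add: M_def)
  show dq: "degree q = M"
    using injective_family_spans(1)[of I "degree q" X, OF finite_I le co inj] card_I by simp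
  fix u :: "complex poly" assume u: "degree u < M"
  have "\<exists>c. u = (\<Sum>b\<in>I. smult (c b) (X b))"
    by (rule injective_family_spans(2)[of I "degree q" X, OF finite_I le co inj])
       (use u dq in \<open>auto intro: coeff_eq_0\<close>)
  then obtain c where c: "u = (\<Sum>b\<in>I. smult (c b) (X b))" by blast
  show "\<exists>c h. h holomorphic_on ann R \<and>
       (\<forall>x\<in>ann R. (\<Sum>b\<in>I. c b * (\<Phi> x ^ snd b * G (fst b) x)) = poly u x + poly q x * h x)"
    using hs[of c] lin[of _ c] unfolding c f_def by blast
qed

lemma holo_quot:
  assumes "f holomorphic_on ann R"
  shows "(\<lambda>t. poly Q t * f t / poly q t) holomorphic_on W"
  by (intro holomorphic_intros holomorphic_on_subset[OF assms W_sub(1)] W_sub(3))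

lemma solves_FC:
  assumes "solves n Q P" "below s" "k \<le> n"
  shows "FC s (\<lambda>z. poly Q z * G \<alpha> z / poly q z) k = FC s (poly (P \<alpha>)) k"
proof -
  have "FC s (\<lambda>z. poly Q z * G \<alpha> z / poly q z - poly (P \<alpha>) z) k = 0"
    using assms by (auto simp: solves_def)
  moreover have "FC s (\<lambda>z. poly Q z * G \<alpha> z / poly q z - poly (P \<alpha>) z) k
     = FC s (\<lambda>z. poly Q z * G \<alpha> z / poly q z) k - FC s (poly (P \<alpha>)) k"
    using assms(2) gt1 by (intro FC_diff[where S=W] open_W W_sub level_W holo_quot G_holo_ann holomorphic_intros) auto
  ultimately show ?thesis by simp
qed

text \<open>The only way across the poles: it applies to functions holomorphic on the whole annular
  region, and not to quotients by \<open>q\<close>.\<close>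

lemma FC_below_above:
  assumes "below s" "above r" "s < r" "f holomorphic_on ann R"
  shows "FC s f k = FC r f k"
proof -
  have s1: "1 < s" using assms(1) by (simp add: below_def)
  have rR: "ereal r < R" using assms(2) by (simp add: above_def)
  have "{z. z \<notin> E \<and> s \<le> norm (\<Phi> z) \<and> norm (\<Phi> z) \<le> r} \<subseteq> ann R"
    using ereal_le_less[OF _ rR] by (auto simp: in_ann)
  from FC_deform[OF s1 less_imp_le[OF assms(3)] this open_ann assms(4) ann_E] show ?thesis .
qed

section \<open>Estimates from the linear equations\<close>

text \<open>
  The linear equations kill the combination of the \<open>\<Phi>\<^sup>j G\<close> with remainder \<open>t\<^sup>l\<close>; what is left is the
  holomorphic part, for which the contour can be moved to the level \<open>r\<close>.
\<close>

lemma FC_mono_estimate: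
  assumes s: "below s" "above r" "s < r"
  obtains C where "C > 0"
    "\<And>n Q P l v. solves n Q P \<Longrightarrow> l < M \<Longrightarrow> v = s \<or> v = r \<Longrightarrow> norm (FC v (\<lambda>t. poly Q t * t ^ l / poly q t) n) \<le> C * pnorm Q / r ^ n"
proof -
  have r: "1 < r" "0 < r" "ereal r < R" using s by (auto simp: above_def)
  have s1: "1 < s" using s by (simp add: below_def)
  have bdd: "bounded (level r)" by (rule compact_imp_bounded[OF compact_level[OF r(1)]])
  obtain K where K: "K > 0" "\<And>p z. degree p \<le> M \<Longrightarrow> z \<in> level r \<Longrightarrow> norm (poly p z) \<le> K * pnorm p"
    using poly_pnorm_bound[OF bdd] by blast
  have ex: "\<exists>C>0. \<forall>n Q P v. solves n Q P \<longrightarrow> v = s \<or> v = r \<longrightarrow> norm (FC v (\<lambda>t. poly Q t * t ^ l / poly q t) n) \<le> C * pnorm Q / r ^ n"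
    if l: "l < M" for l
  proof -
    have "degree (monom (1::complex) l) < M" using l degree_monom_le[of "1::complex" l] by linarith
    then obtain c h where h: "h holomorphic_on ann R"
      "\<And>x. x \<in> ann R \<Longrightarrow> (\<Sum>b\<in>I. c b * (\<Phi> x ^ snd b * G (fst b) x)) = x ^ l + poly q x * h x"
      using spanning(2)[OF s, of "monom 1 l"] by (auto simp: poly_monom)
    obtain H where H: "H > 0" "\<And>z. z \<notin> E \<Longrightarrow> norm (\<Phi> z) = r \<Longrightarrow> norm (h z) \<le> H"
      using holo_level_bound[OF r(1) open_ann level_ann[OF r(3)] h(1)] by blast
    have "(\<lambda>t. t ^ l / poly q t) holomorphic_on W" by (intro holomorphic_intros W_sub(3))
    then obtain H' where H': "H' > 0" "\<And>z. z \<notin> E \<Longrightarrow> norm (\<Phi> z) = r \<Longrightarrow> norm (z ^ l / poly q z) \<le> H'"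
      using holo_level_bound[OF r(1) open_W level_W] s by blast
    have b1: "norm (FC s (\<lambda>t. poly Q t * t ^ l / poly q t) n) \<le> K * H * pnorm Q / r ^ n" if sol: "solves n Q P" for n Q P
    proof -
      let ?g = "\<lambda>b t. \<Phi> t ^ snd b * (poly Q t * G (fst b) t / poly q t)"
      have gh: "?g b holomorphic_on W" for b
        by (intro holomorphic_intros Phi_holo_sub W_sub(2) holo_quot G_holo_ann)
      \<comment> \<open>The factor \<Phi>^j lowers the index from n to n - j, where Q F and P have
        the same coefficient; that of P vanishes as deg P \<le> n - m < n - j.\<close>
      have zero: "FC s (?g b) n = 0" if b: "b \<in> I" for b
      proof -
        have j: "snd b < m (fst b)" "m (fst b) \<le> n" using b sol by (auto simp: I_def solves_def)
        have "FC s (?g b) n = FC s (\<lambda>t. poly Q t * G (fst b) t / poly q t) (n - snd b)"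
        proof (rule FC_cong)
          fix z assume z: "z \<notin> E"
          have "\<Phi> z ^ (n + 1) = \<Phi> z ^ snd b * \<Phi> z ^ (n - snd b + 1)" using j by (simp flip: power_add)
          then show "?g b z / \<Phi> z ^ (n + 1) = poly Q z * G (fst b) z / poly q z / \<Phi> z ^ (n - snd b + 1)"
            using Phi_nz[OF z] by simp
        qed (use s1 in auto)
        also have "\<dots> = FC s (poly (P (fst b))) (n - snd b)" by (rule solves_FC[OF sol s(1)]) simp
        also have "\<dots> = 0"
        proof (rule FC_poly)
          have "degree (P (fst b)) \<le> n - m (fst b)" using sol by (simp add: solves_def)
          then show "degree (P (fst b)) < n - snd b" using j by linarith
        qed (use s1 in auto)
        finally show ?thesis .
      qed
      have "FC s (\<lambda>t. poly Q t * t ^ l / poly q t) n = FC s (\<lambda>t. (\<Sum>b\<in>I. c b * ?g b t) - poly Q t * h t) n"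
      proof (rule FC_cong)
        fix z assume "z \<notin> E" "norm (\<Phi> z) = s"
        then have z: "z \<in> W" using level_W s by blast
        then have qz: "poly q z \<noteq> 0" "z \<in> ann R" using W_sub by auto
        have "(\<Sum>b\<in>I. c b * ?g b z) = (\<Sum>b\<in>I. c b * (\<Phi> z ^ snd b * G (fst b) z)) * (poly Q z / poly q z)"
          unfolding sum_distrib_right by (intro sum.cong) auto
        also have "\<dots> = (z ^ l + poly q z * h z) * (poly Q z / poly q z)" by (simp only: h(2)[OF qz(2)])
        also have "\<dots> = poly Q z * z ^ l / poly q z + poly Q z * h z" using qz by (simp add: field_simps)
        finally show "poly Q z * z ^ l / poly q z / \<Phi> z ^ (n + 1) = ((\<Sum>b\<in>I. c b * ?g b z) - poly Q z * h z) / \<Phi> z ^ (n + 1)"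
          by simp
      qed (use s1 in auto)
      also have "\<dots> = FC s (\<lambda>t. \<Sum>b\<in>I. c b * ?g b t) n - FC s (\<lambda>t. poly Q t * h t) n"
        using s gt1 by (intro FC_diff[where S=W] open_W W_sub level_W holomorphic_intros gh holomorphic_on_subset[OF h(1) W_sub(1)]) auto
      also have "FC s (\<lambda>t. \<Sum>b\<in>I. c b * ?g b t) n = (\<Sum>b\<in>I. c b * FC s (?g b) n)"
        using s gt1 by (intro FC_sum[where S=W] open_W W_sub level_W gh finite_I) auto
      also have "\<dots> = 0" using zero by simp
      also have "FC s (\<lambda>t. poly Q t * h t) n = FC r (\<lambda>t. poly Q t * h t) n"
        by (rule FC_below_above[OF s]) (intro holomorphic_intros h)
      finally have "norm (FC s (\<lambda>t. poly Q t * t ^ l / poly q t) n) = norm (FC r (\<lambda>t. poly Q t * h t) n)" by simp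
      also have "\<dots> \<le> (K * pnorm Q * H) / r ^ n"
      proof (rule FC_bound[OF r(1)])
        fix z assume z: "z \<notin> E" "norm (\<Phi> z) = r"
        have "norm (poly Q z) \<le> K * pnorm Q" using sol z by (intro K) (auto simp: solves_def)
        then show "norm (poly Q z * h z) \<le> K * pnorm Q * H"
          using H(2)[OF z] H(1) unfolding norm_mult by (intro mult_mono) (auto simp: K(1) less_imp_le pnorm_nonneg)
      qed (use K H in \<open>auto simp: pnorm_nonneg\<close>)
      finally show ?thesis by (simp add: mult_ac)
    qed
    \<comment> \<open>On the level \<open>r\<close> Cauchy's bound suffices; the equations are
      needed on the level \<open>s\<close> only.\<close>
    have b2: "norm (FC r (\<lambda>t. poly Q t * t ^ l / poly q t) n) \<le> K * H' * pnorm Q / r ^ n" if sol: "solves n Q P" for n Q P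
    proof -
      have "norm (FC r (\<lambda>t. poly Q t * t ^ l / poly q t) n) \<le> (K * pnorm Q * H') / r ^ n"
      proof (rule FC_bound[OF r(1)])
        fix z assume z: "z \<notin> E" "norm (\<Phi> z) = r"
        have "norm (poly Q z) \<le> K * pnorm Q" using sol z by (intro K) (auto simp: solves_def)
        then have "norm (poly Q z) * norm (z ^ l / poly q z) \<le> K * pnorm Q * H'"
          using H'(2)[OF z] H'(1) by (intro mult_mono) (auto simp: K(1) less_imp_le pnorm_nonneg)
        then show "norm (poly Q z * z ^ l / poly q z) \<le> K * pnorm Q * H'" by (simp add: norm_mult norm_divide)
      qed (use K H' in \<open>auto simp: pnorm_nonneg\<close>)
      then show ?thesis by (simp add: mult_ac)
    qed
    show ?thesis
    proof (intro exI[of _ "K * H + K * H'"] conjI allI impI)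
      show "K * H + K * H' > 0" using K H H' by (simp add: add_pos_pos)
      fix n Q P v assume sol: "solves n Q P" and v: "v = s \<or> v = r"
      have "K * H * pnorm Q / r ^ n \<le> (K * H + K * H') * pnorm Q / r ^ n" "K * H' * pnorm Q / r ^ n \<le> (K * H + K * H') * pnorm Q / r ^ n"
        using K H H' r by (auto intro!: divide_right_mono mult_right_mono simp: pnorm_nonneg)
      then show "norm (FC v (\<lambda>t. poly Q t * t ^ l / poly q t) n) \<le> (K * H + K * H') * pnorm Q / r ^ n"
        using b1[OF sol] b2[OF sol] v by force
    qed
  qed
  have "\<exists>C>0. \<forall>l<M. \<forall>n Q P v. solves n Q P \<longrightarrow> v = s \<or> v = r \<longrightarrow> norm (FC v (\<lambda>t. poly Q t * t ^ l / poly q t) n) \<le> C * pnorm Q / r ^ n"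
  proof (rule uniform_constant[OF ex])
    fix l and C C' :: real
    assume *: "\<forall>n Q P v. solves n Q P \<longrightarrow> v = s \<or> v = r \<longrightarrow> norm (FC v (\<lambda>t. poly Q t * t ^ l / poly q t) n) \<le> C * pnorm Q / r ^ n"
      and le: "C \<le> C'"
    show "\<forall>n Q P v. solves n Q P \<longrightarrow> v = s \<or> v = r \<longrightarrow> norm (FC v (\<lambda>t. poly Q t * t ^ l / poly q t) n) \<le> C' * pnorm Q / r ^ n"
    proof (intro allI impI)
      fix n Q P v assume "solves n Q P" "v = s \<or> v = r"
      then have "norm (FC v (\<lambda>t. poly Q t * t ^ l / poly q t) n) \<le> C * pnorm Q / r ^ n" using * by blast
      also have "\<dots> \<le> C' * pnorm Q / r ^ n"
        using le r by (intro divide_right_mono mult_right_mono) (auto simp: pnorm_nonneg)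
      finally show "norm (FC v (\<lambda>t. poly Q t * t ^ l / poly q t) n) \<le> C' * pnorm Q / r ^ n" .
    qed
  qed
  then show ?thesis using that by blast
qed

lemma poly_lt_M:
  fixes u :: "complex poly"
  assumes u: "\<And>i. M \<le> i \<Longrightarrow> coeff u i = 0"
  shows "poly u x = (\<Sum>l<M. coeff u l * x ^ l)"
proof -
  have "degree u \<le> M" using u by (intro degree_le) auto
  then have "poly u x = (\<Sum>l\<le>M. coeff u l * x ^ l)"
    unfolding poly_altdef by (intro sum.mono_neutral_left) (auto simp: coeff_eq_0)
  also have "\<dots> = (\<Sum>l<M. coeff u l * x ^ l)"
    using u by (intro sum.mono_neutral_right) auto
  finally show ?thesis .
qed

text \<open>This isolates the finitely many functions Q t^l / q, the only terms whose coefficients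
  may change across the poles; the term with \<open>h\<close> has the same coefficient on both
  sides.\<close>

lemma FC_decompose:
  assumes v: "below v \<or> above v" and f: "f holomorphic_on ann R" and h: "h holomorphic_on ann R"
    and eq: "\<And>x. x \<in> ann R \<Longrightarrow> f x = poly u x + poly q x * h x" and u: "\<And>i. M \<le> i \<Longrightarrow> coeff u i = 0"
  shows "FC v (\<lambda>t. poly Q t * f t / poly q t) n
     = (\<Sum>l<M. coeff u l * FC v (\<lambda>t. poly Q t * t ^ l / poly q t) n) + FC v (\<lambda>t. poly Q t * h t) n"
proof -
  let ?g = "\<lambda>l t. poly Q t * t ^ l / poly q t"
  have gh: "?g l holomorphic_on W" for l by (rule holo_quot) (intro holomorphic_intros)
  have hh: "(\<lambda>t. poly Q t * h t) holomorphic_on W"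
    by (intro holomorphic_intros holomorphic_on_subset[OF h W_sub(1)])
  have "FC v (\<lambda>t. poly Q t * f t / poly q t) n = FC v (\<lambda>t. (\<Sum>l<M. coeff u l * ?g l t) + poly Q t * h t) n"
  proof (rule FC_cong[OF gt1(1)[OF v]])
    fix z assume "z \<notin> E" "norm (\<Phi> z) = v"
    then have "z \<in> W" using level_W v by blast
    then have z: "poly q z \<noteq> 0" "z \<in> ann R" using W_sub by auto
    have pu: "poly u z = (\<Sum>l<M. coeff u l * z ^ l)" using u by (rule poly_lt_M)
    have "(\<Sum>l<M. coeff u l * ?g l z) = poly u z * (poly Q z / poly q z)"
      unfolding pu sum_distrib_right by (intro sum.cong) auto
    moreover have "poly Q z * f z / poly q z = poly u z * (poly Q z / poly q z) + poly Q z * h z"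
      unfolding eq[OF z(2)] using z(1) by (simp add: field_simps)
    ultimately show "poly Q z * f z / poly q z / \<Phi> z ^ (n + 1) = ((\<Sum>l<M. coeff u l * ?g l z) + poly Q z * h z) / \<Phi> z ^ (n + 1)"
      by simp
  qed
  also have "\<dots> = FC v (\<lambda>t. \<Sum>l<M. coeff u l * ?g l t) n + FC v (\<lambda>t. poly Q t * h t) n"
    by (rule FC_add[OF gt1(1)[OF v] open_W W_sub(2) level_W[OF v] _ hh]) (intro holomorphic_intros gh)
  also have "FC v (\<lambda>t. \<Sum>l<M. coeff u l * ?g l t) n = (\<Sum>l<M. coeff u l * FC v (?g l) n)"
    by (rule FC_sum[OF gt1(1)[OF v] open_W W_sub(2) level_W[OF v] _ gh]) simp
  finally show ?thesis .
qed

lemma sum_mono_bound: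
  assumes "\<And>l. l < M \<Longrightarrow> norm (a l) \<le> A" "\<And>l. l < M \<Longrightarrow> norm (b l) \<le> B" "0 \<le> A"
  shows "norm (\<Sum>l<M. a l * b l :: complex) \<le> real M * (A * B)"
proof -
  have "norm (\<Sum>l<M. a l * b l) \<le> (\<Sum>l<M. A * B)"
    by (rule sum_norm_le) (use assms in \<open>auto simp: norm_mult intro!: mult_mono\<close>)
  then show ?thesis by simp
qed

text \<open>Passing from \<open>s\<close> to \<open>r\<close> changes the coefficient only by the
  terms of the remainder of \<open>f\<close>, which \<open>FC_mono_estimate\<close> controls on both
  levels; on \<open>r\<close> the whole integrand has Cauchy's bound. Thus a coefficient taken below
  the poles decays like r^-n with r above them. The bound is linear in \<open>B\<close>, so powers
  of \<Phi> may be put into \<open>f\<close>.\<close>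

lemma FC_estimate:
  assumes s: "below s" "above r" "s < r"
  obtains C where "C > 0"
    "\<And>n Q P f B. solves n Q P \<Longrightarrow> f holomorphic_on ann R \<Longrightarrow> 0 \<le> B \<Longrightarrow>
       (\<And>z. z \<notin> E \<Longrightarrow> norm (\<Phi> z) = s \<or> norm (\<Phi> z) = r \<Longrightarrow> norm (f z) \<le> B) \<Longrightarrow>
       norm (FC s (\<lambda>t. poly Q t * f t / poly q t) n) \<le> C * pnorm Q * B / r ^ n"
proof -
  have r: "1 < r" using s by (simp add: above_def)
  have s1: "1 < s" using s by (simp add: below_def)
  have dq: "degree q = M" by (rule spanning(1)[OF s])
  obtain C1 where C1: "C1 > 0"
    "\<And>(f :: complex \<Rightarrow> complex) B i. 0 \<le> B \<Longrightarrow> (\<And>z. z \<notin> E \<Longrightarrow> norm (\<Phi> z) = s \<or> norm (\<Phi> z) = r \<Longrightarrow> norm (f z) \<le> B)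
       \<Longrightarrow> norm (coeff (divrem s r q f) i) \<le> C1 * B"
    using divrem_bound[OF s1 s(3) q_nz] q_bounds s by metis
  obtain C2 where C2: "C2 > 0"
    "\<And>n Q P l v. solves n Q P \<Longrightarrow> l < M \<Longrightarrow> v = s \<or> v = r \<Longrightarrow> norm (FC v (\<lambda>t. poly Q t * t ^ l / poly q t) n) \<le> C2 * pnorm Q / r ^ n"
    using FC_mono_estimate[OF s] by blast
  have bdd: "bounded (level r)" by (rule compact_imp_bounded[OF compact_level[OF r(1)]])
  obtain K where K: "K > 0" "\<And>p z. degree p \<le> M \<Longrightarrow> z \<in> level r \<Longrightarrow> norm (poly p z) \<le> K * pnorm p"
    using poly_pnorm_bound[OF bdd] by blast
  have "(\<lambda>t. 1 / poly q t) holomorphic_on W" by (intro holomorphic_intros W_sub(3))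
  then obtain K' where K': "K' > 0" "\<And>z. z \<notin> E \<Longrightarrow> norm (\<Phi> z) = r \<Longrightarrow> norm (1 / poly q z) \<le> K'"
    using holo_level_bound[OF r(1) open_W level_W] s by blast
  define D where "D = real M * (C1 * C2)"
  have D: "D \<ge> 0" using C1 C2 by (simp add: D_def)
  show ?thesis
  proof (rule that[of "K * K' + 2 * D"])
    show "K * K' + 2 * D > 0" using K K' D by (simp add: add_pos_nonneg)
    fix n Q P f B
    assume sol: "solves n Q P" and f: "f holomorphic_on ann R" and B: "0 \<le> (B::real)"
      and fB: "\<And>z. z \<notin> E \<Longrightarrow> norm (\<Phi> z) = s \<or> norm (\<Phi> z) = r \<Longrightarrow> norm (f z) \<le> B"
    define u where "u = divrem s r q f"
    obtain h where h: "h holomorphic_on ann R" "\<And>x. x \<in> ann R \<Longrightarrow> f x = poly u x + poly q x * h x"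
      using remainder_exists[OF s f] unfolding u_def by blast
    have u0: "coeff u i = 0" if "M \<le> i" for i using that by (simp add: u_def coeff_divrem dq)
    have uB: "norm (coeff u i) \<le> C1 * B" for i unfolding u_def by (rule C1(2)[OF B fB])
    let ?S = "\<lambda>v. \<Sum>l<M. coeff u l * FC v (\<lambda>t. poly Q t * t ^ l / poly q t) n"
    let ?X = "pnorm Q * B / r ^ n"
    have S: "norm (?S v) \<le> D * ?X" if "v = s \<or> v = r" for v
    proof -
      have "norm (?S v) \<le> real M * ((C1 * B) * (C2 * pnorm Q / r ^ n))"
        using uB C2(2)[OF sol _ that] C1 B by (intro sum_mono_bound) auto
      then show ?thesis by (simp add: D_def mult_ac)
    qed
    have ds: "FC s (\<lambda>t. poly Q t * f t / poly q t) n = ?S s + FC s (\<lambda>t. poly Q t * h t) n"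
      using s by (intro FC_decompose f h u0) auto
    have dr: "FC r (\<lambda>t. poly Q t * f t / poly q t) n = ?S r + FC r (\<lambda>t. poly Q t * h t) n"
      using s by (intro FC_decompose f h u0) auto
    have "FC s (\<lambda>t. poly Q t * h t) n = FC r (\<lambda>t. poly Q t * h t) n"
      by (rule FC_below_above[OF s]) (intro holomorphic_intros h)
    then have eqn: "FC s (\<lambda>t. poly Q t * f t / poly q t) n = ?S s - ?S r + FC r (\<lambda>t. poly Q t * f t / poly q t) n"
      using ds dr by simp
    have last: "norm (FC r (\<lambda>t. poly Q t * f t / poly q t) n) \<le> ((K * pnorm Q) * B * K') / r ^ n"
    proof (rule FC_bound[OF r])
      fix z assume z: "z \<notin> E" "norm (\<Phi> z) = r"
      have "norm (poly Q z) \<le> K * pnorm Q" using sol z by (intro K) (auto simp: solves_def)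
      then have "norm (poly Q z) * norm (f z) * norm (1 / poly q z) \<le> (K * pnorm Q) * B * K'"
        using fB[of z] z K'(2)[OF z] K B by (intro mult_mono) (auto simp: pnorm_nonneg)
      then show "norm (poly Q z * f z / poly q z) \<le> (K * pnorm Q) * B * K'" by (simp add: norm_mult norm_divide)
    qed (use K K' B in \<open>auto simp: pnorm_nonneg\<close>)
    have "norm (FC s (\<lambda>t. poly Q t * f t / poly q t) n) \<le> D * ?X + D * ?X + ((K * pnorm Q) * B * K') / r ^ n"
      unfolding eqn by (rule norm_diff_add_le[OF S S last]) auto
    then show "norm (FC s (\<lambda>t. poly Q t * f t / poly q t) n) \<le> (K * K' + 2 * D) * pnorm Q * B / r ^ n"
      by (simp add: algebra_simps add_divide_distrib)
  qed
qed

text \<open>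
  The coefficients of \<open>Q\<close> modulo \<open>q\<close> are differences of Faber coefficients of \<open>Q f / q\<close> with
  \<open>f = \<kappa> \<Phi>\<^sup>n\<^sup>+\<^sup>1 / \<Phi>'\<close>. Reducing \<open>f\<close> modulo \<open>q\<close> costs only \<open>O(r0\<^sup>n)\<close>, since this can be done on the level \<open>r0\<close>.
\<close>

lemma remainder_estimate:
  assumes s: "below s" "above r0" "s < r0" "r0 < r" "ereal r < R"
  obtains C where "C > 0"
    "\<And>n Q P i. solves n Q P \<Longrightarrow> norm (coeff (Q - smult (coeff Q M) q) i) \<le> C * pnorm Q * (r0 / r) ^ n"
proof -
  have r0: "1 < r0" using s by (simp add: above_def)
  have s1: "1 < s" using s by (simp add: below_def)
  have ar: "above r" "s < r" using s by (force simp: above_def)+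
  have r: "1 < r" using s r0 by simp
  have dq: "degree q = M" by (rule spanning(1)[OF s(1-3)])
  have cq: "coeff q M = 1" using monic dq by simp
  obtain C1 where C1: "C1 > 0"
    "\<And>(f :: complex \<Rightarrow> complex) B i. 0 \<le> B \<Longrightarrow> (\<And>z. z \<notin> E \<Longrightarrow> norm (\<Phi> z) = s \<or> norm (\<Phi> z) = r0 \<Longrightarrow> norm (f z) \<le> B)
       \<Longrightarrow> norm (coeff (divrem s r0 q f) i) \<le> C1 * B"
    using divrem_bound[OF s1 s(3) q_nz] q_bounds s by metis
  obtain C2 where C2: "C2 > 0"
    "\<And>n Q P l v. solves n Q P \<Longrightarrow> l < M \<Longrightarrow> v = s \<or> v = r \<Longrightarrow> norm (FC v (\<lambda>t. poly Q t * t ^ l / poly q t) n) \<le> C2 * pnorm Q / r ^ n"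
    using FC_mono_estimate[OF s(1) ar] by blast
  define \<kappa> where "\<kappa> = (\<lambda>i t. poly (poly_shift (Suc i) q) t / deriv \<Phi> t)"
  have \<kappa>h: "\<kappa> i holomorphic_on - E" for i
    unfolding \<kappa>_def by (intro holomorphic_intros) (auto intro: Phi_holo open_E dest: deriv_Phi_nz)
  have "\<exists>K>0. \<forall>i<M. \<forall>z. z \<notin> E \<longrightarrow> norm (\<Phi> z) = s \<or> norm (\<Phi> z) = r0 \<longrightarrow> norm (\<kappa> i z) \<le> K"
  proof (rule uniform_constant)
    fix i
    have sub: "level v \<subseteq> - E" for v by auto
    obtain A where A: "A > 0" "\<forall>z. z \<notin> E \<longrightarrow> norm (\<Phi> z) = s \<longrightarrow> norm (\<kappa> i z) \<le> A"
      using holo_level_bound[OF s1 open_E sub \<kappa>h] by blast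
    obtain B where "B > 0" "\<forall>z. z \<notin> E \<longrightarrow> norm (\<Phi> z) = r0 \<longrightarrow> norm (\<kappa> i z) \<le> B"
      using holo_level_bound[OF r0 open_E sub \<kappa>h] by blast
    with A show "\<exists>K>0. \<forall>z. z \<notin> E \<longrightarrow> norm (\<Phi> z) = s \<or> norm (\<Phi> z) = r0 \<longrightarrow> norm (\<kappa> i z) \<le> K"
      by (intro exI[of _ "max A B"]) (auto simp: le_max_iff_disj)
  next
    fix i and K K' :: real
    assume b: "\<forall>z. z \<notin> E \<longrightarrow> norm (\<Phi> z) = s \<or> norm (\<Phi> z) = r0 \<longrightarrow> norm (\<kappa> i z) \<le> K" and le: "K \<le> K'"
    show "\<forall>z. z \<notin> E \<longrightarrow> norm (\<Phi> z) = s \<or> norm (\<Phi> z) = r0 \<longrightarrow> norm (\<kappa> i z) \<le> K'"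
      using b order_trans[OF _ le] by blast
  qed
  then obtain K where K: "K > 0" "\<And>i z. i < M \<Longrightarrow> z \<notin> E \<Longrightarrow> norm (\<Phi> z) = s \<or> norm (\<Phi> z) = r0 \<Longrightarrow> norm (\<kappa> i z) \<le> K"
    by blast
  \<comment> \<open>M terms; a coefficient of \<open>u\<close> is at most C1 K r0^(n + 1), whence
    the extra r0; 2 C2 accounts for the two levels. The summand 1 ensures positivity when M =
    0.\<close>
  define C where "C = real M * (C1 * (K * r0) * (2 * C2)) + 1"
  have C0: "C > 0" using C1 C2 K r0 unfolding C_def by (intro add_nonneg_pos) auto
  show ?thesis
  proof (rule that[OF C0])
    fix n Q P i assume sol: "solves n Q P"
    define c where "c = coeff Q M"
    define rr where "rr = Q - smult c q"
    have dQ: "degree Q \<le> M" using sol by (simp add: solves_def)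
    have rr0: "coeff rr j = 0" if j: "M \<le> j" for j
    proof (cases "j = M")
      case True then show ?thesis by (simp add: rr_def c_def cq)
    next
      case False
      then have "coeff Q j = 0" "coeff q j = 0" using j dQ dq by (auto intro!: coeff_eq_0)
      then show ?thesis by (simp add: rr_def)
    qed
    have Qh: "poly Q holomorphic_on ann R" by (intro holomorphic_intros)
    obtain h0 where h0: "h0 holomorphic_on ann R" "\<And>x. x \<in> ann R \<Longrightarrow> poly Q x = poly (divrem s r q (poly Q)) x + poly q x * h0 x"
      using remainder_exists[OF s(1) ar Qh] by blast
    \<comment> \<open>Two candidates for the remainder of \<open>Q\<close>: subtraction of a
      multiple of \<open>q\<close>, and the Hermite integral. Their difference is divisible by
      \<open>q\<close> and has too small a degree, so they coincide.\<close>
    have "q dvd rr - divrem s r q (poly Q)"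
    proof (rule poly_dvd_of_holomorphic_quotient[OF open_ann _ q_nz])
      show "(\<lambda>x. h0 x - c) holomorphic_on ann R" by (intro holomorphic_intros h0)
      show "\<zeta> \<in> ann R" if "poly q \<zeta> = 0" for \<zeta> using roots[OF that] by (simp add: in_ann)
      show "poly (rr - divrem s r q (poly Q)) z = poly q z * (h0 z - c)" if "z \<in> ann R" for z
        using h0(2)[OF that] by (simp add: rr_def algebra_simps)
    qed
    moreover have "rr - divrem s r q (poly Q) = 0 \<or> degree (rr - divrem s r q (poly Q)) < M"
    proof (cases "M = 0")
      case True
      then have "rr - divrem s r q (poly Q) = 0" by (intro poly_eqI) (simp add: rr0 coeff_divrem dq)
      then show ?thesis ..
    next
      case False
      have "degree (rr - divrem s r q (poly Q)) \<le> M - 1"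
        by (rule degree_le) (use False in \<open>auto simp: rr0 coeff_divrem dq\<close>)
      then show ?thesis using False by linarith
    qed
    ultimately have rr_eq: "rr = divrem s r q (poly Q)"
      using dq dvd_imp_degree_le[of q "rr - divrem s r q (poly Q)"] by (metis eq_iff_diff_eq_0 not_less)
    show "norm (coeff (Q - smult (coeff Q M) q) i) \<le> C * pnorm Q * (r0 / r) ^ n"
    proof (cases "i < M")
      case False
      then have "coeff rr i = 0" using rr0 by simp
      then show ?thesis using C0 r0 r by (simp add: rr_def c_def pnorm_nonneg)
    next
      case i: True
      define f where "f = (\<lambda>t. \<kappa> i t * \<Phi> t ^ (n + 1))"
      have f: "f holomorphic_on ann R"
        unfolding f_def by (intro holomorphic_intros Phi_holo_sub ann_E holomorphic_on_subset[OF \<kappa>h])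
      have J: "contour_integral (lp v) (\<lambda>t. poly Q t * poly (poly_shift (Suc i) q) t / poly q t) / (2 * of_real pi * \<i>)
         = FC v (\<lambda>t. poly Q t * f t / poly q t) n" if v: "1 < v" for v
      proof -
        have "contour_integral (lp v) (\<lambda>t. poly Q t * poly (poly_shift (Suc i) q) t / poly q t)
          = contour_integral (lp v) (\<lambda>t. poly Q t * f t / poly q t * deriv \<Phi> t / \<Phi> t ^ (n + 1))"
        proof (rule contour_integral_eq)
          fix t assume "t \<in> path_image (lp v)"
          then have t: "\<Phi> t ^ (n + 1) \<noteq> 0" "deriv \<Phi> t \<noteq> 0"
            using v Phi_nz[of t] deriv_Phi_nz[of t] by (auto simp: lp_image)
          have "a = a / d * p * d / p" if "p \<noteq> 0" "d \<noteq> 0" for a p d :: complex using that by simp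
          from this[OF t, of "poly (poly_shift (Suc i) q) t * (poly Q t / poly q t)"]
          show "poly Q t * poly (poly_shift (Suc i) q) t / poly q t = poly Q t * f t / poly q t * deriv \<Phi> t / \<Phi> t ^ (n + 1)"
            unfolding f_def \<kappa>_def by (simp add: mult_ac)
        qed
        then show ?thesis by (simp add: FC_def)
      qed
      have co: "coeff rr i = FC r (\<lambda>t. poly Q t * f t / poly q t) n - FC s (\<lambda>t. poly Q t * f t / poly q t) n"
        unfolding rr_eq coeff_divrem dq using i J[OF s1] J[OF r] by (simp add: diff_divide_distrib)
      define u where "u = divrem s r0 q f"
      obtain h where h: "h holomorphic_on ann R" "\<And>x. x \<in> ann R \<Longrightarrow> f x = poly u x + poly q x * h x"
        using remainder_exists[OF s(1-3) f] unfolding u_def by blast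
      have u0: "coeff u i = 0" if "M \<le> i" for i using that by (simp add: u_def coeff_divrem dq)
      have uB: "norm (coeff u l) \<le> C1 * (K * r0 ^ (n + 1))" for l
        unfolding u_def
      proof (rule C1(2))
        fix z assume z: "z \<notin> E" "norm (\<Phi> z) = s \<or> norm (\<Phi> z) = r0"
        have "norm (\<Phi> z) ^ (n + 1) \<le> r0 ^ (n + 1)" using z s by (intro power_mono) auto
        then show "norm (f z) \<le> K * r0 ^ (n + 1)"
          unfolding f_def norm_mult norm_power using K i z by (intro mult_mono) auto
      qed (use K r0 in auto)
      let ?S = "\<lambda>v. \<Sum>l<M. coeff u l * FC v (\<lambda>t. poly Q t * t ^ l / poly q t) n"
      have ds: "FC s (\<lambda>t. poly Q t * f t / poly q t) n = ?S s + FC s (\<lambda>t. poly Q t * h t) n"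
        using s by (intro FC_decompose f h u0) auto
      have dr: "FC r (\<lambda>t. poly Q t * f t / poly q t) n = ?S r + FC r (\<lambda>t. poly Q t * h t) n"
        using ar by (intro FC_decompose f h u0) auto
      \<comment> \<open>In the difference between the two levels the holomorphic part cancels, and
        only terms with the small coefficients of Q t^l / q remain.\<close>
      have "FC s (\<lambda>t. poly Q t * h t) n = FC r (\<lambda>t. poly Q t * h t) n"
        by (rule FC_below_above[OF s(1) ar]) (intro holomorphic_intros h)
      then have "coeff rr i = ?S r - ?S s" using co ds dr by simp
      also have "\<dots> = (\<Sum>l<M. coeff u l * (FC r (\<lambda>t. poly Q t * t ^ l / poly q t) n - FC s (\<lambda>t. poly Q t * t ^ l / poly q t) n))"
        by (simp add: right_diff_distrib sum_subtractf)
      also have "norm \<dots> \<le> real M * ((C1 * (K * r0 ^ (n + 1))) * (2 * (C2 * pnorm Q / r ^ n)))"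
      proof (rule sum_mono_bound[OF uB])
        fix l assume l: "l < M"
        show "norm (FC r (\<lambda>t. poly Q t * t ^ l / poly q t) n - FC s (\<lambda>t. poly Q t * t ^ l / poly q t) n) \<le> 2 * (C2 * pnorm Q / r ^ n)"
          using C2(2)[OF sol l, of r] C2(2)[OF sol l, of s]
            norm_triangle_ineq4[of "FC r (\<lambda>t. poly Q t * t ^ l / poly q t) n" "FC s (\<lambda>t. poly Q t * t ^ l / poly q t) n"] by simp
      qed (use C1 K r0 in auto)
      also have "\<dots> = (real M * (C1 * (K * r0) * (2 * C2))) * (pnorm Q * (r0 / r) ^ n)"
        by (simp add: power_divide)
      also have "\<dots> \<le> C * (pnorm Q * (r0 / r) ^ n)"
        using r0 r by (intro mult_right_mono) (auto simp: C_def pnorm_nonneg)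
      finally show ?thesis by (simp add: rr_def c_def mult.assoc)
    qed
  qed
qed

end

section \<open>Denominators and numerators\<close>

context pade begin

text \<open>Once (M + 1) C (r0 / r)^n is below 1/2, the difference of \<open>Q\<close> and (coeff Q
  M) q is at most half as large as \<open>Q\<close> and can be absorbed. In particular a vanishing
  coefficient of degree \<open>M\<close> would force Q = 0.\<close>

lemma normalized_close:
  assumes s: "below s" "above r0" "s < r0" "r0 < r" "ereal r < R"
  obtains C n0 where "C > 0"
    "\<And>n Q P. n0 \<le> n \<Longrightarrow> solves n Q P \<Longrightarrow> coeff Q M \<noteq> 0 \<and> pnorm Q \<le> 2 * norm (coeff Q M) * pnorm q"
    "\<And>n Q P i. n0 \<le> n \<Longrightarrow> solves n Q P \<Longrightarrow> norm (coeff (smult (1 / coeff Q M) Q - q) i) \<le> C * (r0 / r) ^ n"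
proof -
  obtain C where C: "C > 0"
    "\<And>n Q P i. solves n Q P \<Longrightarrow> norm (coeff (Q - smult (coeff Q M) q) i) \<le> C * pnorm Q * (r0 / r) ^ n"
    using remainder_estimate[OF s] by blast
  have r0: "0 < r0" "0 < r" using s by (auto simp: above_def)
  have "(\<lambda>n. (real M + 1) * C * (r0 / r) ^ n) \<longlonglongrightarrow> (real M + 1) * C * 0"
    using s r0 by (intro tendsto_intros LIMSEQ_power_zero) auto
  then have "eventually (\<lambda>n. (real M + 1) * C * (r0 / r) ^ n < 1/2) sequentially"
    by (rule order_tendstoD) simp
  then obtain n0 where n0: "\<And>n. n0 \<le> n \<Longrightarrow> (real M + 1) * C * (r0 / r) ^ n < 1/2"
    by (auto simp: eventually_sequentially)
  have main: "coeff Q M \<noteq> 0 \<and> pnorm Q \<le> 2 * norm (coeff Q M) * pnorm q"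
    if n: "n0 \<le> n" and sol: "solves n Q P" for n Q P
  proof -
    let ?c = "coeff Q M"
    have "pnorm (Q - smult ?c q) \<le> (\<Sum>i\<le>M. C * pnorm Q * (r0 / r) ^ n)"
      unfolding pnorm_def[of "Q - smult ?c q"] by (rule sum_mono) (rule C(2)[OF sol])
    also have "\<dots> = ((real M + 1) * C * (r0 / r) ^ n) * pnorm Q" by simp
    also have "\<dots> \<le> 1/2 * pnorm Q" using n0[OF n] by (intro mult_right_mono) (auto simp: pnorm_nonneg)
    finally have 1: "pnorm (Q - smult ?c q) \<le> 1/2 * pnorm Q" .
    have "pnorm Q \<le> pnorm (smult ?c q) + pnorm (Q - smult ?c q)"
      using pnorm_triangle[of "smult ?c q" "Q - smult ?c q"] by simp
    then have 2: "pnorm Q \<le> 2 * norm ?c * pnorm q" using 1 by (simp add: pnorm_smult)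
    moreover have "pnorm Q > 0" using sol by (intro pnorm_pos) (auto simp: solves_def)
    ultimately show ?thesis by auto
  qed
  show ?thesis
  proof (rule that[of "C * (2 * pnorm q) + 1" n0])
    show "C * (2 * pnorm q) + 1 > 0" using C(1) pnorm_nonneg[of q] by (simp add: add_nonneg_pos)
    fix n Q P assume n: "n0 \<le> n" and sol: "solves n Q P"
    show "coeff Q M \<noteq> 0 \<and> pnorm Q \<le> 2 * norm (coeff Q M) * pnorm q" by (rule main[OF n sol])
    then have c: "coeff Q M \<noteq> 0" "pnorm Q \<le> 2 * norm (coeff Q M) * pnorm q" by auto
    fix i
    have "smult (1 / coeff Q M) Q - q = smult (1 / coeff Q M) (Q - smult (coeff Q M) q)"
      using c by (simp add: smult_diff_right)
    then have "norm (coeff (smult (1 / coeff Q M) Q - q) i) = norm (coeff (Q - smult (coeff Q M) q) i) / norm (coeff Q M)"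
      by (simp only: coeff_smult norm_mult norm_divide) simp
    also have "\<dots> \<le> (C * (2 * norm (coeff Q M) * pnorm q) * (r0 / r) ^ n) / norm (coeff Q M)"
      using C(2)[OF sol, of i] c C(1) r0
      by (intro divide_right_mono order_trans[OF C(2)[OF sol]] mult_right_mono mult_left_mono) auto
    also have "\<dots> = C * (2 * pnorm q) * (r0 / r) ^ n" using c by simp
    also have "\<dots> \<le> (C * (2 * pnorm q) + 1) * (r0 / r) ^ n" using r0 by (intro mult_right_mono) auto
    finally show "norm (coeff (smult (1 / coeff Q M) Q - q) i) \<le> (C * (2 * pnorm q) + 1) * (r0 / r) ^ n" .
  qed
qed

lemma solves_combination:
  assumes s: "below s" and a: "solves n Q P" and b: "solves n Q' P'"
    and nz: "smult c Q - smult c' Q' \<noteq> 0"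
  shows "solves n (smult c Q - smult c' Q') (\<lambda>\<alpha>. smult c (P \<alpha>) - smult c' (P' \<alpha>))"
  unfolding solves_def
proof (intro conjI allI impI nz)
  show "degree (smult c Q - smult c' Q') \<le> M"
    using a b by (intro degree_diff_le order_trans[OF degree_smult_le]) (auto simp: solves_def)
  fix \<alpha>
  show "m \<alpha> \<le> n" using a by (simp add: solves_def)
  show "degree (smult c (P \<alpha>) - smult c' (P' \<alpha>)) \<le> n - m \<alpha>"
    using a b by (intro degree_diff_le order_trans[OF degree_smult_le]) (auto simp: solves_def)
  fix v k assume v: "below v" and k: "k \<le> n"
  let ?f = "\<lambda>Q P z. poly Q z * G \<alpha> z / poly q z - poly P z"
  have h: "?f Q P holomorphic_on W" for Q P by (intro holomorphic_intros holo_quot G_holo_ann)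
  have v': "1 < v" "below v \<or> above v" using v by (auto simp: below_def)
  have "FC v (?f (smult c Q - smult c' Q') (smult c (P \<alpha>) - smult c' (P' \<alpha>))) k
      = FC v (\<lambda>z. c * ?f Q (P \<alpha>) z - c' * ?f Q' (P' \<alpha>) z) k"
    by (rule FC_cong[OF v'(1)]) (simp add: algebra_simps diff_divide_distrib)
  also have "\<dots> = FC v (\<lambda>z. c * ?f Q (P \<alpha>) z) k - FC v (\<lambda>z. c' * ?f Q' (P' \<alpha>) z) k"
    by (rule FC_diff[OF v'(1) open_W W_sub(2) level_W[OF v'(2)]]) (intro holomorphic_intros h)+
  also have "\<dots> = c * FC v (?f Q (P \<alpha>)) k - c' * FC v (?f Q' (P' \<alpha>)) k"
    by (simp only: FC_cmult[OF v'(1) open_W W_sub(2) level_W[OF v'(2)] h])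
  also have "\<dots> = 0" using a b v k by (auto simp: solves_def)
  finally show "FC v (?f (smult c Q - smult c' Q') (smult c (P \<alpha>) - smult c' (P' \<alpha>))) k = 0" .
qed

text \<open>The coefficients beyond n vanish by the degree, so \<open>faber_bound\<close> applies
  with A = 0 and \<open>p\<close> vanishes on a nonempty open set.\<close>

lemma poly_zero_of_FC:
  assumes s: "1 < s" and p: "degree p \<le> n" and z: "\<And>k. k \<le> n \<Longrightarrow> FC s (poly p) k = 0"
  shows "p = 0"
proof (rule ccontr)
  assume p0: "p \<noteq> 0"
  define s' where "s' = (1 + s) / 2"
  have s': "1 < s'" "s' < s" using s by (auto simp: s'_def)
  obtain C where C: "C > 0" "\<And>f R A z. ereal s < R \<Longrightarrow> f holomorphic_on dom R \<Longrightarrow> (\<And>j. norm (FC s f j) \<le> A / s ^ j)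
       \<Longrightarrow> z \<in> dom (ereal s') \<Longrightarrow> norm (f z) \<le> C * A"
    using faber_bound[OF s'] by blast
  have "FC s (poly p) j = 0" for j
    using z[of j] FC_poly[OF s, of p j] p by (cases "j \<le> n") auto
  then have "norm (poly p z) \<le> C * 0" if "z \<in> dom (ereal s')" for z
    using that by (intro C(2)[of \<infinity>]) (auto intro!: holomorphic_intros)
  then have "dom (ereal s') \<subseteq> {z. poly p z = 0}" by auto
  then have fin: "finite (dom (ereal s'))" using poly_roots_finite[OF p0] finite_subset by blast
  have "open (dom (ereal s'))" using connected_dom(1)[of "ereal s'"] s' by simp
  moreover have "dom (ereal s') \<noteq> {}" using E_ne E_sub_dom by blast
  ultimately show False using fin by (metis finite_imp_not_open)
qed

text \<open>Two solutions can be combined so that the coefficient of degree \<open>M\<close>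
  cancels. The combination would again be a solution unless its denominator is zero, but
  \<open>normalized_close\<close> forbids such solutions. Hence the denominators are proportional,
  and then so are the numerators, having the same Faber coefficients up to n.\<close>

lemma solution_unique:
  assumes s: "below s" "above r0" "s < r0" "r0 < r" "ereal r < R"
  shows "\<exists>n0. \<forall>n\<ge>n0. \<forall>Q P Q' P'. solves n Q P \<longrightarrow> solves n Q' P' \<longrightarrow> (\<forall>\<alpha>. P' \<alpha> * Q = P \<alpha> * Q')"
proof -
  obtain C n0 where C: "C > 0"
    "\<And>n Q P. n0 \<le> n \<Longrightarrow> solves n Q P \<Longrightarrow> coeff Q M \<noteq> 0 \<and> pnorm Q \<le> 2 * norm (coeff Q M) * pnorm q"
    "\<And>n Q P i. n0 \<le> n \<Longrightarrow> solves n Q P \<Longrightarrow> norm (coeff (smult (1 / coeff Q M) Q - q) i) \<le> C * (r0 / r) ^ n"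
    using normalized_close[OF s] by blast
  have s1: "1 < s" using s by (simp add: below_def)
  show ?thesis
  proof (intro exI[of _ n0] allI impI)
    fix n Q P Q' P' \<alpha>
    assume n: "n0 \<le> n" and a: "solves n Q P" and b: "solves n Q' P'"
    define c where "c = coeff Q M"
    define c' where "c' = coeff Q' M"
    have c: "c \<noteq> 0" "c' \<noteq> 0" using C(2)[OF n a] C(2)[OF n b] by (auto simp: c_def c'_def)
    have Q0: "smult c' Q - smult c Q' = 0"
    proof (rule ccontr)
      assume nz: "smult c' Q - smult c Q' \<noteq> 0"
      from C(2)[OF n solves_combination[OF s(1) a b nz]] show False by (simp add: c_def c'_def)
    qed
    let ?p = "smult c' (P \<alpha>) - smult c (P' \<alpha>)"
    have "?p = 0"
    proof (rule poly_zero_of_FC[OF s1])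
      show "degree ?p \<le> n"
      proof (intro degree_diff_le order_trans[OF degree_smult_le])
        show "degree (P \<alpha>) \<le> n" "degree (P' \<alpha>) \<le> n" using a b unfolding solves_def by (meson diff_le_self order_trans)+
      qed
      fix k assume k: "k \<le> n"
      have sv: "below s \<or> above s" using s by simp
      have gh: "(\<lambda>z. poly Q z * G \<alpha> z / poly q z) holomorphic_on W" for Q by (intro holo_quot G_holo_ann)
      have ph: "poly p holomorphic_on W" for p by (intro holomorphic_intros)
      note lin = FC_cmult[OF s1 open_W W_sub(2) level_W[OF sv]]
      have "FC s (poly ?p) k = FC s (\<lambda>z. c' * poly (P \<alpha>) z - c * poly (P' \<alpha>) z) k"
        by (rule FC_cong[OF s1]) simp
      also have "\<dots> = FC s (\<lambda>z. c' * poly (P \<alpha>) z) k - FC s (\<lambda>z. c * poly (P' \<alpha>) z) k"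
        by (rule FC_diff[OF s1 open_W W_sub(2) level_W[OF sv]]) (intro holomorphic_intros)+
      also have "\<dots> = c' * FC s (poly (P \<alpha>)) k - c * FC s (poly (P' \<alpha>)) k"
        by (simp only: lin[OF ph])
      also have "\<dots> = c' * FC s (\<lambda>z. poly Q z * G \<alpha> z / poly q z) k - c * FC s (\<lambda>z. poly Q' z * G \<alpha> z / poly q z) k"
        using solves_FC[OF a s(1) k, of \<alpha>] solves_FC[OF b s(1) k, of \<alpha>] by simp
      also have "\<dots> = FC s (\<lambda>z. c' * (poly Q z * G \<alpha> z / poly q z)) k - FC s (\<lambda>z. c * (poly Q' z * G \<alpha> z / poly q z)) k"
        by (simp only: lin[OF gh])
      also have "FC s (\<lambda>z. c' * (poly Q z * G \<alpha> z / poly q z)) k = FC s (\<lambda>z. c * (poly Q' z * G \<alpha> z / poly q z)) k"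
      proof (rule FC_cong[OF s1])
        fix z
        have "c' * poly Q z = c * poly Q' z" using arg_cong[OF Q0, of "\<lambda>p. poly p z"] by simp
        then have "c' * poly Q z * (G \<alpha> z / poly q z / \<Phi> z ^ (k + 1)) = c * poly Q' z * (G \<alpha> z / poly q z / \<Phi> z ^ (k + 1))"
          by (rule arg_cong)
        then show "c' * (poly Q z * G \<alpha> z / poly q z) / \<Phi> z ^ (k + 1) = c * (poly Q' z * G \<alpha> z / poly q z) / \<Phi> z ^ (k + 1)"
          by (simp only: times_divide_eq_right mult.assoc)
      qed
      finally show "FC s (poly ?p) k = 0" by (simp only: diff_self)
    qed
    then have e: "smult c' (P \<alpha>) = smult c (P' \<alpha>)" "smult c' Q = smult c Q'" using Q0 by simp_all
    have "smult c (P' \<alpha> * Q) = smult c' (P \<alpha> * Q)" by (metis e(1) mult_smult_left)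
    also have "\<dots> = smult c (P \<alpha> * Q')" by (metis e(2) mult_smult_right)
    finally have "smult c (P' \<alpha> * Q - P \<alpha> * Q') = 0" by (simp add: smult_diff_right)
    then show "P' \<alpha> * Q = P \<alpha> * Q'" using c by simp
  qed
qed

text \<open>Q G - q P is q times the error. It is bounded on the level \<open>r1\<close> and of size
  (s2 / r)^n on \<open>s1\<close>; by \<open>ratio\<close> the latter is at most (s1 / r1)^n, so at
  both ends it is bounded by a multiple of (|\<Phi>| / r1)^n and \<open>annulus_max\<close> applies.
  Coefficients are taken on \<open>s2\<close>; the gaps from \<open>s1\<close> to \<open>s2\<close>
  and from \<open>r1\<close> to \<open>r\<close> are the room used up by \<open>faber_bound\<close>,
  and \<open>s3\<close> bounds a domain on which the error is still holomorphic.\<close>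

lemma numerator_estimate:
  assumes s: "1 < s1" "s1 < s2" "s2 < s3" "below s3" "s3 < r1" and r: "above r1" "r1 < r" "ereal r < R"
    and ratio: "s2 * r1 \<le> s1 * r"
  obtains C where "C > 0"
    "\<And>n Q P z. solves n Q P \<Longrightarrow> z \<in> E \<or> norm (\<Phi> z) \<le> r1 \<Longrightarrow>
      norm (poly Q z * G \<alpha> z - poly q z * poly (P \<alpha>) z)
        \<le> C * pnorm Q * ((if z \<in> E then s1 else max s1 (norm (\<Phi> z))) / r1) ^ n"
proof -
  have b2: "below s2"
    using s unfolding below_def by (auto intro: ereal_less_less[of _ s3] less_trans)
  have ar: "above r" using r unfolding above_def by (auto intro: less_trans)
  have r11: "1 < r1" "ereal r1 < R" using r by (auto simp: above_def)
  have rr: "1 < r" using ar by (simp add: above_def)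
  have s21: "1 < s2" "s2 < r" "s1 < r1" using s r by auto
  obtain C1 where C1: "C1 > 0"
    "\<And>n Q P f B. solves n Q P \<Longrightarrow> f holomorphic_on ann R \<Longrightarrow> 0 \<le> B \<Longrightarrow>
       (\<And>z. z \<notin> E \<Longrightarrow> norm (\<Phi> z) = s2 \<or> norm (\<Phi> z) = r \<Longrightarrow> norm (f z) \<le> B) \<Longrightarrow>
       norm (FC s2 (\<lambda>t. poly Q t * f t / poly q t) n) \<le> C1 * pnorm Q * B / r ^ n"
    using FC_estimate[OF b2 ar s21(2)] by blast
  have Gb: "\<exists>K>0. \<forall>z. z \<notin> E \<longrightarrow> norm (\<Phi> z) = v \<longrightarrow> norm (G \<alpha> z) \<le> K" if "1 < v" "ereal v < R" for v
    by (rule holo_level_bound[OF that(1) open_ann level_ann[OF that(2)] G_holo_ann])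
  obtain K2 where K2: "K2 > 0" "\<And>z. z \<notin> E \<Longrightarrow> norm (\<Phi> z) = s2 \<Longrightarrow> norm (G \<alpha> z) \<le> K2"
    using Gb[OF s21(1)] b2 by (auto simp: below_def)
  obtain K3 where K3: "K3 > 0" "\<And>z. z \<notin> E \<Longrightarrow> norm (\<Phi> z) = r \<Longrightarrow> norm (G \<alpha> z) \<le> K3"
    using Gb[OF rr r(3)] by blast
  obtain K4 where K4: "K4 > 0" "\<And>z. z \<notin> E \<Longrightarrow> norm (\<Phi> z) = r1 \<Longrightarrow> norm (G \<alpha> z) \<le> K4"
    using Gb[OF r11] by blast
  define KG where "KG = max K2 K3"
  have KG: "KG > 0" "\<And>z. z \<notin> E \<Longrightarrow> norm (\<Phi> z) = s2 \<or> norm (\<Phi> z) = r \<Longrightarrow> norm (G \<alpha> z) \<le> KG"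
    using K2 K3 by (auto simp: KG_def le_max_iff_disj)
  have bdd: "bounded (sublevel r1)" by (rule compact_imp_bounded[OF compact_sublevel])
  obtain K where K: "K > 0" "\<And>p z. degree p \<le> M \<Longrightarrow> z \<in> sublevel r1 \<Longrightarrow> norm (poly p z) \<le> K * pnorm p"
    using poly_pnorm_bound[OF bdd] by blast
  define Kq where "Kq = K * pnorm q"
  have Kq: "Kq \<ge> 0" "\<And>z. z \<in> sublevel r1 \<Longrightarrow> norm (poly q z) \<le> Kq"
    using K(2)[of q] K(1) deg_q_le pnorm_nonneg[of q] by (auto simp: Kq_def M_def)
  define rm where "rm = (r1 + r) / 2"
  have rm: "1 < rm" "r1 < rm" "rm < r" using r r11 by (auto simp: rm_def)
  obtain C2 where C2: "C2 > 0" "\<And>f R A z. ereal r < R \<Longrightarrow> f holomorphic_on dom R \<Longrightarrow> (\<And>j. norm (FC r f j) \<le> A / r ^ j)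
       \<Longrightarrow> z \<in> dom (ereal rm) \<Longrightarrow> norm (f z) \<le> C2 * A"
    using faber_bound[OF rm(1,3)] by blast
  define sm where "sm = (s1 + s2) / 2"
  have sm: "1 < sm" "s1 < sm" "sm < s2" using s by (auto simp: sm_def)
  obtain C3 where C3: "C3 > 0" "\<And>f R A z. ereal s2 < R \<Longrightarrow> f holomorphic_on dom R \<Longrightarrow> (\<And>j. norm (FC s2 f j) \<le> A / s2 ^ j)
       \<Longrightarrow> z \<in> dom (ereal sm) \<Longrightarrow> norm (f z) \<le> C3 * A"
    using faber_bound[OF sm(1,3)] by blast
  define CA where "CA = K * K4 + Kq * (C2 * (C1 * KG))"
  define CB where "CB = Kq * (C3 * (C1 * KG))"
  have CAB: "CA > 0" "CB \<ge> 0"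
    using K K4 Kq C1 C2 C3 KG by (auto simp: CA_def CB_def add_pos_nonneg)
  have ratio': "s2 / r \<le> s1 / r1" using ratio r11 rr by (simp add: field_simps)
  show ?thesis
  proof (rule that[of "CA + CB"])
    show "CA + CB > 0" using CAB by simp
    fix n Q P z assume sol: "solves n Q P" and z: "z \<in> E \<or> norm (\<Phi> z) \<le> r1"
    let ?p = "pnorm Q"
    let ?g = "\<lambda>z. poly Q z * G \<alpha> z / poly q z"
    let ?H = "\<lambda>z. poly Q z * G \<alpha> z - poly q z * poly (P \<alpha>) z"
    have dQ: "degree Q \<le> M" and dP: "degree (P \<alpha>) \<le> n"
      using sol unfolding solves_def by (auto intro: order_trans[OF _ diff_le_self])
    have p0: "0 \<le> ?p" by (rule pnorm_nonneg)
    \<comment> \<open>The index is raised to n by the factor \<Phi>^(n - k), which is at most r^(n -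
      k) on both levels.\<close>
    have low: "norm (FC s2 ?g k) \<le> (C1 * KG * ?p) / r ^ k" if k: "k \<le> n" for k
    proof -
      have "FC s2 ?g k = FC s2 (\<lambda>t. poly Q t * (\<Phi> t ^ (n - k) * G \<alpha> t) / poly q t) n"
      proof (rule FC_cong[OF s21(1)])
        fix z assume "z \<notin> E"
        have "\<Phi> z ^ (n + 1) = \<Phi> z ^ (n - k) * \<Phi> z ^ (k + 1)" using k by (simp flip: power_add)
        then show "?g z / \<Phi> z ^ (k + 1) = poly Q z * (\<Phi> z ^ (n - k) * G \<alpha> z) / poly q z / \<Phi> z ^ (n + 1)"
          using Phi_nz[OF \<open>z \<notin> E\<close>] by simp
      qed
      also have "norm \<dots> \<le> C1 * ?p * (r ^ (n - k) * KG) / r ^ n"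
      proof (rule C1(2)[OF sol])
        show "(\<lambda>t. \<Phi> t ^ (n - k) * G \<alpha> t) holomorphic_on ann R"
          by (intro holomorphic_intros Phi_holo_sub ann_E G_holo_ann)
        fix z assume z: "z \<notin> E" "norm (\<Phi> z) = s2 \<or> norm (\<Phi> z) = r"
        have "norm (\<Phi> z) ^ (n - k) \<le> r ^ (n - k)" using z s21 by (intro power_mono) auto
        then show "norm (\<Phi> z ^ (n - k) * G \<alpha> z) \<le> r ^ (n - k) * KG"
          unfolding norm_mult norm_power using KG(2)[OF z] rr by (intro mult_mono) auto
      qed (use KG rr in auto)
      also have "\<dots> = (C1 * KG * ?p) / r ^ k"
      proof -
        have "r ^ n = r ^ (n - k) * r ^ k" using k by (simp flip: power_add)
        then show ?thesis using rr by simp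
      qed
      finally show ?thesis .
    qed
    \<comment> \<open>Here the factor is \<Phi>^-(k - n), largest on the lower level; this is why
      the decay is only s2^-k, though with the gain (s2 / r)^n.\<close>
    have high: "norm (FC s2 ?g k) \<le> (C1 * KG * ?p * (s2 / r) ^ n) / s2 ^ k" if k: "n < k" for k
    proof -
      have "FC s2 ?g k = FC s2 (\<lambda>t. poly Q t * (G \<alpha> t / \<Phi> t ^ (k - n)) / poly q t) n"
      proof (rule FC_cong[OF s21(1)])
        fix z assume "z \<notin> E"
        have "\<Phi> z ^ (k + 1) = \<Phi> z ^ (k - n) * \<Phi> z ^ (n + 1)" using k by (simp flip: power_add)
        then show "?g z / \<Phi> z ^ (k + 1) = poly Q z * (G \<alpha> z / \<Phi> z ^ (k - n)) / poly q z / \<Phi> z ^ (n + 1)"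
          by simp
      qed
      also have "norm \<dots> \<le> C1 * ?p * (KG / s2 ^ (k - n)) / r ^ n"
      proof (rule C1(2)[OF sol])
        show "(\<lambda>t. G \<alpha> t / \<Phi> t ^ (k - n)) holomorphic_on ann R"
          by (intro holomorphic_intros Phi_holo_sub ann_E G_holo_ann) (auto simp: in_ann Phi_nz)
        fix z assume z: "z \<notin> E" "norm (\<Phi> z) = s2 \<or> norm (\<Phi> z) = r"
        have "s2 ^ (k - n) \<le> norm (\<Phi> z) ^ (k - n)" using z s21 by (intro power_mono) auto
        then show "norm (G \<alpha> z / \<Phi> z ^ (k - n)) \<le> KG / s2 ^ (k - n)"
          unfolding norm_divide norm_power using KG(2)[OF z] KG(1) s21 by (intro frac_le) auto
      qed (use KG s21 in auto)
      also have "\<dots> = (C1 * KG * ?p * (s2 / r) ^ n) / s2 ^ k"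
      proof -
        have "s2 ^ k = s2 ^ (k - n) * s2 ^ n" using k by (simp flip: power_add)
        then show ?thesis using s21 by (simp add: power_divide mult_ac)
      qed
      finally show ?thesis .
    qed
    \<comment> \<open>Up to n the coefficients of P are those of Q F, hence at most a constant times
      r^-j. Since P is entire, they may be read on the level \<open>r\<close>, which bounds P on a
      domain containing the level \<open>r1\<close>.\<close>
    have PB: "norm (poly (P \<alpha>) z) \<le> C2 * (C1 * KG * ?p)" if z: "z \<in> dom (ereal rm)" for z
    proof (rule C2(2)[where f="poly (P \<alpha>)" and R=\<infinity>])
      fix j
      show "norm (FC r (poly (P \<alpha>)) j) \<le> (C1 * KG * ?p) / r ^ j"
      proof (cases "j \<le> n")
        case True
        have "FC s2 (poly (P \<alpha>)) j = FC r (poly (P \<alpha>)) j"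
          by (rule FC_below_above[OF b2 ar s21(2)]) (intro holomorphic_intros)
        then have "FC r (poly (P \<alpha>)) j = FC s2 ?g j" using solves_FC[OF sol b2 True, of \<alpha>] by simp
        then show ?thesis using low[OF True] by simp
      next
        case False
        then have "FC r (poly (P \<alpha>)) j = 0" using dP by (intro FC_poly rr) auto
        then show ?thesis using C1 KG p0 rr by simp
      qed
    qed (use z in \<open>auto intro!: holomorphic_intros\<close>)
    have Hr: "norm (?H z) \<le> CA * ?p" if z: "z \<notin> E" "norm (\<Phi> z) = r1" for z
    proof -
      have "norm (poly Q z * G \<alpha> z) \<le> (K * ?p) * K4"
        unfolding norm_mult using K(2)[OF dQ, of z] K4 z K(1) p0 by (intro mult_mono) auto
      moreover have "norm (poly q z * poly (P \<alpha>) z) \<le> Kq * (C2 * (C1 * KG * ?p))"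
        unfolding norm_mult using Kq z PB[of z] rm by (intro mult_mono) (auto simp: dom_ereal_iff)
      moreover have "norm (?H z) \<le> norm (poly Q z * G \<alpha> z) + norm (poly q z * poly (P \<alpha>) z)"
        by (rule norm_triangle_ineq4)
      ultimately have "norm (?H z) \<le> (K * ?p) * K4 + Kq * (C2 * (C1 * KG * ?p))" by linarith
      then show ?thesis by (simp add: CA_def algebra_simps)
    qed
    let ?e = "\<lambda>z. ?g z - poly (P \<alpha>) z"
    have q3: "poly q z \<noteq> 0" if "z \<in> dom (ereal s3)" for z
      using that roots[of z] s(4) by (auto simp: dom_ereal_iff below_def)
    have s3R: "dom (ereal s3) \<subseteq> dom R" using s(4) by (intro dom_subset) (auto simp: below_def)
    have eb: "norm (?e z) \<le> C3 * (C1 * KG * ?p * (s2 / r) ^ n)" if z: "z \<in> dom (ereal sm)" for z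
    proof (rule C3(2)[where f="?e" and R="ereal s3"])
      show "?e holomorphic_on dom (ereal s3)"
        by (intro holomorphic_intros holomorphic_on_subset[OF G_holo s3R] q3)
      fix j
      show "norm (FC s2 ?e j) \<le> (C1 * KG * ?p * (s2 / r) ^ n) / s2 ^ j"
      proof (cases "j \<le> n")
        case True
        then have "FC s2 ?e j = 0" using sol b2 by (auto simp: solves_def)
        then show ?thesis using C1 KG p0 s21 rr by simp
      next
        case False
        have b2': "below s2 \<or> above s2" using b2 by simp
        have "FC s2 ?e j = FC s2 ?g j - FC s2 (poly (P \<alpha>)) j"
          by (rule FC_diff[OF s21(1) open_W W_sub(2) level_W[OF b2']]) (intro holomorphic_intros holo_quot G_holo_ann)+
        moreover have "FC s2 (poly (P \<alpha>)) j = 0" using dP False by (intro FC_poly s21) auto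
        ultimately show ?thesis using high[of j] False by simp
      qed
    qed (use z s in auto)
    have Hs: "norm (?H z) \<le> CB * ?p * (s1 / r1) ^ n" if z: "z \<in> E \<or> norm (\<Phi> z) \<le> s1" for z
    proof -
      have zs: "z \<in> dom (ereal sm)" "z \<in> dom (ereal s3)" using z sm s by (auto simp: dom_ereal_iff)
      have "?H z = poly q z * ?e z" using q3[OF zs(2)] by (simp add: right_diff_distrib)
      then have "norm (?H z) \<le> Kq * (C3 * (C1 * KG * ?p * (s2 / r) ^ n))"
        using Kq eb[OF zs(1)] z s21 unfolding norm_mult by (auto simp: norm_mult intro!: mult_mono)
      also have "\<dots> = CB * ?p * (s2 / r) ^ n" by (simp add: CB_def)
      also have "\<dots> \<le> CB * ?p * (s1 / r1) ^ n"
        using ratio' CAB p0 s21 rr by (intro mult_left_mono power_mono) auto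
      finally show ?thesis .
    qed
    show "norm (?H z) \<le> (CA + CB) * ?p * ((if z \<in> E then s1 else max s1 (norm (\<Phi> z))) / r1) ^ n"
    proof (cases "z \<in> E \<or> norm (\<Phi> z) \<le> s1")
      case True
      have "norm (?H z) \<le> CB * ?p * (s1 / r1) ^ n" by (rule Hs[OF True])
      also have "\<dots> \<le> (CA + CB) * ?p * (s1 / r1) ^ n"
        using CAB p0 s r11 by (intro mult_right_mono) auto
      also have "s1 = (if z \<in> E then s1 else max s1 (norm (\<Phi> z)))" using True by auto
      finally show ?thesis .
    next
      case False
      have "norm (?H z) \<le> (CA + CB) * ?p / r1 ^ n * norm (\<Phi> z) ^ n"
      proof (rule annulus_max[of s1 r1 R])
        show "?H holomorphic_on ann R" by (intro holomorphic_intros G_holo_ann)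
        fix x assume x: "x \<notin> E" "norm (\<Phi> x) = s1"
        then have "norm (?H x) \<le> CB * ?p * (s1 / r1) ^ n" by (intro Hs) auto
        also have "\<dots> \<le> (CA + CB) * ?p * (s1 / r1) ^ n"
          using CAB p0 s r11 by (intro mult_right_mono) auto
        finally show "norm (?H x) \<le> (CA + CB) * ?p / r1 ^ n * s1 ^ n" by (simp add: power_divide)
      next
        fix x assume x: "x \<notin> E" "norm (\<Phi> x) = r1"
        have "norm (?H x) \<le> CA * ?p" by (rule Hr[OF x])
        also have "\<dots> \<le> (CA + CB) * ?p" using CAB p0 by (intro mult_right_mono) auto
        finally show "norm (?H x) \<le> (CA + CB) * ?p / r1 ^ n * r1 ^ n" using r11 by simp
      qed (use s s21 r11 z False in auto)
      then show ?thesis using False by (simp add: power_divide max_absorb2)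
    qed
  qed
qed

end

section \<open>From geometric estimates to limits superior; convergence and normalization\<close>

lemma limsup_root_le:
  assumes "eventually (\<lambda>n. 0 \<le> x n \<and> x n \<le> C * \<delta> ^ n) sequentially" "0 < C" "0 \<le> (\<delta>::real)"
  shows "limsup (\<lambda>n. ereal (root n (x n))) \<le> ereal \<delta>"
proof -
  have "(\<lambda>n. root n C * \<delta>) \<longlonglongrightarrow> 1 * \<delta>" by (intro tendsto_intros LIMSEQ_root_const assms)
  then have lim: "(\<lambda>n. ereal (root n C * \<delta>)) \<longlonglongrightarrow> ereal \<delta>" by simp
  have "eventually (\<lambda>n. ereal (root n (x n)) \<le> ereal (root n C * \<delta>)) sequentially"
    using assms(1) eventually_gt_at_top[of 0]
  proof eventually_elim
    case (elim n)
    have "root n (x n) \<le> root n (C * \<delta> ^ n)" using elim by (intro real_root_le_mono) auto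
    also have "\<dots> = root n C * \<delta>" using elim assms by (simp add: real_root_mult real_root_power_cancel)
    finally show ?case by simp
  qed
  then have "limsup (\<lambda>n. ereal (root n (x n))) \<le> limsup (\<lambda>n. ereal (root n C * \<delta>))"
    by (rule Limsup_mono)
  also have "\<dots> = ereal \<delta>" by (rule lim_imp_Limsup[OF _ lim]) simp
  finally show ?thesis .
qed

text \<open>All losses in the radii disappear here at once, including the case of an infinite index,
  where the rate is 0.\<close>

lemma le_ereal_divide:
  fixes L \<rho> :: ereal
  assumes x: "0 < x" "ereal x < \<rho>" and le: "\<And>S r. \<sigma> < S \<Longrightarrow> x < r \<Longrightarrow> ereal r < \<rho> \<Longrightarrow> L \<le> ereal (S / r)"
  shows "L \<le> ereal \<sigma> / \<rho>"
proof (cases \<rho>)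
  case (real p)
  then have p: "x < p" using x by simp
  \<comment> \<open>The double \<open>Suc\<close> keeps the second radius strictly above
    \<open>x\<close> already at n = 0.\<close>
  have "(\<lambda>n. (\<sigma> + inverse (real (Suc n))) / (p - (p - x) * inverse (real (Suc (Suc n))))) \<longlonglongrightarrow> (\<sigma> + 0) / (p - (p - x) * 0)"
    using p x by (intro tendsto_intros LIMSEQ_inverse_real_of_nat LIMSEQ_Suc[OF LIMSEQ_inverse_real_of_nat]) auto
  then have lim: "(\<lambda>n. ereal ((\<sigma> + inverse (real (Suc n))) / (p - (p - x) * inverse (real (Suc (Suc n)))))) \<longlonglongrightarrow> ereal (\<sigma> / p)"
    by simp
  have bd: "L \<le> ereal ((\<sigma> + inverse (real (Suc n))) / (p - (p - x) * inverse (real (Suc (Suc n)))))" for n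
  proof (rule le)
    have i: "0 < inverse (real (Suc (Suc n)))" "inverse (real (Suc (Suc n))) < 1" by (simp_all add: field_simps)
    have "(p - x) * inverse (real (Suc (Suc n))) < (p - x) * 1" using p i by (intro mult_strict_left_mono) auto
    then show "x < p - (p - x) * inverse (real (Suc (Suc n)))" by simp
    have "0 < (p - x) * inverse (real (Suc (Suc n)))" using p i by (intro mult_pos_pos) auto
    then show "ereal (p - (p - x) * inverse (real (Suc (Suc n)))) < \<rho>" using real by simp
  qed simp
  have "L \<le> ereal (\<sigma> / p)" by (rule LIMSEQ_le_const[OF lim]) (use bd in blast)
  then show ?thesis using real p x by (simp add: ereal_divide)
next
  case PInf
  have "filterlim (\<lambda>n. real (Suc n)) at_top sequentially"
    using filterlim_compose[OF filterlim_real_sequentially filterlim_Suc] by simp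
  then have "filterlim (\<lambda>n. x + real (Suc n)) at_top sequentially"
    by (rule filterlim_tendsto_add_at_top[OF tendsto_const])
  then have "(\<lambda>n. (\<sigma> + 1) * inverse (x + real (Suc n))) \<longlonglongrightarrow> (\<sigma> + 1) * 0"
    by (rule tendsto_mult[OF tendsto_const tendsto_inverse_0_at_top])
  then have lim: "(\<lambda>n. ereal ((\<sigma> + 1) / (x + real (Suc n)))) \<longlonglongrightarrow> ereal 0" by (simp add: divide_inverse)
  have bd: "L \<le> ereal ((\<sigma> + 1) / (x + real (Suc n)))" for n
    by (rule le) (use PInf in auto)
  have "L \<le> ereal 0" by (rule LIMSEQ_le_const[OF lim]) (use bd in blast)
  then show ?thesis using PInf by (simp add: zero_ereal_def)
qed (use x in auto)

text \<open>Each factor 1 - z / \<zeta> is proportional to z - \<zeta>, and the product of the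
  former takes the value 1 at 0.\<close>

lemma prod_one_minus_quotient:
  fixes k :: "complex \<Rightarrow> nat"
  assumes "finite S" "0 \<notin> S"
  defines "p \<equiv> \<Prod>\<zeta>\<in>S. [:- \<zeta>, 1:] ^ k \<zeta>"
  shows "(\<Prod>\<zeta>\<in>S. [:1, - 1 / \<zeta>:] ^ k \<zeta>) = smult (1 / poly p 0) p"
  unfolding p_def using assms(1,2)
proof (induction S rule: finite_induct)
  case (insert \<zeta> S)
  have "\<zeta> \<noteq> 0" using insert.prems by auto
  then have "[:1, - 1 / \<zeta>:] = smult (1 / (- \<zeta>)) [:- \<zeta>, 1:]" by simp
  then have "[:1, - 1 / \<zeta>:] ^ k \<zeta> = smult (1 / (- \<zeta>) ^ k \<zeta>) ([:- \<zeta>, 1:] ^ k \<zeta>)"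
    by (simp only: smult_power power_one_over)
  then show ?case using insert by (simp add: poly_prod mult_ac)
qed simp

context pade begin

lemma finite_roots: "finite {\<zeta>. poly q \<zeta> = 0}" by (rule poly_roots_finite[OF q_nz])

lemma below_exists: "\<exists>s0>1. \<forall>s. 1 < s \<longrightarrow> s < s0 \<longrightarrow> below s"
proof -
  obtain R' :: real where R': "1 < ereal R'" "ereal R' < R" using ereal_dense2[OF R1] by blast
  define s0 where "s0 = Min (insert R' ((\<lambda>\<zeta>. norm (\<Phi> \<zeta>)) ` {\<zeta>. poly q \<zeta> = 0}))"
  have "1 < s0" unfolding s0_def using finite_roots R' roots norm_Phi by (subst Min_gr_iff) auto
  moreover have "s0 \<le> R'" "\<And>\<zeta>. poly q \<zeta> = 0 \<Longrightarrow> s0 \<le> norm (\<Phi> \<zeta>)"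
    unfolding s0_def using finite_roots by (auto intro!: Min_le)
  ultimately show ?thesis
    using R' by (intro exI[of _ s0]) (auto simp: below_def intro: ereal_less_less[of _ R'] order_less_le_trans)
qed

text \<open>f - P / Q equals (Q G - q P) / (q Q). On \<open>K\<close> the polynomial
  \<open>q\<close> stays away from 0 by some \<eta>, and after scaling \<open>Q\<close> is within
  \<eta> / 2 of it, so the denominator is harmless and the scale of \<open>Q\<close>
  cancels.\<close>

lemma conv_estimate:
  assumes K: "compact K" "K \<subseteq> sublevel r1" "\<And>z. z \<in> K \<Longrightarrow> poly q z \<noteq> 0"
    and F: "\<And>z. z \<in> K \<Longrightarrow> G \<alpha> z = poly q z * f z"
    and s: "1 < s1" "s1 < s3" "below s3" "s3 < r1" and r: "above r1"
    and \<sigma>: "\<And>z. z \<in> K \<Longrightarrow> z \<notin> E \<Longrightarrow> norm (\<Phi> z) \<le> \<sigma>"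
  obtains C n0 where "C > 0"
    "\<And>n Q P z. n0 \<le> n \<Longrightarrow> solves n Q P \<Longrightarrow> z \<in> K \<Longrightarrow>
       norm (f z - poly (P \<alpha>) z / poly Q z) \<le> C * (max s1 \<sigma> / r1) ^ n"
proof -
  have r1R: "ereal r1 < R" "1 < r1" using r by (auto simp: above_def)
  then obtain r where r': "ereal r1 < ereal r" "ereal r < R" using ereal_dense2 by blast
  \<comment> \<open>The midpoint keeps \<open>s2\<close> below \<open>s3\<close>, the other term
    enforces s2 r1 \<le> s1 r; both exceed \<open>s1\<close>.\<close>
  define s2 where "s2 = min ((s1 + s3) / 2) (s1 * r / r1)"
  have rr: "r1 < r" using r' by simp
  have "s1 < s1 * r / r1" using s rr r1R by (simp add: field_simps)
  then have s2: "s1 < s2" "s2 < s3" "s2 \<le> s1 * r / r1"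
    using s unfolding s2_def min_less_iff_conj min_less_iff_disj by auto
  then have ratio: "s2 * r1 \<le> s1 * r" using r1R by (simp add: field_simps)
  obtain C1 where C1: "C1 > 0"
    "\<And>n Q P z. solves n Q P \<Longrightarrow> z \<in> E \<or> norm (\<Phi> z) \<le> r1 \<Longrightarrow>
      norm (poly Q z * G \<alpha> z - poly q z * poly (P \<alpha>) z)
        \<le> C1 * pnorm Q * ((if z \<in> E then s1 else max s1 (norm (\<Phi> z))) / r1) ^ n"
    using numerator_estimate[OF s(1) s2(1,2) s(3,4) r rr r'(2) ratio] by blast
  obtain C2 n0 where C2: "C2 > 0"
    "\<And>n Q P. n0 \<le> n \<Longrightarrow> solves n Q P \<Longrightarrow> coeff Q M \<noteq> 0 \<and> pnorm Q \<le> 2 * norm (coeff Q M) * pnorm q"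
    "\<And>n Q P i. n0 \<le> n \<Longrightarrow> solves n Q P \<Longrightarrow> norm (coeff (smult (1 / coeff Q M) Q - q) i) \<le> C2 * (r1 / r) ^ n"
    using normalized_close[OF s(3) r s(4) rr r'(2)] by blast
  obtain C3 where C3: "C3 > 0" "\<And>p z. degree p \<le> M \<Longrightarrow> z \<in> K \<Longrightarrow> norm (poly p z) \<le> C3 * pnorm p"
    using poly_pnorm_bound[OF compact_imp_bounded[OF K(1)]] by blast
  have "compact (poly q ` K)" by (intro compact_continuous_image continuous_intros K(1))
  then have "closed (poly q ` K)" by (rule compact_imp_closed)
  moreover have "0 \<notin> poly q ` K" using K(3) by auto
  ultimately obtain \<eta> where \<eta>: "\<eta> > 0" "\<And>z. z \<in> K \<Longrightarrow> \<eta> \<le> norm (poly q z)"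
    using separate_point_closed[of "poly q ` K" 0] by (auto simp: dist_norm)
  have "(\<lambda>n. C3 * ((real M + 1) * (C2 * (r1 / r) ^ n))) \<longlonglongrightarrow> C3 * ((real M + 1) * (C2 * 0))"
    using rr r1R by (intro tendsto_intros LIMSEQ_power_zero) auto
  then have "eventually (\<lambda>n. C3 * ((real M + 1) * (C2 * (r1 / r) ^ n)) < \<eta> / 2) sequentially"
    by (rule order_tendstoD) (use \<eta> in simp)
  then obtain n1 where n1: "\<And>n. n1 \<le> n \<Longrightarrow> C3 * ((real M + 1) * (C2 * (r1 / r) ^ n)) < \<eta> / 2"
    by (auto simp: eventually_sequentially)
  have dq: "degree q \<le> M" using deg_q_le by (simp add: M_def)
  define C where "C = C1 * (2 * pnorm q) / (\<eta> * (\<eta> / 2)) + 1"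
  have C0: "C > 0" using C1 \<eta> pnorm_nonneg[of q] by (auto simp: C_def intro!: add_nonneg_pos)
  show ?thesis
  proof (rule that[OF C0, of "max n0 n1"])
    fix n Q P z assume n: "max n0 n1 \<le> n" and sol: "solves n Q P" and z: "z \<in> K"
    define c where "c = coeff Q M"
    have n': "n0 \<le> n" "n1 \<le> n" using n by auto
    have c: "c \<noteq> 0" "pnorm Q \<le> 2 * norm c * pnorm q" using C2(2)[OF n'(1) sol] by (auto simp: c_def)
    have dQ: "degree Q \<le> M" using sol by (simp add: solves_def)
    define d where "d = smult (1 / c) Q - q"
    have "pnorm d \<le> (\<Sum>i\<le>M. C2 * (r1 / r) ^ n)"
      unfolding pnorm_def d_def c_def by (rule sum_mono) (rule C2(3)[OF n'(1) sol])
    then have pd: "pnorm d \<le> (real M + 1) * (C2 * (r1 / r) ^ n)" by (simp add: algebra_simps)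
    have "degree d \<le> M" unfolding d_def using dQ dq by (intro degree_diff_le order_trans[OF degree_smult_le])
    then have "norm (poly d z) \<le> C3 * pnorm d" using z by (rule C3(2))
    also have "\<dots> \<le> C3 * ((real M + 1) * (C2 * (r1 / r) ^ n))" using pd C3(1) by (intro mult_left_mono) auto
    also have "\<dots> < \<eta> / 2" by (rule n1[OF n'(2)])
    finally have d: "norm (poly d z) < \<eta> / 2" .
    have "poly Q z = c * (poly q z + poly d z)" using c by (simp add: d_def)
    moreover have "\<eta> / 2 \<le> norm (poly q z + poly d z)"
      using \<eta>(2)[OF z] d norm_diff_ineq[of "poly q z" "poly d z"] by linarith
    ultimately have Qz: "norm c * (\<eta> / 2) \<le> norm (poly Q z)"
      unfolding norm_mult by (simp only: norm_mult) (rule mult_left_mono, simp_all)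
    have "0 < norm c * (\<eta> / 2)" using c(1) \<eta>(1) by simp
    with Qz have "0 < norm (poly Q z)" by (rule less_le_trans[rotated])
    then have Q0: "poly Q z \<noteq> 0" by simp
    have q0: "poly q z \<noteq> 0" using K(3)[OF z] .
    have zc: "z \<in> E \<or> norm (\<Phi> z) \<le> r1" using K(2) z by auto
    let ?m = "max s1 \<sigma> / r1"
    have m0: "?m \<ge> 0" using s r1R by (simp add: le_max_iff_disj)
    have "norm (poly Q z * G \<alpha> z - poly q z * poly (P \<alpha>) z)
        \<le> C1 * pnorm Q * ((if z \<in> E then s1 else max s1 (norm (\<Phi> z))) / r1) ^ n" by (rule C1(2)[OF sol zc])
    also have "\<dots> \<le> C1 * (2 * norm c * pnorm q) * ?m ^ n"
    proof (intro mult_mono power_mono divide_right_mono)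
      show "(if z \<in> E then s1 else max s1 (norm (\<Phi> z))) \<le> max s1 \<sigma>" using \<sigma>[OF z] by (auto simp: max.coboundedI2 max.coboundedI1 max_def)
    qed (use C1 c s r1R in \<open>auto simp: pnorm_nonneg le_max_iff_disj\<close>)
    finally have H: "norm (poly Q z * G \<alpha> z - poly q z * poly (P \<alpha>) z) \<le> C1 * (2 * norm c * pnorm q) * ?m ^ n" .
    have "f z - poly (P \<alpha>) z / poly Q z = (poly Q z * G \<alpha> z - poly q z * poly (P \<alpha>) z) / (poly q z * poly Q z)"
      using Q0 q0 F[OF z] by (simp add: field_simps)
    then have "norm (f z - poly (P \<alpha>) z / poly Q z)
        = norm (poly Q z * G \<alpha> z - poly q z * poly (P \<alpha>) z) / (norm (poly q z) * norm (poly Q z))"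
      by (simp add: norm_divide norm_mult)
    also have "\<dots> \<le> (C1 * (2 * norm c * pnorm q) * ?m ^ n) / (\<eta> * (norm c * (\<eta> / 2)))"
      using H \<eta> Qz z c m0 C1 by (intro frac_le mult_mono) (auto simp: pnorm_nonneg)
    also have "\<dots> = (C1 * (2 * pnorm q) / (\<eta> * (\<eta> / 2))) * ?m ^ n" using c by (simp add: field_simps)
    also have "\<dots> \<le> C * ?m ^ n" using m0 by (intro mult_right_mono) (auto simp: C_def)
    finally show "norm (f z - poly (P \<alpha>) z / poly Q z) \<le> C * ?m ^ n" .
  qed
qed

lemma normalized_poly_eq:
  assumes "Q \<noteq> 0" and r: "\<And>\<zeta>. poly Q \<zeta> = 0 \<Longrightarrow> \<zeta> \<notin> E \<and> norm (\<Phi> \<zeta>) > L \<and> \<zeta> \<noteq> 0"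
  shows "normalized_poly E \<Phi> L Q = smult (1 / poly Q 0) Q"
proof -
  define p where "p = (\<Prod>\<zeta> | poly Q \<zeta> = 0. [:- \<zeta>, 1:] ^ order \<zeta> Q)"
  have fin: "finite {\<zeta>. poly Q \<zeta> = 0}" using assms(1) by (rule poly_roots_finite)
  have 1: "{\<zeta>. poly Q \<zeta> = 0 \<and> (\<zeta> \<in> E \<or> norm (\<Phi> \<zeta>) \<le> L)} = {}" using r by force
  have 2: "{\<zeta>. poly Q \<zeta> = 0 \<and> \<zeta> \<notin> E \<and> norm (\<Phi> \<zeta>) > L} = {\<zeta>. poly Q \<zeta> = 0}" using r by auto
  have "(0::complex) \<notin> {\<zeta>. poly Q \<zeta> = 0}" using r by auto
  from prod_one_minus_quotient[OF fin this, of "\<lambda>\<zeta>. order \<zeta> Q"]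
  have "normalized_poly E \<Phi> L Q = smult (1 / poly p 0) p"
    unfolding normalized_poly_def 1 2 p_def by simp
  moreover have Q: "Q = smult (lead_coeff Q) p" unfolding p_def by (rule complex_poly_decompose[symmetric])
  have "smult (1 / poly Q 0) Q = smult (1 / poly p 0) p"
    by (subst (1 2) Q) (use assms(1) in simp)
  ultimately show ?thesis by simp
qed

text \<open>Being close to \<open>q\<close>, the scaled \<open>Q\<close> eventually has all its
  zeros above the threshold and away from 0. Both normalized polynomials are then scaled to the
  value 1 at 0, and closeness of coefficients passes to these quotients.\<close>

lemma denominator_estimate:
  assumes s: "below s" "above r0" "s < r0" "r0 < r" "ereal r < R"
    and q0: "poly q 0 \<noteq> 0" and L: "\<And>\<zeta>. poly q \<zeta> = 0 \<Longrightarrow> L < norm (\<Phi> \<zeta>)"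
  obtains C n0 where "C > 0"
    "\<And>n Q P. n0 \<le> n \<Longrightarrow> solves n Q P \<Longrightarrow>
       coeff_norm M (normalized_poly E \<Phi> L Q - smult (1 / poly q 0) q) \<le> C * (r0 / r) ^ n"
proof -
  obtain C2 n0 where C2: "C2 > 0"
    "\<And>n Q P. n0 \<le> n \<Longrightarrow> solves n Q P \<Longrightarrow> coeff Q M \<noteq> 0 \<and> pnorm Q \<le> 2 * norm (coeff Q M) * pnorm q"
    "\<And>n Q P i. n0 \<le> n \<Longrightarrow> solves n Q P \<Longrightarrow> norm (coeff (smult (1 / coeff Q M) Q - q) i) \<le> C2 * (r0 / r) ^ n"
    using normalized_close[OF s] by blast
  have rr: "0 < r0" "0 < r" using s by (auto simp: above_def)
  \<comment> \<open>The places where a zero of \<open>Q\<close> would be treated differently by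
    \<open>normalized_poly\<close>: in \<open>E\<close>, up to the level \<open>L\<close>, or at
    0.\<close>
  define K where "K = insert 0 (sublevel L)"
  have K: "compact K" unfolding K_def by (intro compact_insert compact_sublevel)
  have qK: "poly q z \<noteq> 0" if "z \<in> K" for z using that q0 L[of z] roots[of z] by (auto simp: K_def)
  obtain C3 where C3: "C3 > 0" "\<And>p z. degree p \<le> M \<Longrightarrow> z \<in> K \<Longrightarrow> norm (poly p z) \<le> C3 * pnorm p"
    using poly_pnorm_bound[OF compact_imp_bounded[OF K]] by blast
  have "compact (poly q ` K)" by (intro compact_continuous_image continuous_intros K(1))
  then have "closed (poly q ` K)" by (rule compact_imp_closed)
  moreover have "0 \<notin> poly q ` K" using qK by auto
  ultimately obtain \<eta> where \<eta>: "\<eta> > 0" "\<And>z. z \<in> K \<Longrightarrow> \<eta> \<le> norm (poly q z)"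
    using separate_point_closed[of "poly q ` K" 0] by (auto simp: dist_norm)
  have "(\<lambda>n. C3 * ((real M + 1) * (C2 * (r0 / r) ^ n))) \<longlonglongrightarrow> C3 * ((real M + 1) * (C2 * 0))"
    using s rr by (intro tendsto_intros LIMSEQ_power_zero) auto
  then have "eventually (\<lambda>n. C3 * ((real M + 1) * (C2 * (r0 / r) ^ n)) < \<eta> / 2) sequentially"
    by (rule order_tendstoD) (use \<eta> in simp)
  then obtain n1 where n1: "\<And>n. n1 \<le> n \<Longrightarrow> C3 * ((real M + 1) * (C2 * (r0 / r) ^ n)) < \<eta> / 2"
    by (auto simp: eventually_sequentially)
  have dq: "degree q \<le> M" using deg_q_le by (simp add: M_def)
  define b where "b = poly q 0"
  have b: "\<eta> \<le> norm b" using \<eta>(2)[of 0] by (simp add: b_def K_def)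
  define C where "C = (C2 * norm b + pnorm q * (C3 * ((real M + 1) * C2))) / (\<eta> / 2 * \<eta>) + 1"
  have C0: "C > 0" using C2 C3 \<eta> pnorm_nonneg[of q] by (auto simp: C_def intro!: add_nonneg_pos divide_nonneg_nonneg)
  show ?thesis
  proof (rule that[OF C0, of "max n0 n1"])
    fix n Q P assume n: "max n0 n1 \<le> n" and sol: "solves n Q P"
    define c where "c = coeff Q M"
    have n': "n0 \<le> n" "n1 \<le> n" using n by auto
    have c: "c \<noteq> 0" using C2(2)[OF n'(1) sol] by (auto simp: c_def)
    have dQ: "degree Q \<le> M" and Qnz: "Q \<noteq> 0" using sol by (auto simp: solves_def)
    define d where "d = smult (1 / c) Q - q"
    have dco: "norm (coeff d i) \<le> C2 * (r0 / r) ^ n" for i unfolding d_def c_def by (rule C2(3)[OF n'(1) sol])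
    have "pnorm d \<le> (\<Sum>i\<le>M. C2 * (r0 / r) ^ n)" unfolding pnorm_def by (rule sum_mono) (rule dco)
    then have pd: "pnorm d \<le> (real M + 1) * (C2 * (r0 / r) ^ n)" by (simp add: algebra_simps)
    have degd: "degree d \<le> M" unfolding d_def using dQ dq by (intro degree_diff_le order_trans[OF degree_smult_le])
    have dz: "norm (poly d z) \<le> C3 * ((real M + 1) * (C2 * (r0 / r) ^ n))" if "z \<in> K" for z
      using C3(2)[OF degd that] pd C3(1) by (meson less_imp_le mult_left_mono order_trans)
    have Qq: "poly Q z = c * (poly q z + poly d z)" for z using c by (simp add: d_def)
    have low: "\<eta> / 2 \<le> norm (poly q z + poly d z)" if "z \<in> K" for z
      using \<eta>(2)[OF that] dz[OF that] n1[OF n'(2)] norm_diff_ineq[of "poly q z" "poly d z"] by linarith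
    have QK: "poly Q z \<noteq> 0" if "z \<in> K" for z using low[OF that] \<eta>(1) c unfolding Qq by auto
    have N: "normalized_poly E \<Phi> L Q = smult (1 / poly Q 0) Q"
    proof (rule normalized_poly_eq[OF Qnz])
      fix \<zeta> assume "poly Q \<zeta> = 0"
      then have "\<zeta> \<notin> K" using QK by blast
      then show "\<zeta> \<notin> E \<and> norm (\<Phi> \<zeta>) > L \<and> \<zeta> \<noteq> 0" by (auto simp: K_def)
    qed
    define a where "a = poly q 0 + poly d 0"
    have a: "\<eta> / 2 \<le> norm a" using low[of 0] by (simp add: a_def K_def)
    have a0: "a \<noteq> 0" "b \<noteq> 0" using a \<eta>(1) q0 by (auto simp: b_def)
    have Qd: "Q = smult c (q + d)" using c by (simp add: d_def)
    have N': "normalized_poly E \<Phi> L Q = smult (1 / a) (q + d)"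
      unfolding N Qq[of 0] a_def[symmetric] by (subst Qd) (use c in simp)
    have "norm (coeff (normalized_poly E \<Phi> L Q - smult (1 / poly q 0) q) i) \<le> C * (r0 / r) ^ n" for i
    proof -
      let ?y = "coeff q i" and ?x = "coeff d i"
      \<comment> \<open>This is (y + x) / a - y / b over a common denominator, with a = b + poly d
        0; |a| is at least \<eta> / 2 and |b| at least \<eta>.\<close>
      have "coeff (normalized_poly E \<Phi> L Q - smult (1 / poly q 0) q) i = (?x * b - ?y * poly d 0) / (a * b)"
        unfolding N' b_def[symmetric] using a0 by (simp add: field_simps) (simp add: a_def b_def algebra_simps)
      also have "norm \<dots> = norm (?x * b - ?y * poly d 0) / (norm a * norm b)" by (simp add: norm_divide norm_mult)
      also have "\<dots> \<le> (C2 * (r0 / r) ^ n * norm b + pnorm q * (C3 * ((real M + 1) * (C2 * (r0 / r) ^ n)))) / (\<eta> / 2 * \<eta>)"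
      proof (intro frac_le mult_mono a b)
        have "norm (?x * b) \<le> C2 * (r0 / r) ^ n * norm b" unfolding norm_mult by (intro mult_right_mono dco) simp
        moreover have "norm (?y * poly d 0) \<le> pnorm q * (C3 * ((real M + 1) * (C2 * (r0 / r) ^ n)))"
          unfolding norm_mult by (intro mult_mono coeff_le_pnorm dq dz) (auto simp: K_def pnorm_nonneg)
        ultimately show "norm (?x * b - ?y * poly d 0) \<le> C2 * (r0 / r) ^ n * norm b + pnorm q * (C3 * ((real M + 1) * (C2 * (r0 / r) ^ n)))"
          using norm_triangle_ineq4[of "?x * b" "?y * poly d 0"] by linarith
      qed (use \<eta> rr C2 C3 in \<open>auto simp: pnorm_nonneg\<close>)
      also have "\<dots> = ((C2 * norm b + pnorm q * (C3 * ((real M + 1) * C2))) / (\<eta> / 2 * \<eta>)) * (r0 / r) ^ n"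
        by (simp add: add_divide_distrib algebra_simps)
      also have "\<dots> \<le> C * (r0 / r) ^ n" using rr by (intro mult_right_mono) (auto simp: C_def)
      finally show ?thesis .
    qed
    then show "coeff_norm M (normalized_poly E \<Phi> L Q - smult (1 / poly q 0) q) \<le> C * (r0 / r) ^ n"
      unfolding coeff_norm_def by (subst Max_le_iff) auto
  qed
qed

end

section \<open>Poles of the vector\<close>

lemma pole_order_le_vec_pole_order:
  fixes F :: "'d::finite \<Rightarrow> complex \<Rightarrow> complex"
  shows "is_pole (F \<alpha>) z \<Longrightarrow> nat (- zorder (F \<alpha>) z) \<le> vec_pole_order F z"
  unfolding vec_pole_order_def by (rule Max_ge) auto

lemma meromorphic_isolated:
  "f meromorphic_on A \<Longrightarrow> z \<in> A \<Longrightarrow> isolated_singularity_at f z"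
  by (rule meromorphic_on_isolated_singularity) (auto intro: meromorphic_on_subset)

lemma vec_pole_order_pos:
  fixes F :: "'d::finite \<Rightarrow> complex \<Rightarrow> complex"
  assumes "\<And>\<alpha>. F \<alpha> meromorphic_on D" "z \<in> vec_poles F D"
  shows "0 < vec_pole_order F z"
proof -
  obtain \<alpha> where \<alpha>: "z \<in> D" "is_pole (F \<alpha>) z" using assms(2) by (auto simp: vec_poles_def)
  have "zorder (F \<alpha>) z < 0"
    by (rule isolated_pole_imp_neg_zorder[OF meromorphic_isolated[OF assms(1) \<alpha>(1)] \<alpha>(2)])
  then show ?thesis using pole_order_le_vec_pole_order[of F \<alpha> z] \<alpha>(2) by simp
qed

lemma vec_pole_order_cong:
  fixes F G :: "'d::finite \<Rightarrow> complex \<Rightarrow> complex"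
  assumes "\<And>\<alpha>. eventually (\<lambda>w. F \<alpha> w = G \<alpha> w) (at z)"
  shows "(\<exists>\<alpha>. is_pole (F \<alpha>) z) \<longleftrightarrow> (\<exists>\<alpha>. is_pole (G \<alpha>) z)" "vec_pole_order F z = vec_pole_order G z"
proof -
  have 1: "is_pole (F \<alpha>) z \<longleftrightarrow> is_pole (G \<alpha>) z" for \<alpha> by (rule is_pole_cong[OF assms refl])
  have 2: "zorder (F \<alpha>) z = zorder (G \<alpha>) z" for \<alpha> by (rule zorder_cong[OF assms refl])
  show "(\<exists>\<alpha>. is_pole (F \<alpha>) z) \<longleftrightarrow> (\<exists>\<alpha>. is_pole (G \<alpha>) z)" "vec_pole_order F z = vec_pole_order G z"
    by (simp_all add: 1 2 vec_pole_order_def)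
qed

text \<open>Off a sparse set the difference is either constantly 0 or never 0; the second case
  contradicts agreement on \<open>U\<close>.\<close>

lemma meromorphic_unique_extension:
  assumes "f meromorphic_on A" "g meromorphic_on A" "open A" "connected A"
    and U: "open U" "x \<in> U" "x \<in> A" "\<And>z. z \<in> U \<Longrightarrow> f z = g z" and z: "z \<in> A"
  shows "eventually (\<lambda>w. f w = g w) (at z)"
proof -
  have "(\<lambda>z. f z - g z) meromorphic_on A" using assms by (intro meromorphic_intros)
  then consider "eventually (\<lambda>z. f z - g z = 0) (cosparse A)" | "eventually (\<lambda>z. f z - g z \<noteq> 0) (cosparse A)"
    using meromorphic_imp_constant_or_avoid[of "\<lambda>z. f z - g z" A 0] assms by blast
  then show ?thesis
  proof cases
    case 1
    then show ?thesis using z by (simp add: eventually_cosparse_open_eq[OF assms(3)])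
  next
    case 2
    then have "eventually (\<lambda>z. f z - g z \<noteq> 0) (at x)" using U by (simp add: eventually_cosparse_open_eq[OF assms(3)])
    moreover have "eventually (\<lambda>z. z \<in> U) (at x)" using U by (simp add: eventually_at_in_open')
    ultimately have "eventually (\<lambda>z. False) (at x)" by eventually_elim (use U in auto)
    then show ?thesis by simp
  qed
qed

context exterior begin

text \<open>The supremum in \<open>mero_index\<close> need not be attained, and its competitors are
  other extensions than \<open>F\<close>. A finite set of poles already lies in the domain of some
  competitor, which equals \<open>F\<close> there up to isolated points, so its total order is at
  most \<open>N\<close>; a uniform bound on finite subsets gives finiteness.\<close>

lemma poles_within_mero_index:
  fixes F :: "'d::finite \<Rightarrow> complex \<Rightarrow> complex" and N :: nat
  defines "\<rho> \<equiv> mero_index E \<Phi> N F"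
  assumes F: "\<And>\<alpha>. F \<alpha> meromorphic_on dom \<rho>" and \<rho>: "1 < \<rho>"
  shows "finite (vec_poles F (dom \<rho>))" "(\<Sum>z\<in>vec_poles F (dom \<rho>). vec_pole_order F z) \<le> N"
proof -
  have sub: "(\<Sum>z\<in>S. vec_pole_order F z) \<le> N" if S: "S \<subseteq> vec_poles F (dom \<rho>)" "finite S" for S
  proof -
    \<comment> \<open>The inserted 1 forces \<rho>' > 1, so that the smaller domain is connected,
      even if \<open>S\<close> has no point outside \<open>E\<close>.\<close>
    define t where "t = Max (insert 1 ((\<lambda>z. ereal (norm (\<Phi> z))) ` (S - E)))"
    have t: "t < \<rho>" unfolding t_def using S \<rho> by (subst Max_less_iff) (auto simp: vec_poles_def canonical_domain_def)
    have tz: "ereal (norm (\<Phi> z)) \<le> t" if "z \<in> S" "z \<notin> E" for z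
      unfolding t_def using S(2) that by (intro Max_ge) auto
    have t1: "1 \<le> t" unfolding t_def using S(2) by (intro Max_ge) auto
    obtain \<rho>' G where \<rho>': "t < \<rho>'"
      and G: "\<And>\<alpha>. G \<alpha> meromorphic_on dom \<rho>'" "\<And>\<alpha>. \<exists>U. open U \<and> E \<subseteq> U \<and> (\<forall>z\<in>U. G \<alpha> z = F \<alpha> z)"
        "finite (vec_poles G (dom \<rho>'))" "(\<Sum>z\<in>vec_poles G (dom \<rho>'). vec_pole_order G z) \<le> N"
      and le: "\<rho>' \<le> \<rho>"
    proof -
      let ?X = "{\<rho>. 1 < \<rho> \<and>
            (\<exists>G. (\<forall>\<alpha>. G \<alpha> meromorphic_on dom \<rho> \<and>
                      (\<exists>U. open U \<and> E \<subseteq> U \<and> (\<forall>z\<in>U. G \<alpha> z = F \<alpha> z))) \<and>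
                 finite (vec_poles G (dom \<rho>)) \<and>
                 (\<Sum>z\<in>vec_poles G (dom \<rho>). vec_pole_order G z) \<le> N)}"
      have "t < Sup ?X" using t unfolding \<rho>_def mero_index_def .
      then obtain \<rho>' where r: "\<rho>' \<in> ?X" "t < \<rho>'" using less_Sup_iff by blast
      have "\<rho>' \<le> \<rho>" unfolding \<rho>_def mero_index_def using r(1) by (rule Sup_upper)
      then show thesis using r that by blast
    qed
    have dsub: "dom \<rho>' \<subseteq> dom \<rho>" using le by (rule dom_subset)
    have "1 < \<rho>'" using t1 \<rho>' by simp
    then have oc: "open (dom \<rho>')" "connected (dom \<rho>')" using connected_dom by auto
    obtain x where x: "x \<in> E" using E_ne by blast
    have ev: "eventually (\<lambda>w. F \<alpha> w = G \<alpha> w) (at z)" if z: "z \<in> dom \<rho>'" for \<alpha> z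
    proof -
      obtain U where U: "open U" "E \<subseteq> U" "\<And>z. z \<in> U \<Longrightarrow> G \<alpha> z = F \<alpha> z" using G(2)[of \<alpha>] by blast
      show ?thesis
        by (rule meromorphic_unique_extension[OF meromorphic_on_subset[OF F dsub] G(1) oc U(1), of x])
           (use U x E_sub_dom[of \<rho>'] z in auto)
    qed
    have eqp: "vec_poles F (dom \<rho>') = vec_poles G (dom \<rho>')"
      unfolding vec_poles_def using vec_pole_order_cong(1)[of F G, OF ev] by blast
    have eqo: "vec_pole_order F z = vec_pole_order G z" if "z \<in> vec_poles G (dom \<rho>')" for z
      using vec_pole_order_cong(2)[of F G, OF ev] that by (auto simp: vec_poles_def)
    have "S \<subseteq> vec_poles F (dom \<rho>')"
    proof
      fix z assume z: "z \<in> S"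
      have "z \<in> dom \<rho>'"
      proof (cases "z \<in> E")
        case False
        have "ereal (norm (\<Phi> z)) < \<rho>'" using tz[OF z False] \<rho>' by (rule le_less_trans)
        then show ?thesis by (simp add: canonical_domain_def)
      qed (simp add: canonical_domain_def)
      then show "z \<in> vec_poles F (dom \<rho>')" using z S(1) by (auto simp: vec_poles_def)
    qed
    then have "(\<Sum>z\<in>S. vec_pole_order F z) \<le> (\<Sum>z\<in>vec_poles F (dom \<rho>'). vec_pole_order F z)"
      using G(3) eqp by (intro sum_mono2) auto
    also have "\<dots> = (\<Sum>z\<in>vec_poles G (dom \<rho>'). vec_pole_order G z)" unfolding eqp using eqo by (intro sum.cong) auto
    finally show ?thesis using G(4) by simp
  qed
  have "card S \<le> N" if S: "S \<subseteq> vec_poles F (dom \<rho>)" "finite S" for S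
  proof -
    have "card S = (\<Sum>z\<in>S. 1)" by simp
    also have "\<dots> \<le> (\<Sum>z\<in>S. vec_pole_order F z)"
      using vec_pole_order_pos[of F, OF F] S(1) by (intro sum_mono) (metis One_nat_def Suc_leI subsetD)
    finally show ?thesis using sub[OF S] by simp
  qed
  then show "finite (vec_poles F (dom \<rho>))" using finite_if_finite_subsets_card_bdd by blast
  then show "(\<Sum>z\<in>vec_poles F (dom \<rho>). vec_pole_order F z) \<le> N" using sub by blast
qed

end

text \<open>Monic counterpart of \<open>pole_poly\<close> that keeps its meaning when 0 is a
  pole.\<close>

definition pole_denominator :: "('d::finite \<Rightarrow> complex \<Rightarrow> complex) \<Rightarrow> complex set \<Rightarrow> complex poly" where
  "pole_denominator F D = (\<Prod>\<zeta>\<in>vec_poles F D. [:- \<zeta>, 1:] ^ vec_pole_order F \<zeta>)"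

lemma pole_denominator_props:
  fixes F :: "'d::finite \<Rightarrow> complex \<Rightarrow> complex"
  assumes fin: "finite (vec_poles F D)" and F: "\<And>\<alpha>. F \<alpha> meromorphic_on D"
  shows "lead_coeff (pole_denominator F D) = 1"
    and "degree (pole_denominator F D) = (\<Sum>z\<in>vec_poles F D. vec_pole_order F z)"
    and "poly (pole_denominator F D) z = 0 \<longleftrightarrow> z \<in> vec_poles F D"
proof -
  show "lead_coeff (pole_denominator F D) = 1"
    unfolding pole_denominator_def by (simp add: lead_coeff_prod lead_coeff_power)
  have "degree (pole_denominator F D) = (\<Sum>z\<in>vec_poles F D. degree ([:- z, 1:] ^ vec_pole_order F z))"
    unfolding pole_denominator_def by (rule degree_prod_sum_eq) auto
  then show "degree (pole_denominator F D) = (\<Sum>z\<in>vec_poles F D. vec_pole_order F z)"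
    by (simp add: degree_linear_power)
  show "poly (pole_denominator F D) z = 0 \<longleftrightarrow> z \<in> vec_poles F D"
    unfolding pole_denominator_def poly_prod using fin vec_pole_order_pos[of F, OF F]
    by (auto simp: prod_zero_iff)
qed

text \<open>The exponent of each factor is at least the pole order of every component there, so the
  product has finite limits everywhere; \<open>remove_sings\<close> supplies these limits as
  values.\<close>

lemma cleared_analytic:
  fixes F :: "'d::finite \<Rightarrow> complex \<Rightarrow> complex"
  assumes fin: "finite (vec_poles F D)" and F: "\<And>\<alpha>. F \<alpha> meromorphic_on D" and D: "open D"
  shows "remove_sings (\<lambda>z. poly (pole_denominator F D) z * F \<alpha> z) analytic_on D"
proof -
  define q where "q = pole_denominator F D"
  let ?f = "\<lambda>z. poly q z * F \<alpha> z"
  have mer: "?f meromorphic_on D"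
    by (intro meromorphic_intros F analytic_on_imp_meromorphic_on) (auto simp: analytic_on_open[OF D] intro!: holomorphic_intros)
  have np: "\<not> is_pole ?f z" if z: "z \<in> D" for z
  proof (cases "is_pole (F \<alpha>) z")
    case False
    have "not_essential (F \<alpha>) z" using F z meromorphic_onE by metis
    then obtain c where "F \<alpha> \<midarrow>z\<rightarrow> c" using False by (auto simp: not_essential_def)
    then have "?f \<midarrow>z\<rightarrow> poly q z * c" by (intro tendsto_intros)
    then show ?thesis using not_tendsto_and_filterlim_at_infinity[of "at z"] by (auto simp: is_pole_def)
  next
    case True
    obtain e where e: "e > 0" "F \<alpha> analytic_on ball z e - {z}"
      using meromorphic_isolated[OF F z] by (auto simp: isolated_singularity_at_def)
    define k where "k = nat (- zorder (F \<alpha>) z)"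
    obtain r where r: "r > 0" "zor_poly (F \<alpha>) z holomorphic_on cball z r"
        "\<And>w. w \<in> cball z r - {z} \<Longrightarrow> F \<alpha> w = zor_poly (F \<alpha>) z w / (w - z) ^ k"
      using zorder_exist_pole[of "F \<alpha>" "ball z e" z] e True
      by (auto simp: k_def analytic_on_open open_delete dest: analytic_imp_holomorphic)
    have k: "k \<le> vec_pole_order F z" unfolding k_def by (rule pole_order_le_vec_pole_order[of F \<alpha> z, OF True])
    have zV: "z \<in> vec_poles F D" using z True by (auto simp: vec_poles_def)
    define q' where "q' = (\<Prod>\<zeta>\<in>vec_poles F D - {z}. [:- \<zeta>, 1:] ^ vec_pole_order F \<zeta>)"
    have q: "q = [:- z, 1:] ^ vec_pole_order F z * q'"
      unfolding q_def pole_denominator_def q'_def by (rule prod.remove[OF fin zV])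
    have "isCont (zor_poly (F \<alpha>) z) z"
      using holomorphic_on_imp_continuous_on[OF r(2)] r(1) by (intro continuous_on_interior) auto
    then have "(\<lambda>w. (w - z) ^ (vec_pole_order F z - k) * poly q' w * zor_poly (F \<alpha>) z w) \<midarrow>z\<rightarrow>
        (z - z) ^ (vec_pole_order F z - k) * poly q' z * zor_poly (F \<alpha>) z z"
      by (intro tendsto_intros) (simp add: isCont_def)
    moreover have "eventually (\<lambda>w. (w - z) ^ (vec_pole_order F z - k) * poly q' w * zor_poly (F \<alpha>) z w = ?f w) (at z)"
    proof -
      have "eventually (\<lambda>w. w \<in> ball z r - {z}) (at z)"
        using r(1) by (intro eventually_at_in_open) auto
      then show ?thesis
      proof eventually_elim
        case (elim w)
        have "(w - z) ^ vec_pole_order F z = (w - z) ^ (vec_pole_order F z - k) * (w - z) ^ k"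
          using k by (simp flip: power_add)
        then show ?case using r(3)[of w] elim by (simp add: q)
      qed
    qed
    ultimately have "?f \<midarrow>z\<rightarrow> (z - z) ^ (vec_pole_order F z - k) * poly q' z * zor_poly (F \<alpha>) z z"
      by (rule Lim_transform_eventually)
    then show ?thesis using not_tendsto_and_filterlim_at_infinity[of "at z"] by (auto simp: is_pole_def)
  qed
  show ?thesis
    unfolding q_def[symmetric]
  proof (rule nicely_meromorphic_without_singularities[OF remove_sings_nicely_meromorphic[OF mer]])
    show "\<forall>z\<in>D. \<not> is_pole (remove_sings ?f) z"
      using np meromorphic_isolated[OF mer] by simp
  qed
qed

context exterior begin

text \<open>The values of \<Phi> on \<open>E\<close> are arbitrary, so |\<Phi>| is maximized over
  the part of \<open>K\<close> outside the open set \<open>dom x\<close>, which is compact and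
  misses \<open>E\<close>.\<close>

lemma compact_in_sublevel:
  assumes K: "compact K" "K \<subseteq> dom \<rho>" and x: "1 < x" "ereal x < \<rho>"
  obtains y where "x \<le> y" "ereal y < \<rho>" "K \<subseteq> sublevel y"
proof (cases "K - dom (ereal x) = {}")
  case True
  then show ?thesis using x by (intro that[of x]) (auto simp: dom_ereal_iff)
next
  case False
  have "open (dom (ereal x))" using connected_dom(1)[of "ereal x"] x by simp
  then have c: "compact (K - dom (ereal x))" using K(1) by (rule compact_diff[rotated])
  have "continuous_on (K - dom (ereal x)) (\<lambda>z. norm (\<Phi> z))"
    by (intro continuous_intros continuous_on_subset[OF Phi_cont]) (auto simp: dom_ereal_iff)
  from continuous_attains_sup[OF c False this]
  obtain w where w: "w \<in> K" "w \<notin> dom (ereal x)" "\<And>z. z \<in> K \<Longrightarrow> z \<notin> dom (ereal x) \<Longrightarrow> norm (\<Phi> z) \<le> norm (\<Phi> w)" by auto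
  have "w \<in> dom \<rho>" "w \<notin> E" "x \<le> norm (\<Phi> w)" using w K(2) by (auto simp: dom_ereal_iff)
  then have "ereal (norm (\<Phi> w)) < \<rho>" by (auto simp: canonical_domain_def)
  then show ?thesis
    using w(3) \<open>x \<le> norm (\<Phi> w)\<close> by (intro that[of "norm (\<Phi> w)"]) (force simp: dom_ereal_iff)+
qed

lemma map_norm_props:
  assumes K: "K \<subseteq> sublevel y" and y: "1 \<le> y"
  shows "1 \<le> map_norm E \<Phi> K" "map_norm E \<Phi> K \<le> y"
    and "\<And>z. z \<in> K \<Longrightarrow> z \<notin> E \<Longrightarrow> norm (\<Phi> z) \<le> map_norm E \<Phi> K"
proof -
  show up: "norm (\<Phi> z) \<le> map_norm E \<Phi> K" if z: "z \<in> K" "z \<notin> E" for z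
  proof -
    have "norm (\<Phi> z) \<le> (SUP z\<in>K - E. norm (\<Phi> z))"
      using z K by (intro cSUP_upper bdd_aboveI2[of _ _ y]) auto
    then show ?thesis using z by (auto simp: map_norm_def)
  qed
  show "1 \<le> map_norm E \<Phi> K"
  proof (cases "K \<subseteq> E")
    case False
    then obtain z where z: "z \<in> K" "z \<notin> E" by blast
    show ?thesis using up[OF z] norm_Phi[OF z(2)] by linarith
  qed (simp add: map_norm_def)
  show "map_norm E \<Phi> K \<le> y"
  proof (cases "K \<subseteq> E")
    case False
    then show ?thesis using K unfolding map_norm_def by (auto intro!: cSUP_least)
  qed (simp add: map_norm_def y)
qed

lemma sup_norm_bounds:
  assumes "\<And>z. z \<in> K \<Longrightarrow> norm (f z) \<le> B" "0 \<le> B"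
  shows "0 \<le> sup_norm K f" "sup_norm K f \<le> B"
  unfolding sup_norm_def
  using assms by (auto intro!: cSup_upper cSup_least bdd_aboveI[of _ B])

text \<open>The supremum could be taken over the empty set. But for an index at most 1 nothing is
  left of the domain outside \<open>E\<close>, and then every admissible vector contradicts
  independence.\<close>

lemma independent_index_gt_1:
  assumes "polewise_independent E \<Phi> F m \<rho>" "\<exists>\<alpha>. m \<alpha> \<noteq> 0"
  shows "1 < \<rho>"
proof (rule ccontr)
  assume n: "\<not> 1 < \<rho>"
  have e: "dom \<rho> - E = {}"
  proof (rule equals0I)
    fix z assume "z \<in> dom \<rho> - E"
    then have z: "z \<notin> E" "ereal (norm (\<Phi> z)) < \<rho>" by (auto simp: canonical_domain_def)
    have "\<rho> \<le> 1" using n by simp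
    then have "ereal (norm (\<Phi> z)) < 1" using z(2) by (rule less_le_trans[rotated])
    then show False using norm_Phi[OF z(1)] by simp
  qed
  let ?v = "\<lambda>\<alpha>. if m \<alpha> = 0 then 0 else 1 :: complex poly"
  have w: "(\<exists>\<alpha>. ?v \<alpha> \<noteq> 0) \<and> (\<forall>\<alpha>. m \<alpha> \<ge> 1 \<longrightarrow> degree (?v \<alpha>) \<le> m \<alpha> - 1) \<and> (\<forall>\<alpha>. m \<alpha> = 0 \<longrightarrow> ?v \<alpha> = 0) \<and>
     remove_sings (\<lambda>z. \<Sum>\<alpha>\<in>UNIV. poly (?v \<alpha>) (\<Phi> z) * F \<alpha> z) holomorphic_on (dom \<rho> - E)"
    unfolding e using assms(2) by (auto simp: holomorphic_on_def)
  show False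
    by (rule notE[OF assms(1)[unfolded polewise_independent_def]], rule exI[of _ ?v], rule w)
qed

section \<open>Proof of the theorem for a given exterior map\<close>

lemma pade_faber_convergence:
  fixes F :: "'d::finite \<Rightarrow> complex \<Rightarrow> complex"
    and m :: "'d \<Rightarrow> nat"
    and Q :: "nat \<Rightarrow> complex poly"
    and P :: "nat \<Rightarrow> 'd \<Rightarrow> complex poly"
    and M :: nat and \<rho> :: ereal and D Poles :: "complex set"
  assumes M: "M = (\<Sum>\<alpha>\<in>UNIV. m \<alpha>)" and \<rho>: "\<rho> = mero_index E \<Phi> M F" and D: "D = canonical_domain E \<Phi> \<rho>"
    and Poles: "Poles = vec_poles F D"
    and FE: "\<And>\<alpha>. F \<alpha> analytic_on E"
    and FD: "\<And>\<alpha>. F \<alpha> nicely_meromorphic_on D"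
    and m: "\<exists>\<alpha>. m \<alpha> \<noteq> 0"
    and ind: "polewise_independent E \<Phi> F m \<rho>"
    and sol: "\<And>n. n \<ge> Max (range m) \<Longrightarrow> pade_faber E \<Phi> F m n (Q n) (P n)"
  shows
    "(\<forall>\<^sub>F n in sequentially. \<forall>Q' P'. pade_faber E \<Phi> F m n Q' P' \<longrightarrow>
        (\<forall>\<alpha>. Fract (P' \<alpha>) Q' = Fract (P n \<alpha>) (Q n))) \<and>
     (\<forall>\<alpha> K. compact K \<and> K \<subseteq> D - Poles \<longrightarrow>
        uniform_limit K (\<lambda>n z. poly (P n \<alpha>) z / poly (Q n) z) (F \<alpha>) sequentially \<and>
        limsup (\<lambda>n. ereal (root n (sup_norm K (\<lambda>z. F \<alpha> z - poly (P n \<alpha>) z / poly (Q n) z))))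
          \<le> ereal (map_norm E \<Phi> K) / \<rho>) \<and>
     (0 \<notin> Poles \<longrightarrow>
        limsup (\<lambda>n. ereal (root n (coeff_norm M
            (normalized_poly E \<Phi> (pole_threshold \<Phi> F D) (Q n) - pole_poly F D))))
          \<le> ereal (Max ((\<lambda>\<zeta>. norm (\<Phi> \<zeta>)) ` Poles)) / \<rho>)"
proof -
  have \<rho>1: "1 < \<rho>" by (rule independent_index_gt_1[OF ind m])
  have oD: "open D" unfolding D using connected_dom(1)[OF \<rho>1] .
  have mer: "F \<alpha> meromorphic_on D" for \<alpha> using FD by (simp add: nicely_meromorphic_on_def)
  have fin: "finite Poles" and ordM: "(\<Sum>z\<in>Poles. vec_pole_order F z) \<le> M"
    using poles_within_mero_index[of F M] mer \<rho>1 unfolding Poles D \<rho> by auto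
  define q where "q = pole_denominator F D"
  define G where "G = (\<lambda>\<alpha>. remove_sings (\<lambda>z. poly q z * F \<alpha> z))"
  have q_monic: "lead_coeff q = 1" and q_deg: "degree q = (\<Sum>z\<in>Poles. vec_pole_order F z)"
    and q_root: "poly q z = 0 \<longleftrightarrow> z \<in> Poles" for z
    using pole_denominator_props[of F D] fin mer unfolding q_def Poles by auto
  have PE: "z \<in> D" "z \<notin> E" if "z \<in> Poles" for z
  proof -
    show "z \<in> D" using that by (simp add: Poles vec_poles_def)
    show "z \<notin> E"
    proof
      assume "z \<in> E"
      then have "F \<alpha> analytic_on {z}" for \<alpha> using FE by (auto intro: analytic_on_subset)
      then have "\<not> is_pole (F \<alpha>) z" for \<alpha> by (rule analytic_at_imp_no_pole)
      then show False using that by (simp add: Poles vec_poles_def)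
    qed
  qed
  have Poles\<rho>: "ereal (norm (\<Phi> z)) < \<rho>" if "z \<in> Poles" for z
    using PE[OF that] by (simp add: D canonical_domain_def)
  have Fan: "F \<alpha> analytic_on {z}" if "z \<in> D" "z \<notin> Poles" for z \<alpha>
    using that by (intro nicely_meromorphic_on_imp_analytic_at[OF FD]) (auto simp: Poles vec_poles_def)
  have Gq: "G \<alpha> z = poly q z * F \<alpha> z" if "z \<in> D" "z \<notin> Poles" for z \<alpha>
  proof -
    have "poly q analytic_on {z}"
      by (rule analytic_on_subset[of _ UNIV]) (auto simp: analytic_on_open intro!: holomorphic_intros)
    then have "(\<lambda>z. poly q z * F \<alpha> z) analytic_on {z}" using Fan[OF that] by (rule analytic_on_mult)
    then show ?thesis unfolding G_def by (rule remove_sings_at_analytic)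
  qed
  have Gh: "G \<alpha> holomorphic_on D" for \<alpha>
    unfolding G_def q_def using fin mer oD
    by (intro analytic_imp_holomorphic cleared_analytic) (auto simp: Poles)
  interpret S: pade E \<Phi> \<rho> q G m
  proof unfold_locales
    show "1 < \<rho>" by (rule \<rho>1)
    show "lead_coeff q = 1" by (rule q_monic)
    show "\<zeta> \<notin> E \<and> ereal (norm (\<Phi> \<zeta>)) < \<rho>" if "poly q \<zeta> = 0" for \<zeta>
      using PE Poles\<rho> that q_root by blast
    show "G \<alpha> holomorphic_on dom \<rho>" for \<alpha> using Gh D by simp
    show "degree q \<le> (\<Sum>\<alpha>\<in>UNIV. m \<alpha>)" using q_deg ordM M by simp
    fix c :: "'d \<times> nat \<Rightarrow> complex" and h
    assume h: "h holomorphic_on ann \<rho>"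
      and eq: "\<And>x. x \<in> ann \<rho> \<Longrightarrow> (\<Sum>b\<in>Sigma UNIV (\<lambda>\<alpha>. {..<m \<alpha>}). c b * (\<Phi> x ^ snd b * G (fst b) x)) = poly q x * h x"
    \<comment> \<open>The coefficients \<open>c\<close> of a relation assemble into a vector
      \<open>v\<close> as in polewise independence: off the poles, division by \<open>q\<close>
      turns the relation into an equality of \<Sum> (v o \<Phi>) F with \<open>h\<close>.\<close>
    define v where "v = (\<lambda>\<alpha>. \<Sum>k<m \<alpha>. monom (c (\<alpha>, k)) k)"
    have cv: "coeff (v \<alpha>) k = (if k < m \<alpha> then c (\<alpha>, k) else 0)" for \<alpha> k
      by (simp add: v_def coeff_sum)
    let ?f = "\<lambda>z. \<Sum>\<alpha>\<in>UNIV. poly (v \<alpha>) (\<Phi> z) * F \<alpha> z"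
    have feq: "?f z = h z" if z: "z \<in> D - E" "z \<notin> Poles" for z
    proof -
      have za: "z \<in> ann \<rho>" using z(1) by (simp add: ann_eq D)
      have "poly q z * ?f z = (\<Sum>\<alpha>\<in>UNIV. \<Sum>k<m \<alpha>. c (\<alpha>, k) * (\<Phi> z ^ k * G \<alpha> z))"
        using Gq[of z] z by (simp add: v_def poly_sum poly_monom sum_distrib_left sum_distrib_right mult_ac)
      also have "\<dots> = (\<Sum>b\<in>Sigma UNIV (\<lambda>\<alpha>. {..<m \<alpha>}). c b * (\<Phi> z ^ snd b * G (fst b) z))"
        by (subst sum.Sigma) (auto simp: case_prod_beta)
      also have "\<dots> = poly q z * h z" by (rule eq[OF za])
      finally show ?thesis using q_root z by simp
    qed
    have "remove_sings ?f z = h z" if z: "z \<in> D - E" for z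
    proof (rule remove_sings_eqI)
      have "open (ann \<rho>)" by (rule open_ann)
      moreover have "z \<in> ann \<rho>" using z by (simp add: ann_eq D)
      ultimately have "h \<midarrow>z\<rightarrow> h z"
        using holomorphic_on_imp_continuous_on[OF h] by (auto simp: continuous_on_eq_continuous_at isCont_def)
      moreover have "eventually (\<lambda>w. h w = ?f w) (at z)"
      proof -
        have "eventually (\<lambda>w. w \<in> (ann \<rho> - (Poles - {z})) - {z}) (at z)"
          using open_ann fin \<open>z \<in> ann \<rho>\<close> by (intro eventually_at_in_open) (auto simp: open_Diff finite_imp_closed)
        then show ?thesis by eventually_elim (use feq in \<open>auto simp: ann_eq D\<close>)
      qed
      ultimately show "?f \<midarrow>z\<rightarrow> h z" by (rule Lim_transform_eventually)
    qed
    then have rh: "remove_sings ?f holomorphic_on (dom \<rho> - E)"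
      using h by (intro holomorphic_transform[OF h[unfolded ann_eq]]) (auto simp: D)
    have deg: "\<forall>\<alpha>. m \<alpha> \<ge> 1 \<longrightarrow> degree (v \<alpha>) \<le> m \<alpha> - 1"
      by (intro allI impI degree_le) (auto simp: cv)
    have zero: "\<forall>\<alpha>. m \<alpha> = 0 \<longrightarrow> v \<alpha> = 0" by (auto simp: v_def)
    have "\<forall>\<alpha>. v \<alpha> = 0"
    proof (rule ccontr)
      assume "\<not> (\<forall>\<alpha>. v \<alpha> = 0)"
      then have w: "(\<exists>\<alpha>. v \<alpha> \<noteq> 0) \<and> (\<forall>\<alpha>. m \<alpha> \<ge> 1 \<longrightarrow> degree (v \<alpha>) \<le> m \<alpha> - 1) \<and> (\<forall>\<alpha>. m \<alpha> = 0 \<longrightarrow> v \<alpha> = 0) \<and>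
          remove_sings ?f holomorphic_on (dom \<rho> - E)"
        using rh deg zero by simp
      show False
        by (rule notE[OF ind[unfolded polewise_independent_def]], rule exI[of _ v], rule w)
    qed
    then show "\<forall>b\<in>Sigma UNIV (\<lambda>\<alpha>. {..<m \<alpha>}). c b = 0"
      using cv by (metis (no_types, lifting) SigmaE coeff_0 lessThan_iff)
  qed
  have SM: "S.M = M" by (simp add: S.M_def M)
  have solves: "S.solves n Q' P'" if n: "Max (range m) \<le> n" and pf: "pade_faber E \<Phi> F m n Q' P'" for n Q' P'
    unfolding S.solves_def
  proof (intro conjI allI impI)
    show "Q' \<noteq> 0" "degree Q' \<le> S.M" using pf SM M by (auto simp: pade_faber_def)
    fix \<alpha>
    have "m \<alpha> \<le> Max (range m)" by (rule Max_ge) auto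
    then show "m \<alpha> \<le> n" using n by simp
    show "degree (P' \<alpha>) \<le> n - m \<alpha>" using pf by (simp add: pade_faber_def)
    fix s k assume s: "S.below s" and k: "k \<le> n"
    have s1: "1 < s" using s by (simp add: S.below_def)
    \<comment> \<open>\<open>faber_coeff_eq\<close> needs holomorphy on a domain of index beyond
      \<open>s\<close>, so a slightly larger level without poles inside is chosen.\<close>
    obtain s' where s': "s < s'" "ereal s' < \<rho>" "\<And>z. z \<in> Poles \<Longrightarrow> s' \<le> norm (\<Phi> z)"
    proof -
      obtain t where t: "ereal s < ereal t" "ereal t < \<rho>" using ereal_dense2[of "ereal s" \<rho>] s by (auto simp: S.below_def)
      define s' where "s' = Min (insert t ((\<lambda>z. norm (\<Phi> z)) ` Poles))"
      have "s < s'" unfolding s'_def using fin t s q_root by (subst Min_gr_iff) (auto simp: S.below_def)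
      moreover have "s' \<le> t" "\<And>z. z \<in> Poles \<Longrightarrow> s' \<le> norm (\<Phi> z)" unfolding s'_def using fin by (auto intro!: Min_le)
      ultimately show thesis using t by (intro that[of s']) (auto intro: ereal_le_less)
    qed
    have sub: "dom (ereal s') \<subseteq> D - Poles"
    proof
      fix z assume z: "z \<in> dom (ereal s')"
      have "z \<in> D" unfolding D using subsetD[OF dom_subset[OF less_imp_le[OF s'(2)]] z] .
      moreover have "z \<notin> Poles" using z s'(3)[of z] PE(2)[of z] by (auto simp: dom_ereal_iff)
      ultimately show "z \<in> D - Poles" by simp
    qed
    have os: "open (dom (ereal s'))" using connected_dom(1)[of "ereal s'"] s1 s'(1) by simp
    have Fh: "F \<alpha> holomorphic_on dom (ereal s')"
    proof -
      have "F \<alpha> analytic_on dom (ereal s')" using Fan sub by (subst analytic_on_analytic_at) auto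
      then show ?thesis by (rule analytic_imp_holomorphic)
    qed
    have "FC s (\<lambda>z. poly Q' z * G \<alpha> z / poly q z - poly (P' \<alpha>) z) k = FC s (\<lambda>z. poly Q' z * F \<alpha> z - poly (P' \<alpha>) z) k"
    proof (rule FC_cong[OF s1])
      fix z assume "z \<notin> E" "norm (\<Phi> z) = s"
      then have "z \<in> D - Poles" using sub s'(1) by (auto simp: dom_ereal_iff)
      then show "(poly Q' z * G \<alpha> z / poly q z - poly (P' \<alpha>) z) / \<Phi> z ^ (k + 1) = (poly Q' z * F \<alpha> z - poly (P' \<alpha>) z) / \<Phi> z ^ (k + 1)"
        using Gq[of z \<alpha>] q_root[of z] by simp
    qed
    also have "\<dots> = faber_coeff E \<Phi> (\<lambda>z. poly Q' z * F \<alpha> z - poly (P' \<alpha>) z) k"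
      by (rule faber_coeff_eq[symmetric, OF s1, of "ereal s'"]) (use s' Fh in \<open>auto intro!: holomorphic_intros\<close>)
    also have "\<dots> = 0" using pf k by (simp add: pade_faber_def)
    finally show "FC s (\<lambda>z. poly Q' z * G \<alpha> z / poly q z - poly (P' \<alpha>) z) k = 0" .
  qed
  obtain s0 where s0: "1 < s0" "\<And>s. 1 < s \<Longrightarrow> s < s0 \<Longrightarrow> S.below s" using S.below_exists by blast
  \<comment> \<open>The 1 serves until poles are known to exist; afterwards it does not affect the
    maximum.\<close>
  define x0 where "x0 = Max (insert 1 ((\<lambda>z. norm (\<Phi> z)) ` Poles))"
  have x0: "1 \<le> x0" "\<And>z. z \<in> Poles \<Longrightarrow> norm (\<Phi> z) \<le> x0" unfolding x0_def using fin by (auto intro!: Max_ge)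
  have x0\<rho>: "ereal x0 < \<rho>"
  proof -
    have "x0 \<in> insert 1 ((\<lambda>z. norm (\<Phi> z)) ` Poles)" unfolding x0_def using fin by (intro Max_in) auto
    then show ?thesis using \<rho>1 Poles\<rho> by (auto simp: one_ereal_def)
  qed
  have above: "S.above r" if "x0 < r" "ereal r < \<rho>" for r
    unfolding S.above_def using that x0 q_root by (auto intro: le_less_trans)
  have below_lt: "\<exists>s. S.below s \<and> 1 < s \<and> s < t" if "1 < t" for t
    using s0(2)[of "(1 + min t s0) / 2"] that s0(1) by (intro exI[of _ "(1 + min t s0) / 2"]) (auto simp: min_def)
  obtain x1 where x1: "x0 < x1" "ereal x1 < \<rho>" using ereal_dense2[OF x0\<rho>] by auto
  \<comment> \<open>Without poles \<open>q\<close> would have degree 0, whereas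
    \<open>spanning\<close> makes its degree M > 0.\<close>
  have Pne: "Poles \<noteq> {}"
  proof
    assume "Poles = {}"
    then have "degree q = 0" using q_deg by simp
    moreover obtain s where "S.below s" "1 < s" "s < x1" using below_lt[of x1] x0 x1 by auto
    then have "degree q = M" using S.spanning(1)[OF _ above[OF x1]] SM by simp
    moreover have "M \<noteq> 0" using m M by (simp add: sum_eq_0_iff)
    ultimately show False by simp
  qed
  have x0_eq: "x0 = Max ((\<lambda>\<zeta>. norm (\<Phi> \<zeta>)) ` Poles)"
  proof -
    have "1 \<le> Max ((\<lambda>\<zeta>. norm (\<Phi> \<zeta>)) ` Poles)"
    proof -
      obtain z where z: "z \<in> Poles" using Pne by blast
      have "norm (\<Phi> z) \<le> Max ((\<lambda>\<zeta>. norm (\<Phi> \<zeta>)) ` Poles)" using z fin by (intro Max_ge) auto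
      then show ?thesis using norm_Phi[OF PE(2)[OF z]] by linarith
    qed
    then show ?thesis unfolding x0_def using fin Pne by (subst Max_insert) auto
  qed
  have x0_1: "1 < x0"
  proof -
    obtain z where z: "z \<in> Poles" using Pne by blast
    show ?thesis using x0(2)[OF z] norm_Phi[OF PE(2)[OF z]] by linarith
  qed
  show ?thesis
  proof (intro conjI allI impI)
    obtain r where r: "x1 < r" "ereal r < \<rho>" using ereal_dense2[OF x1(2)] by auto
    obtain s where s: "S.below s" "1 < s" "s < x1" using below_lt[of x1] x0 x1 by auto
    obtain n0 where n0: "\<forall>n\<ge>n0. \<forall>Q P Q' P'. S.solves n Q P \<longrightarrow> S.solves n Q' P' \<longrightarrow> (\<forall>\<alpha>. P' \<alpha> * Q = P \<alpha> * Q')"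
      using S.solution_unique[OF s(1) above[OF x1] s(3) r] by blast
    show "\<forall>\<^sub>F n in sequentially. \<forall>Q' P'. pade_faber E \<Phi> F m n Q' P' \<longrightarrow>
        (\<forall>\<alpha>. Fract (P' \<alpha>) Q' = Fract (P n \<alpha>) (Q n))"
      unfolding eventually_sequentially
    proof (intro exI[of _ "max n0 (Max (range m))"] allI impI)
      fix n Q' P' \<alpha> assume n: "max n0 (Max (range m)) \<le> n" and pf: "pade_faber E \<Phi> F m n Q' P'"
      have n': "n0 \<le> n" "Max (range m) \<le> n" using n by auto
      have a: "S.solves n (Q n) (P n)" and b: "S.solves n Q' P'"
        using solves[OF n'(2) sol[OF n'(2)]] solves[OF n'(2) pf] by auto
      have "P' \<alpha> * Q n = P n \<alpha> * Q'" using n0 n'(1) a b by blast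
      moreover have "Q n \<noteq> 0" "Q' \<noteq> 0" using a b by (auto simp: S.solves_def)
      ultimately show "Fract (P' \<alpha>) Q' = Fract (P n \<alpha>) (Q n)" by (simp add: eq_fract)
    qed
  next
    fix \<alpha> K assume K: "compact K \<and> K \<subseteq> D - Poles"
    obtain x where x: "x1 \<le> x" "ereal x < \<rho>" "K \<subseteq> sublevel x"
      using compact_in_sublevel[of K \<rho> x1] K x0 x1 D by auto
    define \<sigma> where "\<sigma> = map_norm E \<Phi> K"
    have \<sigma>: "1 \<le> \<sigma>" "\<sigma> \<le> x" "\<And>z. z \<in> K \<Longrightarrow> z \<notin> E \<Longrightarrow> norm (\<Phi> z) \<le> \<sigma>"
      using map_norm_props[OF x(3)] x x0 x1 unfolding \<sigma>_def by auto
    \<comment> \<open>\<open>U\<close> above \<sigma> absorbs the auxiliary level \<open>s1\<close>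
      > 1 that replaces |\<Phi>| on and near \<open>E\<close>; \<open>r\<close> approaches \<rho>
      independently.\<close>
    have claim: "\<exists>C n0. C > 0 \<and> (\<forall>n\<ge>n0. \<forall>z\<in>K. norm (F \<alpha> z - poly (P n \<alpha>) z / poly (Q n) z) \<le> C * (U / r) ^ n)"
      if U: "\<sigma> < U" and r: "x < r" "ereal r < \<rho>" for U r
    proof -
      have "1 < min U r" using U r \<sigma> x x0 x1 by auto
      then obtain s3 where s3: "S.below s3" "1 < s3" "s3 < min U r" using below_lt by blast
      define s1 where "s1 = (1 + s3) / 2"
      have s1: "1 < s1" "s1 < s3" using s3 by (auto simp: s1_def)
      have ar: "S.above r" using r x x1 by (intro above) auto
      have Kr: "K \<subseteq> sublevel r" using x(3) r by force
      have qK: "poly q z \<noteq> 0" "G \<alpha> z = poly q z * F \<alpha> z" if "z \<in> K" for z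
        using K that q_root Gq by auto
      obtain C n0 where C: "C > 0"
        "\<And>n Q P z. n0 \<le> n \<Longrightarrow> S.solves n Q P \<Longrightarrow> z \<in> K \<Longrightarrow>
           norm (F \<alpha> z - poly (P \<alpha>) z / poly Q z) \<le> C * (max s1 \<sigma> / r) ^ n"
        using S.conv_estimate[of K r \<alpha> "F \<alpha>" s1 s3 \<sigma>] K Kr qK s1 s3 ar \<sigma> by auto
      have r0: "0 < r" using \<sigma> r by linarith
      show ?thesis
      proof (intro exI[of _ C] exI[of _ "max n0 (Max (range m))"] conjI allI impI ballI C(1))
        fix n z assume n: "max n0 (Max (range m)) \<le> n" and z: "z \<in> K"
        have "norm (F \<alpha> z - poly (P n \<alpha>) z / poly (Q n) z) \<le> C * (max s1 \<sigma> / r) ^ n"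
          using n z by (intro C(2) solves sol) auto
        also have "\<dots> \<le> C * (U / r) ^ n"
          using C(1) r0 s1 s3 U \<sigma> by (intro mult_left_mono power_mono divide_right_mono) auto
        finally show "norm (F \<alpha> z - poly (P n \<alpha>) z / poly (Q n) z) \<le> C * (U / r) ^ n" .
      qed
    qed
    show "uniform_limit K (\<lambda>n z. poly (P n \<alpha>) z / poly (Q n) z) (F \<alpha>) sequentially"
    proof (rule uniform_limitI)
      fix e :: real assume e: "0 < e"
      obtain r where r: "x < r" "ereal r < \<rho>" using ereal_dense2[OF x(2)] by auto
      define U where "U = (\<sigma> + r) / 2"
      have U: "\<sigma> < U" "U < r" "0 < U" using \<sigma> r by (auto simp: U_def)
      obtain C n0 where C: "C > 0" "\<And>n z. n0 \<le> n \<Longrightarrow> z \<in> K \<Longrightarrow> norm (F \<alpha> z - poly (P n \<alpha>) z / poly (Q n) z) \<le> C * (U / r) ^ n"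
        using claim[OF U(1) r] by blast
      have "(\<lambda>n. C * (U / r) ^ n) \<longlonglongrightarrow> C * 0" using U by (intro tendsto_intros LIMSEQ_power_zero) auto
      then have "eventually (\<lambda>n. C * (U / r) ^ n < e) sequentially" by (rule order_tendstoD) (use e in simp)
      then show "\<forall>\<^sub>F n in sequentially. \<forall>z\<in>K. dist (poly (P n \<alpha>) z / poly (Q n) z) (F \<alpha> z) < e"
        using eventually_ge_at_top[of n0]
      proof eventually_elim
        case (elim n)
        show ?case
        proof
          fix z assume "z \<in> K"
          from C(2)[OF elim(2) this] elim(1) show "dist (poly (P n \<alpha>) z / poly (Q n) z) (F \<alpha> z) < e"
            by (simp add: dist_norm norm_minus_commute)
        qed
      qed
    qed
    show "limsup (\<lambda>n. ereal (root n (sup_norm K (\<lambda>z. F \<alpha> z - poly (P n \<alpha>) z / poly (Q n) z))))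
          \<le> ereal (map_norm E \<Phi> K) / \<rho>"
      unfolding \<sigma>_def[symmetric]
    proof (rule le_ereal_divide[of x])
      show "0 < x" using \<sigma> by linarith
      fix U r assume U: "\<sigma> < U" and r: "x < r" "ereal r < \<rho>"
      have Ur: "0 \<le> U / r" using U r \<sigma> by simp
      obtain C n0 where C: "C > 0" "\<And>n z. n0 \<le> n \<Longrightarrow> z \<in> K \<Longrightarrow> norm (F \<alpha> z - poly (P n \<alpha>) z / poly (Q n) z) \<le> C * (U / r) ^ n"
        using claim[OF U(1) r] by blast
      show "limsup (\<lambda>n. ereal (root n (sup_norm K (\<lambda>z. F \<alpha> z - poly (P n \<alpha>) z / poly (Q n) z)))) \<le> ereal (U / r)"
      proof (rule limsup_root_le[OF _ C(1) Ur])
        show "\<forall>\<^sub>F n in sequentially. 0 \<le> sup_norm K (\<lambda>z. F \<alpha> z - poly (P n \<alpha>) z / poly (Q n) z) \<and>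
           sup_norm K (\<lambda>z. F \<alpha> z - poly (P n \<alpha>) z / poly (Q n) z) \<le> C * (U / r) ^ n"
          using eventually_ge_at_top[of n0]
        proof eventually_elim
          case (elim n)
          have "0 \<le> C * (U / r) ^ n" using C(1) Ur by simp
          then show ?case using sup_norm_bounds[of K "\<lambda>z. F \<alpha> z - poly (P n \<alpha>) z / poly (Q n) z"] C(2)[OF elim] by blast
        qed
      qed
    qed (rule x(2))
  next
    assume z0: "0 \<notin> Poles"
    define L where "L = pole_threshold \<Phi> F D"
    have L: "L < norm (\<Phi> \<zeta>)" if "\<zeta> \<in> Poles" for \<zeta>
    proof -
      have "Min ((\<lambda>\<zeta>. norm (\<Phi> \<zeta>)) ` Poles) \<le> norm (\<Phi> \<zeta>)" using that fin by (intro Min_le) auto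
      moreover have "1 < norm (\<Phi> \<zeta>)" using norm_Phi[OF PE(2)[OF that]] .
      moreover have "(1 + a) / 2 < c" if "a \<le> c" "1 < c" for a c :: real using that by (simp add: field_simps)
      ultimately show ?thesis unfolding L_def pole_threshold_def Poles[symmetric] by blast
    qed
    have pp: "pole_poly F D = smult (1 / poly q 0) q"
      unfolding pole_poly_def q_def pole_denominator_def using fin z0 unfolding Poles by (rule prod_one_minus_quotient)
    have q0: "poly q 0 \<noteq> 0" using z0 q_root by simp
    show "limsup (\<lambda>n. ereal (root n (coeff_norm M (normalized_poly E \<Phi> (pole_threshold \<Phi> F D) (Q n) - pole_poly F D))))
          \<le> ereal (Max ((\<lambda>\<zeta>. norm (\<Phi> \<zeta>)) ` Poles)) / \<rho>"
      unfolding L_def[symmetric] pp x0_eq[symmetric]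
    proof (rule le_ereal_divide[of x0])
      show "0 < x0" using x0 by linarith
      fix U r assume U: "x0 < U" and r: "x0 < r" "ereal r < \<rho>"
      \<comment> \<open>\<open>r0\<close> must exceed \<open>x0\<close> and stay below
        \<open>r\<close>, as the midpoint does, while r0 \<le> U yields the rate U / r.\<close>
      define r0 where "r0 = min U ((x0 + r) / 2)"
      have r0: "x0 < r0" "r0 < r" "r0 \<le> U" "1 < r0" using U r x0 unfolding r0_def by (auto simp: min_def)
      have ar0: "S.above r0" using r0 r by (intro above) (auto intro: ereal_less_less)
      obtain s where s: "S.below s" "1 < s" "s < r0" using below_lt[OF r0(4)] by blast
      obtain C n0 where C: "C > 0"
        "\<And>n Q P. n0 \<le> n \<Longrightarrow> S.solves n Q P \<Longrightarrow>
           coeff_norm M (normalized_poly E \<Phi> L Q - smult (1 / poly q 0) q) \<le> C * (r0 / r) ^ n"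
        using S.denominator_estimate[OF s(1) ar0 s(3) r0(2) r(2) q0, of L] L q_root unfolding SM by blast
      have "limsup (\<lambda>n. ereal (root n (coeff_norm M (normalized_poly E \<Phi> L (Q n) - smult (1 / poly q 0) q)))) \<le> ereal (r0 / r)"
      proof (rule limsup_root_le[OF _ C(1)])
        show "0 \<le> r0 / r" using r0 by simp
        have nn: "0 \<le> coeff_norm M p" for p
          unfolding coeff_norm_def by (rule order_trans[OF norm_ge_zero Max_ge]) auto
        show "\<forall>\<^sub>F n in sequentially. 0 \<le> coeff_norm M (normalized_poly E \<Phi> L (Q n) - smult (1 / poly q 0) q) \<and>
            coeff_norm M (normalized_poly E \<Phi> L (Q n) - smult (1 / poly q 0) q) \<le> C * (r0 / r) ^ n"
          using eventually_ge_at_top[of n0] eventually_ge_at_top[of "Max (range m)"]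
          by eventually_elim (use nn C(2) solves sol in blast)
      qed
      also have "ereal (r0 / r) \<le> ereal (U / r)" using r0 by (simp add: divide_right_mono)
      finally show "limsup (\<lambda>n. ereal (root n (coeff_norm M (normalized_poly E \<Phi> L (Q n) - smult (1 / poly q 0) q)))) \<le> ereal (U / r)" .
    qed (rule x0\<rho>)
  qed
qed

end

theorem theorem1:
  fixes E :: "complex set"
    and \<Phi> :: "complex \<Rightarrow> complex"
    and F :: "'d::finite \<Rightarrow> complex \<Rightarrow> complex"
    and m :: "'d \<Rightarrow> nat"
    and Q :: "nat \<Rightarrow> complex poly"
    and P :: "nat \<Rightarrow> 'd \<Rightarrow> complex poly"
    and M :: nat and \<rho> :: ereal and D Poles :: "complex set"
  defines "M \<equiv> \<Sum>\<alpha>\<in>UNIV. m \<alpha>"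
    and "\<rho> \<equiv> mero_index E \<Phi> M F"
    and "D \<equiv> canonical_domain E \<Phi> \<rho>"
    and "Poles \<equiv> vec_poles F D"
  assumes "compact E"
    and "\<exists>x\<in>E. \<exists>y\<in>E. x \<noteq> y"
    and "simply_connected (sphere_complement E)"
    and "exterior_map E \<Phi>"
    and "\<And>\<alpha>. F \<alpha> analytic_on E"
    and "\<And>\<alpha>. F \<alpha> nicely_meromorphic_on D"
    and "\<exists>\<alpha>. m \<alpha> \<noteq> 0"
    and "polewise_independent E \<Phi> F m \<rho>"
    and "\<And>n. n \<ge> Max (range m) \<Longrightarrow> pade_faber E \<Phi> F m n (Q n) (P n)"
  shows
    "(\<forall>\<^sub>F n in sequentially. \<forall>Q' P'. pade_faber E \<Phi> F m n Q' P' \<longrightarrow>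
        (\<forall>\<alpha>. Fract (P' \<alpha>) Q' = Fract (P n \<alpha>) (Q n))) \<and>
     (\<forall>\<alpha> K. compact K \<and> K \<subseteq> D - Poles \<longrightarrow>
        uniform_limit K (\<lambda>n z. poly (P n \<alpha>) z / poly (Q n) z) (F \<alpha>) sequentially \<and>
        limsup (\<lambda>n. ereal (root n (sup_norm K (\<lambda>z. F \<alpha> z - poly (P n \<alpha>) z / poly (Q n) z))))
          \<le> ereal (map_norm E \<Phi> K) / \<rho>) \<and>
     (0 \<notin> Poles \<longrightarrow>
        limsup (\<lambda>n. ereal (root n (coeff_norm M
            (normalized_poly E \<Phi> (pole_threshold \<Phi> F D) (Q n) - pole_poly F D))))
          \<le> ereal (Max ((\<lambda>\<zeta>. norm (\<Phi> \<zeta>)) ` Poles)) / \<rho>)"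
proof -
  interpret exterior E \<Phi>
    using assms by unfold_locales auto
  show ?thesis
    unfolding Poles_def D_def \<rho>_def M_def
    by (rule pade_faber_convergence[OF refl refl refl refl])
       (use assms in \<open>simp_all add: Poles_def D_def \<rho>_def M_def\<close>)
qed

end
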